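(* Let $X=(X_t)_{t\in[0,T]}$ be a centered real-valued bi-measurable Gaussian process with continuous covariance function, with Karhunen-Loève eigensystem $(e_k^X,\lambda_k^X)_{k\ge1}$ (where $\lambda_k^X>0$ and the $e_k^X$ are the continuous versions). Let $0=t_0\le t_1\le\cdots\le t_n=T$, $d\ge1$, $V=(X_{t_0},\dots,X_{t_n})^{\top}$ and $Y=\big(\int_0^TX_se_1^X(s)ds,\dots,\int_0^TX_se_d^X(s)ds\big)^{\top}$. Let $R_{V|Y}=(e_j^X(t_i))_{0\le i\le n,\,1\le j\le d}$ and let $R_{Y|V}$ be a $d\times(n+1)$ matrix such that $\mathbb{E}[Y\mid V]=R_{Y|V}V$ a.s. Consider a random vector $(\widetilde V,G)$ such that $\widetilde V$ has the distribution of $V$ and, conditionally on $\widetilde V$, $$G\sim\mathcal N\Big(R_{Y|V}\widetilde V,\ \mathrm{cov}(Y)-R_{Y|V}\,\mathrm{cov}(V)\,R_{Y|V}^{\top}\Big),$$ and set $Z=\widetilde V-R_{V|Y}G$. Then, for every $y\in\mathbb{R}^d$, the random vector $R_{V|Y}\,y+Z$ has distribution $\mathcal L(V\mid Y=y)$.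
   Context: The Karhunen-Loève eigensystem of $X$ is the system of orthonormal eigenvectors $e_k^X$ in $L^2([0,T],dt)$ and nonzero eigenvalues $\lambda_1^X\ge\lambda_2^X\ge\cdots>0$ (repeated with multiplicity) of the covariance operator $f\mapsto\int_0^T\mathbb{E}[X_sX_\cdot]f(s)\,ds$. $\mathcal L(V\mid Y=y)$ denotes the regular conditional distribution given by the Gaussian transition kernel $\nu(y,\cdot)=\mathcal N\big(a(y),\mathrm{cov}(V-\mathbb{E}[V\mid Y])\big)$, where $a:\mathbb{R}^d\to\mathbb{R}^{n+1}$ is the affine regression function with $\mathbb{E}[V\mid Y]=a(Y)$; Gaussian distributions may be degenerate. *)

theory Defs
  imports "HOL-Probability.Probability" "HOL-Library.Extended_Nat"
begin

text \<open>
  For a finite index set \<open>I\<close>, the vectors of the Euclidean space indexed by \<open>I\<close> are the extensional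
  functions on \<open>I\<close>; matrices are plain functions of two indices, of which only the entries inside
  the relevant index sets matter.
\<close>

abbreviation borel_vec :: "'i set \<Rightarrow> ('i \<Rightarrow> real) measure" where
  "borel_vec I \<equiv> Pi\<^sub>M I (\<lambda>_. borel)"

abbreviation vecs :: "'i set \<Rightarrow> ('i \<Rightarrow> real) set" where
  "vecs I \<equiv> I \<rightarrow>\<^sub>E UNIV"

definition mat_vec :: "'j set \<Rightarrow> ('i \<Rightarrow> 'j \<Rightarrow> real) \<Rightarrow> ('j \<Rightarrow> real) \<Rightarrow> 'i \<Rightarrow> real" where
  "mat_vec J A x i = (\<Sum>j\<in>J. A i j * x j)"

definition mat_mul :: "'j set \<Rightarrow> ('i \<Rightarrow> 'j \<Rightarrow> real) \<Rightarrow> ('j \<Rightarrow> 'k \<Rightarrow> real) \<Rightarrow> 'i \<Rightarrow> 'k \<Rightarrow> real" where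
  "mat_mul J A B i k = (\<Sum>j\<in>J. A i j * B j k)"

definition mat_transpose :: "('i \<Rightarrow> 'j \<Rightarrow> real) \<Rightarrow> 'j \<Rightarrow> 'i \<Rightarrow> real" where
  "mat_transpose A j i = A i j"

definition cov_mat :: "'a measure \<Rightarrow> ('a \<Rightarrow> 'i \<Rightarrow> real) \<Rightarrow> 'i \<Rightarrow> 'i \<Rightarrow> real" where
  "cov_mat M W i k =
     (\<integral>\<omega>. (W \<omega> i - (\<integral>\<omega>'. W \<omega>' i \<partial>M)) * (W \<omega> k - (\<integral>\<omega>'. W \<omega>' k \<partial>M)) \<partial>M)"


text \<open>The one-dimensional Gaussian law with mean \<open>m\<close> and variance \<open>v \<ge> 0\<close>, a point mass if \<open>v = 0\<close>.\<close>

definition normal_real :: "real \<Rightarrow> real \<Rightarrow> real measure" where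
  "normal_real m v =
     (if v = 0 then return borel m
      else density lborel (\<lambda>x. ennreal (normal_density m (sqrt v) x)))"

text \<open>
  \<open>\<mu>\<close> is the (possibly degenerate) Gaussian law with mean vector \<open>m\<close> and covariance matrix \<open>C\<close>.
  Since \<^const>\<open>normal_density\<close> depends on the square of its second argument only, the
  nonnegativity of the quadratic form has to be required explicitly.
\<close>

definition is_normal ::
  "'i set \<Rightarrow> ('i \<Rightarrow> real) \<Rightarrow> ('i \<Rightarrow> 'i \<Rightarrow> real) \<Rightarrow> ('i \<Rightarrow> real) measure \<Rightarrow> bool" where
  "is_normal I m C \<mu> \<longleftrightarrow>
     prob_space \<mu> \<and> sets \<mu> = sets (borel_vec I) \<and>
     (\<forall>i\<in>I. \<forall>k\<in>I. C i k = C k i) \<and>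
     (\<forall>u. 0 \<le> (\<Sum>i\<in>I. \<Sum>k\<in>I. u i * C i k * u k)) \<and>
     (\<forall>u. distr \<mu> borel (\<lambda>x. \<Sum>i\<in>I. u i * x i) =
          normal_real (\<Sum>i\<in>I. u i * m i) (\<Sum>i\<in>I. \<Sum>k\<in>I. u i * C i k * u k))"

definition gaussian_process :: "real \<Rightarrow> 'a measure \<Rightarrow> (real \<Rightarrow> 'a \<Rightarrow> real) \<Rightarrow> bool" where
  "gaussian_process T M X \<longleftrightarrow>
     (\<forall>t\<in>{0..T}. X t \<in> borel_measurable M) \<and>
     (\<forall>S. finite S \<and> S \<subseteq> {0..T} \<longrightarrow>
        (\<exists>m C. is_normal S m C (distr M (borel_vec S) (\<lambda>\<omega>. \<lambda>s\<in>S. X s \<omega>))))"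

definition bimeasurable :: "real \<Rightarrow> 'a measure \<Rightarrow> (real \<Rightarrow> 'a \<Rightarrow> real) \<Rightarrow> bool" where
  "bimeasurable T M X \<longleftrightarrow>
     (\<lambda>(t, \<omega>). X t \<omega>) \<in> borel_measurable (restrict_space borel {0..T} \<Otimes>\<^sub>M M)"

definition cov_fun :: "'a measure \<Rightarrow> (real \<Rightarrow> 'a \<Rightarrow> real) \<Rightarrow> real \<Rightarrow> real \<Rightarrow> real" where
  "cov_fun M X s t = (\<integral>\<omega>. X s \<omega> * X t \<omega> \<partial>M)"

definition cov_op :: "real \<Rightarrow> 'a measure \<Rightarrow> (real \<Rightarrow> 'a \<Rightarrow> real) \<Rightarrow> (real \<Rightarrow> real) \<Rightarrow> real \<Rightarrow> real" where
  "cov_op T M X f t = (LINT s:{0..T}|lborel. cov_fun M X s t * f s)"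


text \<open>Square-integrable functions on \<open>[0,T]\<close> are represented by Borel functions; equality in
  \<open>L\<^sup>2([0,T],dt)\<close> is equality almost everywhere on \<open>[0,T]\<close>.\<close>

definition in_L2 :: "real \<Rightarrow> (real \<Rightarrow> real) \<Rightarrow> bool" where
  "in_L2 T f \<longleftrightarrow>
     set_borel_measurable lborel {0..T} f \<and> set_integrable lborel {0..T} (\<lambda>t. (f t)\<^sup>2)"

definition eq_L2 :: "real \<Rightarrow> (real \<Rightarrow> real) \<Rightarrow> (real \<Rightarrow> real) \<Rightarrow> bool" where
  "eq_L2 T f g \<longleftrightarrow> (AE t in lborel. t \<in> {0..T} \<longrightarrow> f t = g t)"

definition inner_L2 :: "real \<Rightarrow> (real \<Rightarrow> real) \<Rightarrow> (real \<Rightarrow> real) \<Rightarrow> real" where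
  "inner_L2 T f g = (LINT t:{0..T}|lborel. f t * g t)"

text \<open>
  The eigensystem is indexed by \<open>1, \<dots>, N\<close>, where \<open>N \<le> \<infinity>\<close> is the rank of the covariance operator.
  The last clause says that every nonzero eigenvalue \<open>\<mu>\<close> is listed with its full multiplicity: the
  \<open>e k\<close> with \<open>lam k = \<mu>\<close> span the eigenspace of \<open>\<mu>\<close>.
\<close>

definition kl_index :: "enat \<Rightarrow> nat set" where
  "kl_index N = {k. 1 \<le> k \<and> enat k \<le> N}"

definition KL_eigensystem ::
  "real \<Rightarrow> 'a measure \<Rightarrow> (real \<Rightarrow> 'a \<Rightarrow> real) \<Rightarrow> enat \<Rightarrow> (nat \<Rightarrow> real \<Rightarrow> real) \<Rightarrow> (nat \<Rightarrow> real) \<Rightarrow> bool"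
where
  "KL_eigensystem T M X N e lam \<longleftrightarrow>
     (\<forall>k\<in>kl_index N. in_L2 T (e k)) \<and>
     (\<forall>k\<in>kl_index N. \<forall>l\<in>kl_index N. inner_L2 T (e k) (e l) = (if k = l then 1 else 0)) \<and>
     (\<forall>k\<in>kl_index N. eq_L2 T (cov_op T M X (e k)) (\<lambda>t. lam k * e k t)) \<and>
     (\<forall>k\<in>kl_index N. lam k > 0) \<and>
     (\<forall>k\<in>kl_index N. \<forall>l\<in>kl_index N. k \<le> l \<longrightarrow> lam l \<le> lam k) \<and>
     (\<forall>\<mu> f. \<mu> \<noteq> 0 \<and> in_L2 T f \<and> eq_L2 T (cov_op T M X f) (\<lambda>t. \<mu> * f t) \<longrightarrow>
        (\<exists>S c. finite S \<and> S \<subseteq> {k \<in> kl_index N. lam k = \<mu>} \<and>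
               eq_L2 T f (\<lambda>t. \<Sum>k\<in>S. c k * e k t)))"


text \<open>The conditional expectation of \<open>f\<close> given a random element \<open>U\<close> with values in \<open>L\<close>.\<close>

definition cond_exp_given ::
  "'a measure \<Rightarrow> ('a \<Rightarrow> 'b) \<Rightarrow> 'b measure \<Rightarrow> ('a \<Rightarrow> real) \<Rightarrow> 'a \<Rightarrow> real" where
  "cond_exp_given M U L f = real_cond_exp M (vimage_algebra (space M) U L) f"

text \<open>\<open>\<kappa>\<close> is a regular version of the conditional distribution of \<open>W\<close> (with values in \<open>N\<close>)
  given \<open>U\<close> (with values in \<open>L\<close>).\<close>

definition regular_cond_distr ::
  "'a measure \<Rightarrow> ('a \<Rightarrow> 'c) \<Rightarrow> 'c measure \<Rightarrow> ('a \<Rightarrow> 'b) \<Rightarrow> 'b measure \<Rightarrow> ('b \<Rightarrow> 'c measure) \<Rightarrow> bool"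
where
  "regular_cond_distr M W N U L \<kappa> \<longleftrightarrow>
     \<kappa> \<in> L \<rightarrow>\<^sub>M prob_algebra N \<and>
     (\<forall>B\<in>sets N. AE \<omega> in M.
        cond_exp_given M U L (\<lambda>\<omega>'. indicator B (W \<omega>')) \<omega> = measure (\<kappa> (U \<omega>)) B)"

definition affine_regression ::
  "'a measure \<Rightarrow> 'i set \<Rightarrow> ('a \<Rightarrow> 'i \<Rightarrow> real) \<Rightarrow> 'j set \<Rightarrow> ('a \<Rightarrow> 'j \<Rightarrow> real) \<Rightarrow>
    (('j \<Rightarrow> real) \<Rightarrow> 'i \<Rightarrow> real) \<Rightarrow> bool"
where
  "affine_regression M I V J Y a \<longleftrightarrow>
     (\<exists>A b. \<forall>y\<in>vecs J. \<forall>i\<in>I. a y i = mat_vec J A y i + b i) \<and>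
     (\<forall>i\<in>I. AE \<omega> in M. cond_exp_given M Y (borel_vec J) (\<lambda>\<omega>'. V \<omega>' i) \<omega> = a (Y \<omega>) i)"

text \<open>\<open>\<nu>\<close> is the Gaussian transition kernel that is a regular conditional distribution of \<open>V\<close>
  given \<open>Y\<close>.\<close>

definition gaussian_cond_kernel ::
  "'a measure \<Rightarrow> 'i set \<Rightarrow> ('a \<Rightarrow> 'i \<Rightarrow> real) \<Rightarrow> 'j set \<Rightarrow> ('a \<Rightarrow> 'j \<Rightarrow> real) \<Rightarrow>
    (('j \<Rightarrow> real) \<Rightarrow> ('i \<Rightarrow> real) measure) \<Rightarrow> bool"
where
  "gaussian_cond_kernel M I V J Y \<nu> \<longleftrightarrow>
     regular_cond_distr M V (borel_vec I) Y (borel_vec J) \<nu> \<and>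
     (\<exists>a. affine_regression M I V J Y a \<and>
        (\<forall>y\<in>vecs J. is_normal I (a y)
           (cov_mat M (\<lambda>\<omega> i. V \<omega> i - cond_exp_given M Y (borel_vec J) (\<lambda>\<omega>'. V \<omega>' i) \<omega>))
           (\<nu> y)))"

text \<open>
  The law \<open>\<L>(V | Y = y)\<close>. It is well defined when \<open>V, Y\<close> are jointly Gaussian with \<open>cov(Y)\<close>
  nonsingular: the affine map \<open>a\<close> is then unique on the whole space, not only almost everywhere.
\<close>

definition cond_law ::
  "'a measure \<Rightarrow> 'i set \<Rightarrow> ('a \<Rightarrow> 'i \<Rightarrow> real) \<Rightarrow> 'j set \<Rightarrow> ('a \<Rightarrow> 'j \<Rightarrow> real) \<Rightarrow>
    ('j \<Rightarrow> real) \<Rightarrow> ('i \<Rightarrow> real) measure"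
where
  "cond_law M I V J Y y = (THE \<mu>. \<exists>\<nu>. gaussian_cond_kernel M I V J Y \<nu> \<and> \<mu> = \<nu> y)"

end

theory Submission
  imports Defs
begin

text \<open>
  The pair \<open>(V, Y)\<close> is centered and jointly Gaussian, \<open>cov(Y)\<close> is the diagonal matrix of the first
  \<open>d\<close> eigenvalues, and \<open>cov(V\<^sub>i, Y\<^sub>j)\<close> is the covariance operator applied to \<open>e\<^sub>j\<close> and evaluated
  at \<open>t\<^sub>i\<close>, that is \<open>\<lambda>\<^sub>j e\<^sub>j(t\<^sub>i)\<close>. Hence \<open>V = R Y + U\<close>, where \<open>R\<close> is the matrix of the \<open>e\<^sub>j(t\<^sub>i)\<close> and
  the residual \<open>U\<close> is uncorrelated with \<open>Y\<close>, so independent of it. Therefore \<open>E[V | Y] = R Y\<close>,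
  and \<open>y \<mapsto> law of R y + U\<close> is a Gaussian transition kernel that disintegrates the law of \<open>V\<close> along
  \<open>Y\<close> (\<open>regular_cond_distr_kernel\<close>, \<open>is_normal_kernel\<close>). Because all eigenvalues involved are
  positive, the affine regression function is unique on the whole space
  (\<open>affine_regression_unique\<close>), and so the kernel is the only candidate for the conditional law
  (\<open>cond_law_eq_kernel\<close>).

  The recipe for \<open>(V', G)\<close> draws the two blocks in the reversed order: first the law of \<open>V\<close>, then
  the Gaussian conditional law of \<open>Y\<close> given \<open>V\<close>. Its joint characteristic function is therefore
  that of \<open>(V, Y)\<close>, which is Pythagoras for the orthogonal decomposition of \<open>Y\<close> into \<open>E[Y | V]\<close>
  and an error (\<open>reversed_sampling_char\<close>). Consequently \<open>Z = V' - R G\<close> has the law of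
  \<open>U = V - R Y\<close>, and \<open>R y + Z\<close> has the law given by the kernel at \<open>y\<close>.

  Two facts carry the analysis. A finite measure on a finite product of real lines is determined by
  its characteristic function (\<open>char_unique_PiM\<close>); this turns every statement about Gaussian vectors
  into a computation with exponentials of quadratic forms. And a linear combination of values of the
  process and of an integral of its paths against a continuous function is Gaussian
  (\<open>process_integral_centered_gaussian\<close>), because the integral is a limit in mean square of
  integrals of step functions, which are finite linear combinations of values of the process.
\<close>

section \<open>Real Gaussian laws\<close>

text \<open>Presenting every normal law, point masses included, as an affine image of the standard one
  reduces characteristic functions and moments to the standard case without case distinctions.\<close>
lemma normal_real_eq_distr:
  assumes "0 \<le> v"
  shows "normal_real m v = distr std_normal_distribution borel (\<lambda>x. m + sqrt v * x)"
proof (cases "v = 0")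
  case True
  interpret prob_space std_normal_distribution
    by (rule prob_space_normal_density) simp
  show ?thesis
    using True by (simp add: normal_real_def distr_const)
next
  case False
  then have v: "0 < sqrt v" using assms by simp
  interpret prob_space std_normal_distribution
    by (rule prob_space_normal_density) simp
  have "distributed std_normal_distribution lborel (\<lambda>x. x) std_normal_density"
    by (auto simp: distributed_def intro!: measure_eqI simp: emeasure_distr)
  from normal_density_affine[OF this, of "sqrt v" m] v
  have "distributed std_normal_distribution lborel (\<lambda>x. m + sqrt v * x) (normal_density m (sqrt v))"
    by simp
  then have "distr std_normal_distribution lborel (\<lambda>x. m + sqrt v * x) = density lborel (normal_density m (sqrt v))"
    by (simp add: distributed_distr_eq_density)
  moreover have "distr std_normal_distribution lborel (\<lambda>x. m + sqrt v * x)
      = distr std_normal_distribution borel (\<lambda>x. m + sqrt v * x)"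
    by (rule distr_cong) auto
  ultimately show ?thesis using False by (simp add: normal_real_def)
qed

lemma char_normal_real:
  assumes "0 \<le> v"
  shows "char (normal_real m v) \<theta> = iexp (\<theta> * m) * of_real (exp (- (\<theta>\<^sup>2 * v) / 2))"
proof -
  have "char (normal_real m v) \<theta> =
      (CLINT x|std_normal_distribution. iexp (\<theta> * (m + sqrt v * x)))"
    unfolding char_def normal_real_eq_distr[OF assms]
    by (subst integral_distr) auto
  also have "\<dots> = (CLINT x|std_normal_distribution. iexp (\<theta> * m) * iexp ((\<theta> * sqrt v) * x))"
    by (simp add: algebra_simps flip: exp_add)
  also have "\<dots> = iexp (\<theta> * m) * char std_normal_distribution (\<theta> * sqrt v)"
    unfolding char_def by simp
  also have "\<dots> = iexp (\<theta> * m) * of_real (exp (- (\<theta>\<^sup>2 * v) / 2))"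
    using assms by (simp add: char_std_normal_distribution power_mult_distrib)
  finally show ?thesis .
qed

lemma prob_space_normal_real: "0 \<le> v \<Longrightarrow> prob_space (normal_real m v)"
  unfolding normal_real_eq_distr
  by (intro prob_space.prob_space_distr prob_space_normal_density) auto

lemma sets_normal_real [simp]: "sets (normal_real m v) = sets borel"
  by (simp add: normal_real_def)

lemma (in prob_space) distr_eq_normal_realI:
  assumes "W \<in> borel_measurable M" "0 \<le> v"
    and "\<And>\<theta>. (CLINT \<omega>|M. iexp (\<theta> * W \<omega>)) = iexp (\<theta> * m) * of_real (exp (- (\<theta>\<^sup>2 * v) / 2))"
  shows "distr M borel W = normal_real m v"
proof (rule Levy_uniqueness)
  show "real_distribution (distr M borel W)" using assms(1) by (rule real_distribution_distr)
  show "real_distribution (normal_real m v)"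
    using assms(2) prob_space_normal_real[of v m] sets_eq_imp_space_eq[OF sets_normal_real[of m v]]
    by (simp add: real_distribution_def real_distribution_axioms_def)
  show "char (distr M borel W) = char (normal_real m v)"
  proof
    fix \<theta>
    have "char (distr M borel W) \<theta> = (CLINT \<omega>|M. iexp (\<theta> * W \<omega>))"
      unfolding char_def using assms(1) by (subst integral_distr) auto
    then show "char (distr M borel W) \<theta> = char (normal_real m v) \<theta>"
      unfolding assms(3) char_normal_real[OF assms(2)] .
  qed
qed

lemma (in prob_space) normal_real_moments:
  assumes [measurable]: "W \<in> borel_measurable M" and v: "0 \<le> v"
    and W: "distr M borel W = normal_real m v"
  shows "integrable M W" "integrable M (\<lambda>\<omega>. (W \<omega>)\<^sup>2)" "expectation W = m"
    "expectation (\<lambda>\<omega>. (W \<omega>)\<^sup>2) = m\<^sup>2 + v"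
proof -
  let ?N = std_normal_distribution
  interpret N: prob_space ?N
    by (rule prob_space_normal_density) simp
  have i1: "integrable ?N (\<lambda>x. x)" using integrable_std_normal_distribution_moment[of 1] by simp
  have e1: "(\<integral>x. x \<partial>?N) = 0" using integral_std_normal_distribution_moment_odd[of 1] by simp
  have i2: "integrable ?N (\<lambda>x. x\<^sup>2)" using integrable_std_normal_distribution_moment[of 2] by simp
  have e2: "(\<integral>x. x\<^sup>2 \<partial>?N) = 1" using std_normal_distribution_even_moments(1)[of 1] by simp
  have sq: "(m + sqrt v * x)\<^sup>2 = m\<^sup>2 + 2 * m * sqrt v * x + v * x\<^sup>2" for x
    using v by (simp add: power2_sum power_mult_distrib)
  note D = W[unfolded normal_real_eq_distr[OF v]]
  have int: "integrable M (\<lambda>\<omega>. f (W \<omega>)) \<longleftrightarrow> integrable ?N (\<lambda>x. f (m + sqrt v * x))"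
    if [measurable]: "f \<in> borel_measurable borel" for f :: "real \<Rightarrow> real"
    using integrable_distr_eq[of W M borel f] integrable_distr_eq[of "\<lambda>x. m + sqrt v * x" ?N borel f]
    unfolding D by simp
  have ex: "expectation (\<lambda>\<omega>. f (W \<omega>)) = (\<integral>x. f (m + sqrt v * x) \<partial>?N)"
    if [measurable]: "f \<in> borel_measurable borel" for f :: "real \<Rightarrow> real"
    using integral_distr[of W M borel f] integral_distr[of "\<lambda>x. m + sqrt v * x" ?N borel f]
    unfolding D by simp
  have i1': "integrable ?N (\<lambda>x. m + sqrt v * x)"
    by (intro Bochner_Integration.integrable_add N.integrable_const integrable_mult_right i1)
  have i2': "integrable ?N (\<lambda>x. m\<^sup>2 + 2 * m * sqrt v * x)"
    by (intro Bochner_Integration.integrable_add N.integrable_const integrable_mult_right i1)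
  show "integrable M W" using int[of "\<lambda>x. x"] i1' by simp
  have "integrable ?N (\<lambda>x. (m + sqrt v * x)\<^sup>2)"
    unfolding sq by (intro Bochner_Integration.integrable_add[OF i2'] integrable_mult_right i2)
  then show "integrable M (\<lambda>\<omega>. (W \<omega>)\<^sup>2)" using int[of power2] by simp
  have c: "(\<integral>x. c \<partial>?N) = c" for c :: real
    using N.prob_space by (simp only: lebesgue_integral_const N.prob_space) simp
  have "(\<integral>x. m + sqrt v * x \<partial>?N) = m"
    by (simp only: Bochner_Integration.integral_add[OF N.integrable_const integrable_mult_right[OF i1]]
        integral_mult_right_zero e1 c mult_zero_right add_0_right)
  then show "expectation W = m" using ex[of "\<lambda>x. x"] by simp
  have "(\<integral>x. m\<^sup>2 + 2 * m * sqrt v * x \<partial>?N) = m\<^sup>2"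
    by (simp only: Bochner_Integration.integral_add[OF N.integrable_const integrable_mult_right[OF i1]]
        integral_mult_right_zero e1 c mult_zero_right add_0_right)
  then have "(\<integral>x. (m + sqrt v * x)\<^sup>2 \<partial>?N) = m\<^sup>2 + v"
    unfolding sq 
    by (simp only: Bochner_Integration.integral_add[OF i2' integrable_mult_right[OF i2]]
        integral_mult_right_zero e2 mult_1_right)
  then show "expectation (\<lambda>\<omega>. (W \<omega>)\<^sup>2) = m\<^sup>2 + v" using ex[of power2] by simp
qed

definition centered_gaussian :: "'a measure \<Rightarrow> ('a \<Rightarrow> real) \<Rightarrow> bool" where
  "centered_gaussian M W \<longleftrightarrow>
     W \<in> borel_measurable M \<and> (\<exists>v\<ge>0. distr M borel W = normal_real 0 v)"

context prob_space begin

lemma centered_gaussianD: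
  assumes "centered_gaussian M W"
  shows "W \<in> borel_measurable M" "integrable M W" "integrable M (\<lambda>\<omega>. (W \<omega>)\<^sup>2)"
    "expectation W = 0" "distr M borel W = normal_real 0 (expectation (\<lambda>\<omega>. (W \<omega>)\<^sup>2))"
    "(CLINT \<omega>|M. iexp (W \<omega>)) = of_real (exp (- expectation (\<lambda>\<omega>. (W \<omega>)\<^sup>2) / 2))"
proof -
  from assms obtain v where [measurable]: "W \<in> borel_measurable M" and v: "0 \<le> v"
    and D: "distr M borel W = normal_real 0 v"
    unfolding centered_gaussian_def by auto
  note m = normal_real_moments[OF this]
  show "W \<in> borel_measurable M" "integrable M W" "integrable M (\<lambda>\<omega>. (W \<omega>)\<^sup>2)"
    "expectation W = 0" "distr M borel W = normal_real 0 (expectation (\<lambda>\<omega>. (W \<omega>)\<^sup>2))"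
    using m D by simp_all
  have "(CLINT \<omega>|M. iexp (W \<omega>)) = char (distr M borel W) 1"
    unfolding char_def by (subst integral_distr) auto
  then show "(CLINT \<omega>|M. iexp (W \<omega>)) = of_real (exp (- expectation (\<lambda>\<omega>. (W \<omega>)\<^sup>2) / 2))"
    using m unfolding D by (simp add: char_normal_real v)
qed

text \<open>By uniqueness of characteristic functions on the real line, it suffices to know the Fourier
  transform along all multiples of the variable. If the square is not integrable, the variance
  appearing here is the default value 0 of the integral, and the criterion remains sound.\<close>
lemma centered_gaussianI:
  assumes "W \<in> borel_measurable M"
    and "\<And>\<theta>. (CLINT \<omega>|M. iexp (\<theta> * W \<omega>)) = of_real (exp (- expectation (\<lambda>\<omega>. (\<theta> * W \<omega>)\<^sup>2) / 2))"
  shows "centered_gaussian M W"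
  unfolding centered_gaussian_def
proof (intro conjI exI)
  show "distr M borel W = normal_real 0 (expectation (\<lambda>\<omega>. (W \<omega>)\<^sup>2))"
    using assms by (intro distr_eq_normal_realI) (auto simp: power_mult_distrib)
qed (use assms in auto)

lemma centered_gaussian_scale:
  assumes "centered_gaussian M W"
  shows "centered_gaussian M (\<lambda>\<omega>. c * W \<omega>)"
  unfolding centered_gaussian_def
proof (intro conjI exI)
  note [measurable] = centered_gaussianD(1)[OF assms]
  let ?v = "expectation (\<lambda>\<omega>. (W \<omega>)\<^sup>2)"
  show "(\<lambda>\<omega>. c * W \<omega>) \<in> borel_measurable M" by simp
  show "distr M borel (\<lambda>\<omega>. c * W \<omega>) = normal_real 0 (c\<^sup>2 * ?v)"
  proof (rule distr_eq_normal_realI)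
    fix \<theta>
    have "(CLINT \<omega>|M. iexp (\<theta> * (c * W \<omega>))) = char (distr M borel W) (\<theta> * c)"
      unfolding char_def by (subst integral_distr) (auto simp: mult_ac)
    then show "(CLINT \<omega>|M. iexp (\<theta> * (c * W \<omega>))) = iexp (\<theta> * 0) * of_real (exp (- (\<theta>\<^sup>2 * (c\<^sup>2 * ?v)) / 2))"
      unfolding centered_gaussianD(5)[OF assms] by (simp add: char_normal_real power_mult_distrib mult_ac)
  qed auto
qed auto

end

lemma centered_gaussian_cong_AE:
  assumes "centered_gaussian M W" "W' \<in> borel_measurable M" "AE \<omega> in M. W \<omega> = W' \<omega>"
  shows "centered_gaussian M W'"
proof -
  have "distr M borel W = distr M borel W'"
    using assms by (intro distr_cong_AE) (auto simp: centered_gaussian_def)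
  then show ?thesis using assms(1,2) by (simp add: centered_gaussian_def)
qed

section \<open>Square-integrable functions and Gaussian limits\<close>

lemma integrable_mult_of_square:
  fixes f g :: "'a \<Rightarrow> real"
  assumes [measurable]: "f \<in> borel_measurable M" "g \<in> borel_measurable M"
    and "integrable M (\<lambda>x. (f x)\<^sup>2)" "integrable M (\<lambda>x. (g x)\<^sup>2)"
  shows "integrable M (\<lambda>x. f x * g x)"
proof (rule Bochner_Integration.integrable_bound)
  show "integrable M (\<lambda>x. (f x)\<^sup>2 + (g x)\<^sup>2)" using assms by simp
  have "\<bar>a * b\<bar> \<le> a\<^sup>2 + b\<^sup>2" for a b :: real
  proof -
    have "2 * (\<bar>a\<bar> * \<bar>b\<bar>) \<le> \<bar>a\<bar>\<^sup>2 + \<bar>b\<bar>\<^sup>2" using sum_squares_bound[of "\<bar>a\<bar>" "\<bar>b\<bar>"] by simp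
    moreover have "0 \<le> \<bar>a\<bar> * \<bar>b\<bar>" by simp
    ultimately show ?thesis by (simp add: abs_mult del: mult_nonneg_nonneg zero_le_mult_iff abs_ge_zero)
  qed
  then show "AE x in M. norm (f x * g x) \<le> norm ((f x)\<^sup>2 + (g x)\<^sup>2)"
    by (intro AE_I2) (simp add: real_norm_def)
qed auto

lemma integrable_square_add:
  fixes f g :: "'a \<Rightarrow> real"
  assumes "f \<in> borel_measurable M" "g \<in> borel_measurable M"
    and "integrable M (\<lambda>x. (f x)\<^sup>2)" "integrable M (\<lambda>x. (g x)\<^sup>2)"
  shows "integrable M (\<lambda>x. (f x + g x)\<^sup>2)"
  using assms integrable_mult_of_square[OF assms] by (simp add: power2_sum mult.assoc)

lemma integral_square_add:
  fixes f g :: "'a \<Rightarrow> real"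
  assumes "f \<in> borel_measurable M" "g \<in> borel_measurable M"
    and "integrable M (\<lambda>x. (f x)\<^sup>2)" "integrable M (\<lambda>x. (g x)\<^sup>2)"
  shows "(\<integral>x. (f x + g x)\<^sup>2 \<partial>M) = (\<integral>x. (f x)\<^sup>2 \<partial>M) + (\<integral>x. (g x)\<^sup>2 \<partial>M) + 2 * (\<integral>x. f x * g x \<partial>M)"
  using assms integrable_mult_of_square[OF assms] by (simp add: power2_sum mult.assoc)

text \<open>The quadratic polynomial \<open>s \<mapsto> \<integral>(f + s g)\<^sup>2\<close> is nonnegative, so its discriminant is not positive.\<close>
lemma integral_Cauchy_Schwarz:
  fixes f g :: "'a \<Rightarrow> real"
  assumes [measurable]: "f \<in> borel_measurable M" "g \<in> borel_measurable M"
    and f: "integrable M (\<lambda>x. (f x)\<^sup>2)" and g: "integrable M (\<lambda>x. (g x)\<^sup>2)"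
  shows "(\<integral>x. f x * g x \<partial>M)\<^sup>2 \<le> (\<integral>x. (f x)\<^sup>2 \<partial>M) * (\<integral>x. (g x)\<^sup>2 \<partial>M)"
proof -
  let ?a = "\<integral>x. (f x)\<^sup>2 \<partial>M" and ?b = "\<integral>x. f x * g x \<partial>M" and ?c = "\<integral>x. (g x)\<^sup>2 \<partial>M"
  have quad: "0 \<le> ?a + s\<^sup>2 * ?c + 2 * (s * ?b)" for s
  proof -
    have "0 \<le> (\<integral>x. (f x + s * g x)\<^sup>2 \<partial>M)" by simp
    also have "\<dots> = ?a + s\<^sup>2 * ?c + 2 * (s * ?b)"
      using f g by (subst integral_square_add) (auto simp: power_mult_distrib mult.left_commute)
    finally show ?thesis .
  qed
  show ?thesis
  proof (cases "?c = 0")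
    case True
    have "?b = 0"
    proof (rule ccontr)
      assume "?b \<noteq> 0"
            \<comment> \<open>The polynomial is now affine in \<open>s\<close>, and takes the value -1 at this point.\<close>
with quad[of "- (?a + 1) / (2 * ?b)"] True show False by (simp add: field_simps)
    qed
    then show ?thesis using True by simp
  next
    case False
    then have c: "0 < ?c" by (simp add: less_le)
    from quad[of "- ?b / ?c"] c have "0 \<le> ?a - ?b\<^sup>2 / ?c"
      by (simp add: field_simps power2_eq_square)
    with c show ?thesis by (simp add: field_simps)
  qed
qed

lemma norm_iexp_diff_le: "cmod (iexp a - iexp b) \<le> \<bar>a - b\<bar>"
proof -
  have "iexp a - iexp b = iexp b * (iexp (a - b) - 1)"
    by (simp add: algebra_simps flip: exp_add)
  then have "cmod (iexp a - iexp b) = cmod (iexp (a - b) - 1)" by (simp add: norm_mult del: of_real_diff)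
  also have "\<dots> \<le> \<bar>a - b\<bar>" using iexp_approx1[of "a - b" 0] by simp
  finally show ?thesis .
qed

lemma (in prob_space) expectation_abs_le:
  assumes [measurable]: "f \<in> borel_measurable M" and f: "integrable M (\<lambda>\<omega>. (f \<omega>)\<^sup>2)"
  shows "integrable M f" "expectation (\<lambda>\<omega>. \<bar>f \<omega>\<bar>) \<le> sqrt (expectation (\<lambda>\<omega>. (f \<omega>)\<^sup>2))"
proof -
  show "integrable M f" using integrable_mult_of_square[of f M "\<lambda>_. 1"] f by simp
  have "(expectation (\<lambda>\<omega>. \<bar>f \<omega>\<bar>))\<^sup>2 \<le> expectation (\<lambda>\<omega>. (f \<omega>)\<^sup>2)"
    using integral_Cauchy_Schwarz[of "\<lambda>\<omega>. \<bar>f \<omega>\<bar>" M "\<lambda>_. 1"] f prob_space by simp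
  then show "expectation (\<lambda>\<omega>. \<bar>f \<omega>\<bar>) \<le> sqrt (expectation (\<lambda>\<omega>. (f \<omega>)\<^sup>2))"
    by (rule real_le_rsqrt)
qed

text \<open>Convergence in mean square implies convergence of the characteristic functions, since \<open>iexp\<close> is
  1-Lipschitz, and convergence of the variances, since the second moment is continuous in mean
  square. So the Gaussian form of the characteristic function passes to the limit.\<close>
lemma (in prob_space) centered_gaussian_L2_limit:
  assumes gauss: "\<And>m. centered_gaussian M (S m)"
    and [measurable]: "W \<in> borel_measurable M" and W: "integrable M (\<lambda>\<omega>. (W \<omega>)\<^sup>2)"
    and lim: "(\<lambda>m. expectation (\<lambda>\<omega>. (W \<omega> - S m \<omega>)\<^sup>2)) \<longlonglongrightarrow> 0"
  shows "centered_gaussian M W"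
proof (rule centered_gaussianI)
  fix \<theta>
  note [measurable] = centered_gaussianD(1)[OF gauss] and S = centered_gaussianD(3)[OF gauss]
  let ?D = "\<lambda>m \<omega>. W \<omega> - S m \<omega>"
  have D: "integrable M (\<lambda>\<omega>. (?D m \<omega>)\<^sup>2)" for m
    using integrable_square_add[of W M "\<lambda>\<omega>. - S m \<omega>"] W S by simp
  let ?e = "\<lambda>m. sqrt (expectation (\<lambda>\<omega>. (?D m \<omega>)\<^sup>2))"
  have e: "?e \<longlonglongrightarrow> 0" using tendsto_real_sqrt[OF lim] by simp
  have 1: "(\<lambda>m. CLINT \<omega>|M. iexp (\<theta> * S m \<omega>)) \<longlonglongrightarrow> (CLINT \<omega>|M. iexp (\<theta> * W \<omega>))"
  proof (rule metric_tendsto_imp_tendsto)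
    show "(\<lambda>m. \<bar>\<theta>\<bar> * ?e m) \<longlonglongrightarrow> 0" using tendsto_mult_right_zero[OF e] by simp
    show "\<forall>\<^sub>F m in sequentially. dist (CLINT \<omega>|M. iexp (\<theta> * S m \<omega>)) (CLINT \<omega>|M. iexp (\<theta> * W \<omega>)) \<le> dist (\<bar>\<theta>\<bar> * ?e m) 0"
    proof (rule always_eventually, rule allI)
      fix m
      have i: "integrable M (\<lambda>\<omega>. iexp (\<theta> * S m \<omega>))" "integrable M (\<lambda>\<omega>. iexp (\<theta> * W \<omega>))"
        by (auto intro!: integrable_iexp)
      have "dist (CLINT \<omega>|M. iexp (\<theta> * S m \<omega>)) (CLINT \<omega>|M. iexp (\<theta> * W \<omega>)) =
          cmod (CLINT \<omega>|M. iexp (\<theta> * W \<omega>) - iexp (\<theta> * S m \<omega>))"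
        by (simp only: Bochner_Integration.integral_diff[OF i(2,1)] dist_norm norm_minus_commute)
      also have "\<dots> \<le> (\<integral>\<omega>. cmod (iexp (\<theta> * W \<omega>) - iexp (\<theta> * S m \<omega>)) \<partial>M)"
        by (rule integral_norm_bound)
      also have "\<dots> \<le> (\<integral>\<omega>. \<bar>\<theta>\<bar> * \<bar>?D m \<omega>\<bar> \<partial>M)"
      proof (rule integral_mono)
        show "integrable M (\<lambda>\<omega>. cmod (iexp (\<theta> * W \<omega>) - iexp (\<theta> * S m \<omega>)))"
          using i by (intro integrable_norm Bochner_Integration.integrable_diff)
        show "integrable M (\<lambda>\<omega>. \<bar>\<theta>\<bar> * \<bar>?D m \<omega>\<bar>)"
          using expectation_abs_le(1)[of "?D m"] D by (intro integrable_mult_right integrable_abs) simp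
        show "cmod (iexp (\<theta> * W \<omega>) - iexp (\<theta> * S m \<omega>)) \<le> \<bar>\<theta>\<bar> * \<bar>?D m \<omega>\<bar>" for \<omega>
          using norm_iexp_diff_le[of "\<theta> * W \<omega>" "\<theta> * S m \<omega>"] by (simp only: flip: abs_mult right_diff_distrib)
      qed
      also have "\<dots> \<le> \<bar>\<theta>\<bar> * ?e m"
        using expectation_abs_le(2)[of "?D m"] D by (simp add: mult_left_mono)
      finally show "dist (CLINT \<omega>|M. iexp (\<theta> * S m \<omega>)) (CLINT \<omega>|M. iexp (\<theta> * W \<omega>)) \<le> dist (\<bar>\<theta>\<bar> * ?e m) 0"
        by simp
    qed
  qed
  have 2: "(\<lambda>m. expectation (\<lambda>\<omega>. (S m \<omega>)\<^sup>2)) \<longlonglongrightarrow> expectation (\<lambda>\<omega>. (W \<omega>)\<^sup>2)"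
  proof -
    have eq: "expectation (\<lambda>\<omega>. (S m \<omega>)\<^sup>2) = expectation (\<lambda>\<omega>. (W \<omega>)\<^sup>2) +
        expectation (\<lambda>\<omega>. (?D m \<omega>)\<^sup>2) - 2 * expectation (\<lambda>\<omega>. W \<omega> * ?D m \<omega>)" for m
    proof -
      have "expectation (\<lambda>\<omega>. (S m \<omega>)\<^sup>2) = expectation (\<lambda>\<omega>. (W \<omega> + - ?D m \<omega>)\<^sup>2)" by simp
      also have "\<dots> = expectation (\<lambda>\<omega>. (W \<omega>)\<^sup>2) + expectation (\<lambda>\<omega>. (- ?D m \<omega>)\<^sup>2) +
          2 * expectation (\<lambda>\<omega>. W \<omega> * - ?D m \<omega>)"
        using W D[of m] by (intro integral_square_add) (simp_all only: power2_minus, measurable)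
      finally show ?thesis
        by (simp only: power2_minus mult_minus_right Bochner_Integration.integral_minus)
    qed
    have "(\<lambda>m. expectation (\<lambda>\<omega>. W \<omega> * ?D m \<omega>)) \<longlonglongrightarrow> 0"
    proof (rule metric_tendsto_imp_tendsto)
      show "(\<lambda>m. sqrt (expectation (\<lambda>\<omega>. (W \<omega>)\<^sup>2)) * ?e m) \<longlonglongrightarrow> 0"
        using tendsto_mult_right_zero[OF e] by simp
      have "\<bar>expectation (\<lambda>\<omega>. W \<omega> * ?D m \<omega>)\<bar> \<le> sqrt (expectation (\<lambda>\<omega>. (W \<omega>)\<^sup>2)) * ?e m" for m
        using integral_Cauchy_Schwarz[of W M "?D m"] W D[of m]
        by (simp add: real_le_rsqrt flip: real_sqrt_mult)
      then show "\<forall>\<^sub>F m in sequentially. dist (expectation (\<lambda>\<omega>. W \<omega> * ?D m \<omega>)) 0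
          \<le> dist (sqrt (expectation (\<lambda>\<omega>. (W \<omega>)\<^sup>2)) * ?e m) 0"
        by (intro always_eventually allI) (simp add: abs_mult)
    qed
    from tendsto_diff[OF tendsto_add[OF tendsto_const lim] tendsto_mult_right_zero[OF this, of 2]]
    show ?thesis unfolding eq by simp
  qed
  have "(\<lambda>m. CLINT \<omega>|M. iexp (\<theta> * S m \<omega>)) \<longlonglongrightarrow> of_real (exp (- (\<theta>\<^sup>2 * expectation (\<lambda>\<omega>. (W \<omega>)\<^sup>2)) / 2))"
  proof -
    have "(CLINT \<omega>|M. iexp (\<theta> * S m \<omega>)) = of_real (exp (- (\<theta>\<^sup>2 * expectation (\<lambda>\<omega>. (S m \<omega>)\<^sup>2)) / 2))" for m
      using centered_gaussianD(6)[OF centered_gaussian_scale[OF gauss[of m], of \<theta>]]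
      by (simp only: power_mult_distrib integral_mult_right_zero)
    then show ?thesis using 2 by (simp only:) (intro tendsto_intros, auto)
  qed
  from LIMSEQ_unique[OF 1 this]
  show "(CLINT \<omega>|M. iexp (\<theta> * W \<omega>)) = of_real (exp (- expectation (\<lambda>\<omega>. (\<theta> * W \<omega>)\<^sup>2) / 2))"
    by (simp only: power_mult_distrib integral_mult_right_zero)
qed fact

section \<open>Characteristic functions determine laws on finite products\<close>

text \<open>Weights turn the uniqueness theorem for laws on the real line into a statement about measures
  with a density; after normalisation of the total mass the two image measures are probability
  laws with the same characteristic function.\<close>
lemma weighted_char_unique:
  fixes x :: "'a \<Rightarrow> real" and x' :: "'b \<Rightarrow> real"
  assumes "finite_measure \<mu>" "finite_measure \<nu>"
    and [measurable]: "x \<in> borel_measurable \<mu>" "x' \<in> borel_measurable \<nu>"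
    and [measurable]: "w \<in> borel_measurable \<mu>" "w' \<in> borel_measurable \<nu>"
    and w: "\<And>a. 0 \<le> w a" "\<And>a. w a \<le> K" and w': "\<And>a. 0 \<le> w' a" "\<And>a. w' a \<le> K"
    and eq: "\<And>\<theta>. (CLINT a|\<mu>. of_real (w a) * iexp (\<theta> * x a)) = (CLINT a|\<nu>. of_real (w' a) * iexp (\<theta> * x' a))"
    and [measurable]: "B \<in> sets borel"
  shows "(\<integral>a. w a * indicator B (x a) \<partial>\<mu>) = (\<integral>a. w' a * indicator B (x' a) \<partial>\<nu>)"
proof -
  interpret \<mu>: finite_measure \<mu> by fact
  interpret \<nu>: finite_measure \<nu> by fact
  have iw: "integrable \<mu> w" by (rule \<mu>.integrable_const_bound[of _ K]) (use w in auto)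
  have iw': "integrable \<nu> w'" by (rule \<nu>.integrable_const_bound[of _ K]) (use w' in auto)
  have iB: "integrable \<mu> (\<lambda>a. w a * indicator B (x a))"
    by (rule \<mu>.integrable_const_bound[of _ K]) (use w in \<open>auto simp: indicator_def intro: order_trans[OF w(1) w(2)]\<close>)
  have iB': "integrable \<nu> (\<lambda>a. w' a * indicator B (x' a))"
    by (rule \<nu>.integrable_const_bound[of _ K]) (use w' in \<open>auto simp: indicator_def intro: order_trans[OF w'(1) w'(2)]\<close>)
  define c where "c = (\<integral>a. w a \<partial>\<mu>)"
  have "complex_of_real c = of_real (\<integral>a. w' a \<partial>\<nu>)"
    using eq[of 0] unfolding c_def by simp
  then have c': "c = (\<integral>a. w' a \<partial>\<nu>)" by simp
  have "0 \<le> c" unfolding c_def by (rule integral_nonneg_AE) (use w in auto)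
  show ?thesis
  proof (cases "c = 0")
    case True
    have "(\<integral>a. w a * indicator B (x a) \<partial>\<mu>) \<le> c" unfolding c_def
      by (rule integral_mono[OF iB iw]) (auto simp: indicator_def w)
    moreover have "(\<integral>a. w' a * indicator B (x' a) \<partial>\<nu>) \<le> c" unfolding c'
      by (rule integral_mono[OF iB' iw']) (auto simp: indicator_def w')
    moreover have "0 \<le> (\<integral>a. w a * indicator B (x a) \<partial>\<mu>)" "0 \<le> (\<integral>a. w' a * indicator B (x' a) \<partial>\<nu>)"
      by (auto intro!: integral_nonneg_AE simp: w w')
    ultimately show ?thesis using True by linarith
  next
    case False
    with \<open>0 \<le> c\<close> have c: "0 < c" by simp
    let ?D = "density \<mu> (\<lambda>a. ennreal (w a / c))" and ?D' = "density \<nu> (\<lambda>a. ennreal (w' a / c))"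
    have nn: "0 \<le> w a / c" "0 \<le> w' b / c" for a b using w w' c by simp_all
    have "(\<integral>\<^sup>+a. ennreal (w a / c) \<partial>\<mu>) = ennreal (\<integral>a. w a / c \<partial>\<mu>)"
      using iw by (intro nn_integral_eq_integral AE_I2 nn) auto
    also have "\<dots> = 1" using c by (simp add: c_def[symmetric])
    finally have p: "prob_space ?D" by (intro prob_spaceI) (simp add: emeasure_density cong: nn_integral_cong)
    have "(\<integral>\<^sup>+a. ennreal (w' a / c) \<partial>\<nu>) = ennreal (\<integral>a. w' a / c \<partial>\<nu>)"
      using iw' by (intro nn_integral_eq_integral AE_I2 nn) auto
    also have "\<dots> = 1" using c by (simp add: c'[symmetric])
    finally have p': "prob_space ?D'" by (intro prob_spaceI) (simp add: emeasure_density cong: nn_integral_cong)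
    have "distr ?D borel x = distr ?D' borel x'"
    proof (rule Levy_uniqueness)
      show "real_distribution (distr ?D borel x)"
        by (rule prob_space.real_distribution_distr[OF p]) simp
      show "real_distribution (distr ?D' borel x')"
        by (rule prob_space.real_distribution_distr[OF p']) simp
      have 1: "char (distr ?D borel x) \<theta> = (CLINT a|\<mu>. of_real (w a) * iexp (\<theta> * x a)) / c" for \<theta>
        unfolding char_def
        by (subst integral_distr, simp, simp, subst integral_density) (auto simp: w w' \<open>0 \<le> c\<close> scaleR_conv_of_real mult_ac)
      have 2: "char (distr ?D' borel x') \<theta> = (CLINT a|\<nu>. of_real (w' a) * iexp (\<theta> * x' a)) / c" for \<theta>
        unfolding char_def
        by (subst integral_distr, simp, simp, subst integral_density) (auto simp: w w' \<open>0 \<le> c\<close> scaleR_conv_of_real mult_ac)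
      show "char (distr ?D borel x) = char (distr ?D' borel x')"
        by (rule ext) (simp only: 1 2 eq)
    qed
    then have "(\<integral>y. indicator B y \<partial>distr ?D borel x) = (\<integral>y. indicator B y \<partial>distr ?D' borel x' :: real)"
      by simp
    moreover have "(\<integral>y. indicator B y \<partial>distr ?D borel x) = (\<integral>a. w a * indicator B (x a) \<partial>\<mu>) / c"
      by (subst integral_distr, simp, simp, subst integral_density) (auto simp: w w' \<open>0 \<le> c\<close>)
    moreover have "(\<integral>y. indicator B y \<partial>distr ?D' borel x') = (\<integral>a. w' a * indicator B (x' a) \<partial>\<nu>) / c"
      by (subst integral_distr, simp, simp, subst integral_density) (auto simp: w w' \<open>0 \<le> c\<close>)
    ultimately show ?thesis using c by simp
  qed
qed

lemma cos_sin_iexp: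
  "complex_of_real (cos p) * iexp q = 1 / 2 * iexp (q + p) + 1 / 2 * iexp (q - p)"
  "complex_of_real (sin p) * iexp q = - \<i> / 2 * iexp (q + p) + \<i> / 2 * iexp (q - p)"
  by (simp_all add: complex_eq_iff Re_exp Im_exp cos_add sin_add cos_diff sin_diff field_simps)

lemma integral_linear3:
  fixes f g h :: "'a \<Rightarrow> complex"
  assumes "integrable M f" "integrable M g" "integrable M h"
  shows "(CLINT x|M. f x + a * g x + b * h x) = (CLINT x|M. f x) + a * (CLINT x|M. g x) + b * (CLINT x|M. h x)"
  using assms by simp

text \<open>A complex phase \<open>iexp (p a)\<close> cannot serve as a weight, but \<open>1 + cos (p a)\<close> and \<open>1 + sin (p a)\<close>
  can, being nonnegative. The Fourier transforms of these weighted measures are combinations of the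
  known integrals with \<open>\<theta> x + s p\<close> for \<open>s \<in> {-1, 0, 1}\<close>.\<close>
lemma weighted_char_unique_phase:
  fixes x p :: "'a \<Rightarrow> real" and x' p' :: "'b \<Rightarrow> real"
  assumes "finite_measure \<mu>" "finite_measure \<nu>"
    and [measurable]: "x \<in> borel_measurable \<mu>" "x' \<in> borel_measurable \<nu>"
    and [measurable]: "p \<in> borel_measurable \<mu>" "p' \<in> borel_measurable \<nu>"
    and [measurable]: "h \<in> borel_measurable \<mu>" "h' \<in> borel_measurable \<nu>"
    and h: "\<And>a. 0 \<le> h a" "\<And>a. h a \<le> 1" and h': "\<And>a. 0 \<le> h' a" "\<And>a. h' a \<le> 1"
    and eq: "\<And>\<theta> s. (CLINT a|\<mu>. of_real (h a) * iexp (\<theta> * x a + s * p a)) =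
                     (CLINT a|\<nu>. of_real (h' a) * iexp (\<theta> * x' a + s * p' a))"
    and [measurable]: "B \<in> sets borel"
  shows "(CLINT a|\<mu>. of_real (h a * indicator B (x a)) * iexp (p a)) =
         (CLINT a|\<nu>. of_real (h' a * indicator B (x' a)) * iexp (p' a))"
proof -
  interpret \<mu>: finite_measure \<mu> by fact
  interpret \<nu>: finite_measure \<nu> by fact
  have i: "integrable \<mu> (\<lambda>a. of_real (h a) * iexp (q a))" if [measurable]: "q \<in> borel_measurable \<mu>" for q
    by (rule \<mu>.integrable_const_bound[of _ 1]) (use h in \<open>auto simp: norm_mult\<close>)
  have i': "integrable \<nu> (\<lambda>a. of_real (h' a) * iexp (q a))" if [measurable]: "q \<in> borel_measurable \<nu>" for q
    by (rule \<nu>.integrable_const_bound[of _ 1]) (use h' in \<open>auto simp: norm_mult\<close>)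
  have base: "(\<integral>a. h a * (1 + c * g (p a)) * indicator B (x a) \<partial>\<mu>) =
      (\<integral>a. h' a * (1 + c * g (p' a)) * indicator B (x' a) \<partial>\<nu>)"
    if g: "\<And>q. \<bar>g q\<bar> \<le> 1" and c: "c \<in> {0, 1}" and [measurable]: "g \<in> borel_measurable borel"
      and gi: "\<And>q r. complex_of_real (g q) * iexp r = \<alpha> * iexp (r + q) + \<beta> * iexp (r - q)"
    for g :: "real \<Rightarrow> real" and c \<alpha> \<beta>
  proof (rule weighted_char_unique[of \<mu> \<nu> x x' _ _ 2])
    fix a b
    have "0 \<le> 1 + c * g q" "1 + c * g q \<le> 2" for q using g[of q] c by (auto simp: abs_le_iff)
    then show "0 \<le> h a * (1 + c * g (p a))" "0 \<le> h' b * (1 + c * g (p' b))"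
      "h a * (1 + c * g (p a)) \<le> 2" "h' b * (1 + c * g (p' b)) \<le> 2"
      using h[of a] h'[of b] mult_mono[of "h a" 1 "1 + c * g (p a)" 2] mult_mono[of "h' b" 1 "1 + c * g (p' b)" 2]
      by auto
  next
    fix \<theta>
    have "of_real (y * (1 + c * g q)) * iexp r =
       of_real y * iexp (r + 0 * q) + c * \<alpha> * (of_real y * iexp (r + 1 * q)) + c * \<beta> * (of_real y * iexp (r + (-1) * q))"
      for y q r
    proof -
      have "of_real (y * (1 + c * g q)) * iexp r = of_real y * iexp r + of_real y * c * (of_real (g q) * iexp r)"
        by (simp add: algebra_simps)
      then show ?thesis unfolding gi by (simp add: algebra_simps)
    qed
    note * = this
    have "(CLINT a|\<mu>. of_real (h a * (1 + c * g (p a))) * iexp (\<theta> * x a)) =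
        (CLINT a|\<mu>. of_real (h a) * iexp (\<theta> * x a + 0 * p a)) +
        c * \<alpha> * (CLINT a|\<mu>. of_real (h a) * iexp (\<theta> * x a + 1 * p a)) +
        c * \<beta> * (CLINT a|\<mu>. of_real (h a) * iexp (\<theta> * x a + (-1) * p a))"
      unfolding * by (rule integral_linear3; rule i) measurable
    also have "\<dots> = (CLINT a|\<nu>. of_real (h' a * (1 + c * g (p' a))) * iexp (\<theta> * x' a))"
      unfolding * eq by (rule integral_linear3[symmetric]; rule i') measurable
    finally show "(CLINT a|\<mu>. of_real (h a * (1 + c * g (p a))) * iexp (\<theta> * x a)) =
        (CLINT a|\<nu>. of_real (h' a * (1 + c * g (p' a))) * iexp (\<theta> * x' a))" .
  qed (simp_all add: assms)
  have ib: "integrable \<mu> (\<lambda>a. h a * indicator B (x a) * g (p a))" "integrable \<nu> (\<lambda>a. h' a * indicator B (x' a) * g (p' a))"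
    if g: "\<And>q. \<bar>g q\<bar> \<le> 1" and [measurable]: "g \<in> borel_measurable borel" for g :: "real \<Rightarrow> real"
  proof -
    show "integrable \<mu> (\<lambda>a. h a * indicator B (x a) * g (p a))"
      by (rule \<mu>.integrable_const_bound[of _ 1])
        (use h g in \<open>auto simp: abs_mult indicator_def intro!: mult_le_one\<close>)
    show "integrable \<nu> (\<lambda>a. h' a * indicator B (x' a) * g (p' a))"
      by (rule \<nu>.integrable_const_bound[of _ 1])
        (use h' g in \<open>auto simp: abs_mult indicator_def intro!: mult_le_one\<close>)
  qed
  have trig: "(\<integral>a. h a * indicator B (x a) * g (p a) \<partial>\<mu>) = (\<integral>a. h' a * indicator B (x' a) * g (p' a) \<partial>\<nu>)"
    if g: "\<And>q. \<bar>g q\<bar> \<le> 1" and m: "g \<in> borel_measurable borel"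
      and gi: "\<And>q r. complex_of_real (g q) * iexp r = \<alpha> * iexp (r + q) + \<beta> * iexp (r - q)"
    for g :: "real \<Rightarrow> real" and \<alpha> \<beta>
  proof -
    note i1 = ib[of "\<lambda>_. 1"] and i2 = ib[OF g m]
    have "(\<integral>a. h a * indicator B (x a) \<partial>\<mu>) + (\<integral>a. h a * indicator B (x a) * g (p a) \<partial>\<mu>) =
      (\<integral>a. h a * (1 + 1 * g (p a)) * indicator B (x a) \<partial>\<mu>)"
      using i1 i2 by (subst Bochner_Integration.integral_add[symmetric]) (auto simp: algebra_simps)
    also have "\<dots> = (\<integral>a. h' a * (1 + 1 * g (p' a)) * indicator B (x' a) \<partial>\<nu>)"
      by (rule base[OF g _ m gi]) simp
    also have "\<dots> = (\<integral>a. h' a * indicator B (x' a) \<partial>\<nu>) + (\<integral>a. h' a * indicator B (x' a) * g (p' a) \<partial>\<nu>)"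
      using i1 i2 by (subst Bochner_Integration.integral_add[symmetric]) (auto simp: algebra_simps)
    finally show ?thesis using base[OF g _ m gi, of 0] by simp
  qed
  have split: "of_real y * iexp q = of_real (y * cos q) + \<i> * of_real (y * sin q)" for y q
    by (simp add: complex_eq_iff Re_exp Im_exp)
  have c: "\<bar>cos q\<bar> \<le> 1" "\<bar>sin q\<bar> \<le> 1" for q :: real by auto
  have m: "(cos :: real \<Rightarrow> real) \<in> borel_measurable borel" "(sin :: real \<Rightarrow> real) \<in> borel_measurable borel" by auto
  note tr = trig[OF c(1) m(1) cos_sin_iexp(1)] trig[OF c(2) m(2) cos_sin_iexp(2)]
  note ii = ib[OF c(1) m(1)] ib[OF c(2) m(2)]
  show ?thesis
    unfolding split using ii tr by (simp del: of_real_mult)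
qed

text \<open>Fourier inversion is carried out one coordinate at a time: induction on \<open>F\<close> shows that the
  integrals of indicators in the coordinates from \<open>F\<close> times a phase in the remaining ones agree, and
  the previous lemma replaces the phase in one more coordinate by an indicator. For \<open>F = I\<close> these are
  the measures of boxes, which generate the product \<open>\<sigma>\<close>-algebra.\<close>
lemma char_unique_PiM:
  fixes \<mu> \<nu> :: "('i \<Rightarrow> real) measure"
  assumes "finite I" "finite_measure \<mu>" "finite_measure \<nu>"
    and sets: "sets \<mu> = sets (borel_vec I)" "sets \<nu> = sets (borel_vec I)"
    and eq: "\<And>u. (CLINT x|\<mu>. iexp (\<Sum>i\<in>I. u i * x i)) = (CLINT x|\<nu>. iexp (\<Sum>i\<in>I. u i * x i))"
  shows "\<mu> = \<nu>"
proof -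
  interpret \<mu>: finite_measure \<mu> by fact
  interpret \<nu>: finite_measure \<nu> by fact
  note [measurable_cong] = sets
  have space: "space \<mu> = vecs I" "space \<nu> = vecs I"
    using sets[THEN sets_eq_imp_space_eq] by (simp_all add: space_PiM)
  have main: "(CLINT x|\<mu>. of_real (\<Prod>j\<in>F. indicator (B j) (x j)) * iexp (\<Sum>i\<in>I - F. u i * x i)) =
      (CLINT x|\<nu>. of_real (\<Prod>j\<in>F. indicator (B j) (x j)) * iexp (\<Sum>i\<in>I - F. u i * x i))"
    if "finite F" "F \<subseteq> I" "\<And>j. j \<in> I \<Longrightarrow> B j \<in> sets borel" for F u and B :: "'i \<Rightarrow> real set"
    using that(1,2)
  proof (induction F arbitrary: u rule: finite_induct)
    case empty
    then show ?case using eq by simp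
  next
    case (insert j F)
    then have j: "j \<in> I" "j \<notin> F" "F \<subseteq> I" by auto
    have [measurable]: "B i \<in> sets borel" if "i \<in> I" for i using that \<open>\<And>j. j \<in> I \<Longrightarrow> B j \<in> sets borel\<close> by auto
    let ?h = "\<lambda>x. \<Prod>j\<in>F. indicator (B j) (x j) :: real"
    have h: "0 \<le> ?h x" "?h x \<le> 1" for x :: "'i \<Rightarrow> real"
      by (auto intro!: prod_nonneg prod_le_1)
    have [measurable]: "?h \<in> borel_measurable (borel_vec I)"
      using j by (intro borel_measurable_prod) (auto intro!: borel_measurable_indicator')
    then have hm: "?h \<in> borel_measurable \<mu>" "?h \<in> borel_measurable \<nu>" by (simp_all add: measurable_cong_sets[OF sets(1) refl] measurable_cong_sets[OF sets(2) refl])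
    have "(CLINT x|\<mu>. of_real (?h x * indicator (B j) (x j)) * iexp (\<Sum>i\<in>I - insert j F. u i * x i)) =
      (CLINT x|\<nu>. of_real (?h x * indicator (B j) (x j)) * iexp (\<Sum>i\<in>I - insert j F. u i * x i))"
    proof (rule weighted_char_unique_phase)
      fix \<theta> s
      have "I - F - {j} = I - insert j F" "finite (I - F)" "j \<in> I - F" using j \<open>finite I\<close> by auto
      note * = this
      have **: "(\<Sum>i\<in>I - F. (if i = j then \<theta> else s * u i) * x i) =
          \<theta> * x j + s * (\<Sum>i\<in>I - insert j F. u i * x i)" for x :: "'i \<Rightarrow> real"
      proof -
        have "(\<Sum>i\<in>I - insert j F. (if i = j then \<theta> else s * u i) * x i) =
            (\<Sum>i\<in>I - insert j F. s * (u i * x i))"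
          by (rule sum.cong) auto
        then show ?thesis
          unfolding sum.remove[OF *(2,3)] *(1) sum_distrib_left by simp
      qed
      note IH = insert.IH[OF j(3), of "\<lambda>i. if i = j then \<theta> else s * u i", unfolded **]
      show "(CLINT x|\<mu>. of_real (?h x) * iexp (\<theta> * x j + s * (\<Sum>i\<in>I - insert j F. u i * x i))) =
          (CLINT x|\<nu>. of_real (?h x) * iexp (\<theta> * x j + s * (\<Sum>i\<in>I - insert j F. u i * x i)))"
        by (rule IH)
    next
      show "(\<lambda>x. x j) \<in> borel_measurable \<mu>" "(\<lambda>x. x j) \<in> borel_measurable \<nu>" using j by measurable
    next
      show "(\<lambda>x. \<Sum>i\<in>I - insert j F. u i * x i) \<in> borel_measurable \<mu>"
        "(\<lambda>x. \<Sum>i\<in>I - insert j F. u i * x i) \<in> borel_measurable \<nu>" by measurable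
    next
      show "B j \<in> sets borel" using j by simp
    next
      show "finite_measure \<mu>" "finite_measure \<nu>" by fact+
      show "?h \<in> borel_measurable \<mu>" "?h \<in> borel_measurable \<nu>" by (rule hm)+
      show "0 \<le> ?h x" "?h x \<le> 1" "0 \<le> ?h x" "?h x \<le> 1" for x :: "'i \<Rightarrow> real" by (rule h)+
    qed
    then show ?case using j insert.hyps by (simp add: mult.commute)
  qed
  show ?thesis
  proof (rule measure_eqI_PiM_finite[of I \<mu> _ \<nu>])
    show "range (\<lambda>_::nat. vecs I) \<subseteq> prod_algebra I (\<lambda>_. borel :: real measure)"
      using \<open>finite I\<close> by (auto intro!: prod_algebraI_finite)
    show "(\<Union>i::nat. vecs I) = space (Pi\<^sub>M I (\<lambda>_. borel :: real measure))"
      by (auto simp: space_PiM)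
    show "emeasure \<mu> (vecs I) \<noteq> \<infinity>" by simp
    fix A :: "'i \<Rightarrow> real set" assume A: "\<And>i. i \<in> I \<Longrightarrow> A i \<in> sets borel"
    have S: "Pi\<^sub>E I A \<in> sets (borel_vec I)" using \<open>finite I\<close> A by (intro sets_PiM_I_finite) auto
    have ind: "(\<Prod>j\<in>I. indicator (A j) (x j)) = (indicator (Pi\<^sub>E I A) x :: real)" if "x \<in> vecs I" for x
    proof (cases "\<forall>j\<in>I. x j \<in> A j")
      case True
      then have "x \<in> Pi\<^sub>E I A" using that by (auto simp: PiE_iff)
      then show ?thesis using True by simp
    next
      case False
      then have "x \<notin> Pi\<^sub>E I A" by auto
      moreover have "(\<Prod>j\<in>I. indicator (A j) (x j) :: real) = 0"
        using False \<open>finite I\<close> by (intro prod_zero) (auto simp: indicator_def)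
      ultimately show ?thesis by simp
    qed
    have int: "complex_of_real (measure N (Pi\<^sub>E I A)) = (CLINT x|N. of_real (\<Prod>j\<in>I. indicator (A j) (x j)))"
      if N: "finite_measure N" "sets N = sets (borel_vec I)" for N :: "('i \<Rightarrow> real) measure"
    proof -
      have "(CLINT x|N. of_real (\<Prod>j\<in>I. indicator (A j) (x j))) = (CLINT x|N. of_real (indicator (Pi\<^sub>E I A) x))"
        using sets_eq_imp_space_eq[OF N(2)]
        by (intro Bochner_Integration.integral_cong refl arg_cong[where f=of_real] ind) (simp add: space_PiM)
      also have "\<dots> = of_real (\<integral>x. indicator (Pi\<^sub>E I A) x \<partial>N)" by (rule integral_complex_of_real)
      also have "(\<integral>x. indicator (Pi\<^sub>E I A) x \<partial>N) = measure N (Pi\<^sub>E I A)"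
        using sets.sets_into_space[of "Pi\<^sub>E I A" N] S N(2) by (simp add: Int_absorb2)
      finally show ?thesis by (rule sym)
    qed
    have "complex_of_real (measure \<mu> (Pi\<^sub>E I A)) = complex_of_real (measure \<nu> (Pi\<^sub>E I A))"
      unfolding int[OF assms(2) sets(1)] int[OF assms(3) sets(2)]
      using main[OF \<open>finite I\<close> subset_refl A] by (simp del: of_real_prod)
    then have "measure \<mu> (Pi\<^sub>E I A) = measure \<nu> (Pi\<^sub>E I A)" by (simp only: of_real_eq_iff)
    then show "emeasure \<mu> (Pi\<^sub>E I A) = emeasure \<nu> (Pi\<^sub>E I A)"
      by (simp add: \<mu>.emeasure_eq_measure \<nu>.emeasure_eq_measure)
  qed (use assms in auto)
qed

text \<open>A pair of vectors is a vector indexed by the disjoint sum of the two index sets.\<close>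
lemma char_unique_pair_PiM:
  fixes \<mu> \<nu> :: "(('i \<Rightarrow> real) \<times> ('j \<Rightarrow> real)) measure"
  assumes fin: "finite I" "finite J" and "finite_measure \<mu>" "finite_measure \<nu>"
    and sets: "sets \<mu> = sets (borel_vec I \<Otimes>\<^sub>M borel_vec J)" "sets \<nu> = sets (borel_vec I \<Otimes>\<^sub>M borel_vec J)"
    and eq: "\<And>u w. (CLINT (x, y)|\<mu>. iexp ((\<Sum>i\<in>I. u i * x i) + (\<Sum>j\<in>J. w j * y j))) =
                  (CLINT (x, y)|\<nu>. iexp ((\<Sum>i\<in>I. u i * x i) + (\<Sum>j\<in>J. w j * y j)))"
  shows "\<mu> = \<nu>"
proof -
  let ?P = "borel_vec I \<Otimes>\<^sub>M borel_vec J" and ?S = "borel_vec (I <+> J)"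
  define join :: "('i \<Rightarrow> real) \<times> ('j \<Rightarrow> real) \<Rightarrow> 'i + 'j \<Rightarrow> real"
    where "join = (\<lambda>(x, y). \<lambda>k\<in>I <+> J. case_sum x y k)"
  define split :: "('i + 'j \<Rightarrow> real) \<Rightarrow> ('i \<Rightarrow> real) \<times> ('j \<Rightarrow> real)"
    where "split = (\<lambda>z. (\<lambda>i\<in>I. z (Inl i), \<lambda>j\<in>J. z (Inr j)))"
  have join: "join \<in> ?P \<rightarrow>\<^sub>M ?S"
    unfolding join_def case_prod_beta
  proof (rule measurable_restrict)
    fix k assume "k \<in> I <+> J"
    then show "(\<lambda>p. case_sum (fst p) (snd p) k) \<in> borel_measurable ?P"
      by (elim PlusE) (auto intro: measurable_compose[OF measurable_fst] measurable_compose[OF measurable_snd] measurable_component_singleton)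
  qed
  have split: "split \<in> ?S \<rightarrow>\<^sub>M ?P"
    unfolding split_def
    by (intro measurable_Pair measurable_restrict measurable_component_singleton) auto
  have split_join: "split (join p) = p" if "p \<in> space ?P" for p
    using that by (auto simp: split_def join_def space_pair_measure space_PiM PiE_iff extensional_def restrict_def fun_eq_iff)
  have distr: "N = distr (distr N ?S join) ?P split" if "sets N = sets ?P" for N
  proof -
    note [measurable_cong] = that
    have "distr (distr N ?S join) ?P split = distr N ?P (split \<circ> join)"
      using join split by (intro distr_distr) (simp_all add: measurable_cong_sets[OF that refl])
    also have "\<dots> = distr N N (\<lambda>p. p)"
      using sets_eq_imp_space_eq[OF that] by (intro distr_cong) (auto simp: that split_join)
    also have "\<dots> = N" by (simp add: distr_id2)
    finally show ?thesis by (rule sym)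
  qed
  have jm: "join \<in> \<mu> \<rightarrow>\<^sub>M ?S" "join \<in> \<nu> \<rightarrow>\<^sub>M ?S"
    using join by (simp_all add: measurable_cong_sets[OF sets(1) refl] measurable_cong_sets[OF sets(2) refl])
  have "distr \<mu> ?S join = distr \<nu> ?S join"
  proof (rule char_unique_PiM)
    show "finite_measure (distr \<mu> ?S join)" "finite_measure (distr \<nu> ?S join)"
      using jm assms(3,4) by (auto intro: finite_measure.finite_measure_distr)
    fix u :: "'i + 'j \<Rightarrow> real"
    have sums: "(\<Sum>k\<in>I <+> J. u k * join p k) =
        (\<Sum>i\<in>I. u (Inl i) * fst p i) + (\<Sum>j\<in>J. u (Inr j) * snd p j)" for p
    proof -
      have "join p (Inl i) = fst p i" if "i \<in> I" for i using that by (simp add: join_def case_prod_beta InlI InrI)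
      moreover have "join p (Inr j) = snd p j" if "j \<in> J" for j using that by (simp add: join_def case_prod_beta InlI InrI)
      ultimately show ?thesis using fin by (simp add: sum.Plus)
    qed
    have "(\<lambda>z. iexp (\<Sum>k\<in>I <+> J. u k * z k)) \<in> borel_measurable ?S" by measurable
    note meas = this
    have i: "(CLINT z|distr N ?S join. iexp (\<Sum>k\<in>I <+> J. u k * z k)) =
      (CLINT (x, y)|N. iexp ((\<Sum>i\<in>I. u (Inl i) * x i) + (\<Sum>j\<in>J. u (Inr j) * y j)))"
      if N: "join \<in> N \<rightarrow>\<^sub>M ?S" for N
      unfolding integral_distr[OF N meas] by (simp only: sums case_prod_beta')
    show "(CLINT z|distr \<mu> ?S join. iexp (\<Sum>k\<in>I <+> J. u k * z k)) =
      (CLINT z|distr \<nu> ?S join. iexp (\<Sum>k\<in>I <+> J. u k * z k))"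
      unfolding i[OF jm(1)] i[OF jm(2)] by (rule eq)
  qed (use fin in auto)
  then show ?thesis using distr[OF sets(1)] distr[OF sets(2)] by simp
qed

lemma is_normal_char:
  assumes "is_normal I m C \<mu>"
  shows "(CLINT x|\<mu>. iexp (\<Sum>i\<in>I. u i * x i)) =
    iexp (\<Sum>i\<in>I. u i * m i) * of_real (exp (- (\<Sum>i\<in>I. \<Sum>k\<in>I. u i * C i k * u k) / 2))"
proof -
  let ?q = "\<Sum>i\<in>I. \<Sum>k\<in>I. u i * C i k * u k"
  have s: "sets \<mu> = sets (borel_vec I)" and q: "0 \<le> ?q"
    and d: "distr \<mu> borel (\<lambda>x. \<Sum>i\<in>I. u i * x i) = normal_real (\<Sum>i\<in>I. u i * m i) ?q"
    using assms unfolding is_normal_def by blast+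
  have "(\<lambda>x. \<Sum>i\<in>I. u i * x i) \<in> borel_measurable (borel_vec I)" by measurable
  then have [measurable]: "(\<lambda>x. \<Sum>i\<in>I. u i * x i) \<in> borel_measurable \<mu>"
    by (simp only: measurable_cong_sets[OF s refl])
  have "(CLINT x|\<mu>. iexp (\<Sum>i\<in>I. u i * x i)) = char (distr \<mu> borel (\<lambda>x. \<Sum>i\<in>I. u i * x i)) 1"
    unfolding char_def by (subst integral_distr) auto
  then show ?thesis unfolding d char_normal_real[OF q] by simp
qed

lemma is_normal_unique:
  assumes "finite I" and \<mu>: "is_normal I m C \<mu>" and \<nu>: "is_normal I m' C \<nu>" and m: "\<And>i. i \<in> I \<Longrightarrow> m i = m' i"
  shows "\<mu> = \<nu>"
proof (rule char_unique_PiM[OF \<open>finite I\<close>])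
  show "finite_measure \<mu>" "finite_measure \<nu>" "sets \<mu> = sets (borel_vec I)" "sets \<nu> = sets (borel_vec I)"
    using \<mu> \<nu> by (auto simp: is_normal_def prob_space_def)
  show "(CLINT x|\<mu>. iexp (\<Sum>i\<in>I. u i * x i)) = (CLINT x|\<nu>. iexp (\<Sum>i\<in>I. u i * x i))" for u
    unfolding is_normal_char[OF \<mu>] is_normal_char[OF \<nu>] using m by simp
qed

section \<open>Integrals along the paths of a Gaussian process\<close>

locale gaussian_process_with_continuous_covariance = prob_space M
  for M :: "'a measure" and T :: real and X :: "real \<Rightarrow> 'a \<Rightarrow> real" +
  assumes T_nonneg: "0 \<le> T"
    and gaussian: "gaussian_process T M X"
    and bimeas: "bimeasurable T M X"
    and centered: "\<And>s. s \<in> {0..T} \<Longrightarrow> expectation (X s) = 0"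
    and cont: "continuous_on ({0..T} \<times> {0..T}) (\<lambda>(r, s). cov_fun M X r s)"
begin

abbreviation "K \<equiv> cov_fun M X"

definition lebesgue_T :: "real measure" where "lebesgue_T = restrict_space lborel {0..T}"

lemma sets_lebesgue_T [measurable_cong]: "sets lebesgue_T = sets (restrict_space borel {0..T})"
  by (simp add: lebesgue_T_def sets_restrict_space)

lemma space_lebesgue_T: "space lebesgue_T = {0..T}"
  by (simp add: lebesgue_T_def space_restrict_space)

lemma emeasure_lebesgue_T: "emeasure lebesgue_T (space lebesgue_T) = ennreal T"
  using T_nonneg by (simp add: space_lebesgue_T) (simp add: lebesgue_T_def emeasure_restrict_space)

lemma finite_measure_lebesgue_T: "finite_measure lebesgue_T"
  by standard (simp add: emeasure_lebesgue_T)

sublocale lebesgue_T: finite_measure lebesgue_T by (rule finite_measure_lebesgue_T)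
sublocale time_sample: pair_sigma_finite lebesgue_T M ..

lemma measure_lebesgue_T: "measure lebesgue_T (space lebesgue_T) = T"
  using T_nonneg by (simp add: measure_def emeasure_lebesgue_T)

lemma set_integral_eq_lebesgue_T: "(LINT s:{0..T}|lborel. f s) = (\<integral>s. f s \<partial>lebesgue_T)"
  for f :: "real \<Rightarrow> real"
  by (simp add: lebesgue_T_def integral_restrict_space set_lebesgue_integral_def)

lemma measurable_lebesgue_T_continuous: "continuous_on {0..T} g \<Longrightarrow> g \<in> borel_measurable lebesgue_T"
  for g :: "real \<Rightarrow> real"
  by (simp add: measurable_cong_sets[OF sets_lebesgue_T refl] borel_measurable_continuous_on_restrict)

lemma X_bimeasurable: "(\<lambda>p. X (fst p) (snd p)) \<in> borel_measurable (lebesgue_T \<Otimes>\<^sub>M M)"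
  using bimeas unfolding bimeasurable_def case_prod_beta
  by (simp add: measurable_cong_sets[OF sets_pair_measure_cong[OF sets_lebesgue_T refl] refl])

lemma X_measurable: "s \<in> {0..T} \<Longrightarrow> X s \<in> borel_measurable M"
  using gaussian by (simp add: gaussian_process_def)

text \<open>The points \<open>p i\<close> need not be distinct, so the coefficients belonging to the same time are added
  up before the definition of a Gaussian process applies to the set of times.\<close>
lemma linear_combination_normal:
  assumes "finite I" "\<And>i. i \<in> I \<Longrightarrow> p i \<in> {0..T}"
  shows "\<exists>m v. 0 \<le> v \<and> distr M borel (\<lambda>\<omega>. \<Sum>i\<in>I. u i * X (p i) \<omega>) = normal_real m v"
proof -
  let ?S = "p ` I"
  obtain m C where N: "is_normal ?S m C (distr M (borel_vec ?S) (\<lambda>\<omega>. \<lambda>s\<in>?S. X s \<omega>))"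
    using gaussian assms unfolding gaussian_process_def by (meson finite_imageI image_subsetI)
  define c where "c s = (\<Sum>i | i \<in> I \<and> p i = s. u i)" for s
  have "(\<Sum>i\<in>I. u i * X (p i) \<omega>) = (\<Sum>s\<in>?S. c s * X s \<omega>)" for \<omega>
    using sum.image_gen[OF \<open>finite I\<close>, of "\<lambda>i. u i * X (p i) \<omega>" p] by (simp add: c_def sum_distrib_right)
  then have "distr M borel (\<lambda>\<omega>. \<Sum>i\<in>I. u i * X (p i) \<omega>) =
      distr (distr M (borel_vec ?S) (\<lambda>\<omega>. \<lambda>s\<in>?S. X s \<omega>)) borel (\<lambda>x. \<Sum>s\<in>?S. c s * x s)"
    using assms by (subst distr_distr) (auto simp: comp_def intro!: measurable_restrict X_measurable)
  also have "\<dots> = normal_real (\<Sum>s\<in>?S. c s * m s) (\<Sum>s\<in>?S. \<Sum>r\<in>?S. c s * C s r * c r)"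
    using N unfolding is_normal_def by blast
  finally show ?thesis using N unfolding is_normal_def by blast
qed

lemma X_moments:
  assumes s: "s \<in> {0..T}"
  shows "integrable M (X s)" "integrable M (\<lambda>\<omega>. (X s \<omega>)\<^sup>2)"
proof -
  obtain m v where "0 \<le> v" "distr M borel (X s) = normal_real m v"
    using linear_combination_normal[of "{s}" "\<lambda>s. s" "\<lambda>_. 1"] s by auto
  from normal_real_moments[OF X_measurable[OF s] this]
  show "integrable M (X s)" "integrable M (\<lambda>\<omega>. (X s \<omega>)\<^sup>2)" by auto
qed

lemma linear_combination_centered_gaussian:
  assumes I: "finite I" "\<And>i. i \<in> I \<Longrightarrow> p i \<in> {0..T}"
  shows "centered_gaussian M (\<lambda>\<omega>. \<Sum>i\<in>I. u i * X (p i) \<omega>)"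
proof -
  obtain m v where v: "0 \<le> v" and d: "distr M borel (\<lambda>\<omega>. \<Sum>i\<in>I. u i * X (p i) \<omega>) = normal_real m v"
    using linear_combination_normal[OF I(1), of p u] I(2) by blast
  have meas: "(\<lambda>\<omega>. \<Sum>i\<in>I. u i * X (p i) \<omega>) \<in> borel_measurable M"
    using I by (auto intro!: borel_measurable_sum borel_measurable_times X_measurable)
  have "m = expectation (\<lambda>\<omega>. \<Sum>i\<in>I. u i * X (p i) \<omega>)"
    using normal_real_moments(3)[OF meas v d] by simp
  also have "\<dots> = (\<Sum>i\<in>I. expectation (\<lambda>\<omega>. u i * X (p i) \<omega>))"
    using I X_moments(1) by (intro Bochner_Integration.integral_sum integrable_mult_right) auto
  also have "\<dots> = 0" using I centered by (intro sum.neutral) simp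
  finally show ?thesis using v d meas by (auto simp: centered_gaussian_def)
qed

lemma K_bounded:
  obtains B where "0 \<le> B" "\<And>r s. r \<in> {0..T} \<Longrightarrow> s \<in> {0..T} \<Longrightarrow> \<bar>K r s\<bar> \<le> B"
proof -
  have "compact ((\<lambda>(r, s). K r s) ` ({0..T} \<times> {0..T}))"
    by (intro compact_continuous_image cont compact_Times compact_Icc)
  then obtain B where "\<forall>x\<in>(\<lambda>(r, s). K r s) ` ({0..T} \<times> {0..T}). norm x \<le> B"
    using compact_imp_bounded bounded_iff by metis
  then have B: "\<bar>K r s\<bar> \<le> B" if "r \<in> {0..T}" "s \<in> {0..T}" for r s using that by force
  from B[of 0 0] T_nonneg have "0 \<le> B" by simp
  from this B show ?thesis by (rule that)
qed

text \<open>Fubini and Cauchy-Schwarz for the random integral of a jointly measurable field with bounded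
  second moments. It is needed twice: for the integral of the process itself, and for the error
  committed when the time variable is discretised.\<close>
lemma L2_integral_properties:
  fixes \<Phi> :: "real \<Rightarrow> 'a \<Rightarrow> real"
  assumes \<Phi>m [measurable]: "(\<lambda>p. \<Phi> (fst p) (snd p)) \<in> borel_measurable (lebesgue_T \<Otimes>\<^sub>M M)"
    and sq: "\<And>s. s \<in> {0..T} \<Longrightarrow> integrable M (\<lambda>\<omega>. (\<Phi> s \<omega>)\<^sup>2)"
    and bnd: "\<And>s. s \<in> {0..T} \<Longrightarrow> expectation (\<lambda>\<omega>. (\<Phi> s \<omega>)\<^sup>2) \<le> B"
  shows L2_integral_AE: "AE \<omega> in M. integrable lebesgue_T (\<lambda>s. \<Phi> s \<omega>)"
    and L2_integral_measurable: "(\<lambda>\<omega>. \<integral>s. \<Phi> s \<omega> \<partial>lebesgue_T) \<in> borel_measurable M"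
    and L2_integral_square: "integrable M (\<lambda>\<omega>. (\<integral>s. \<Phi> s \<omega> \<partial>lebesgue_T)\<^sup>2)"
    and L2_integral_square_le: "expectation (\<lambda>\<omega>. (\<integral>s. \<Phi> s \<omega> \<partial>lebesgue_T)\<^sup>2) \<le> T * (\<integral>s. expectation (\<lambda>\<omega>. (\<Phi> s \<omega>)\<^sup>2) \<partial>lebesgue_T)"
    and L2_integral_inner: "\<And>Q. Q \<in> borel_measurable M \<Longrightarrow> integrable M (\<lambda>\<omega>. (Q \<omega>)\<^sup>2) \<Longrightarrow>
      expectation (\<lambda>\<omega>. Q \<omega> * (\<integral>s. \<Phi> s \<omega> \<partial>lebesgue_T)) = (\<integral>s. expectation (\<lambda>\<omega>. Q \<omega> * \<Phi> s \<omega>) \<partial>lebesgue_T)"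
proof -
  have m1: "\<Phi> s \<in> borel_measurable M" if "s \<in> {0..T}" for s
    using measurable_compose[OF measurable_Pair1'[of s lebesgue_T M] \<Phi>m] that by (simp add: space_lebesgue_T)
  have m2: "(\<lambda>s. \<Phi> s \<omega>) \<in> borel_measurable lebesgue_T" if "\<omega> \<in> space M" for \<omega>
    using measurable_compose[OF measurable_Pair2'[of \<omega> M lebesgue_T] \<Phi>m] that by simp
  have "case_prod \<Phi> \<in> borel_measurable (lebesgue_T \<Otimes>\<^sub>M M)" using \<Phi>m by (simp add: case_prod_beta')
  have dm: "(\<lambda>s. expectation (\<lambda>\<omega>. (\<Phi> s \<omega>)\<^sup>2)) \<in> borel_measurable lebesgue_T"
    by (rule borel_measurable_lebesgue_integral) (simp add: case_prod_beta')
  have id: "integrable lebesgue_T (\<lambda>s. expectation (\<lambda>\<omega>. (\<Phi> s \<omega>)\<^sup>2))"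
    using bnd dm by (intro lebesgue_T.integrable_const_bound[of _ B]) (auto simp: space_lebesgue_T intro!: AE_I2)
  have ip: "integrable (lebesgue_T \<Otimes>\<^sub>M M) (\<lambda>(s, \<omega>). (\<Phi> s \<omega>)\<^sup>2)"
    using id sq by (intro time_sample.Fubini_integrable) (auto simp: case_prod_beta' space_lebesgue_T intro!: AE_I2)
  have AE2: "AE \<omega> in M. integrable lebesgue_T (\<lambda>s. (\<Phi> s \<omega>)\<^sup>2)"
    by (rule time_sample.AE_integrable_snd[OF ip])
  have "integrable lebesgue_T (\<lambda>s. \<Phi> s \<omega>)" if "integrable lebesgue_T (\<lambda>s. (\<Phi> s \<omega>)\<^sup>2)" "\<omega> \<in> space M" for \<omega>
    using integrable_mult_of_square[of "\<lambda>s. \<Phi> s \<omega>" lebesgue_T "\<lambda>_. 1"] that m2 by simp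
  then have "AE \<omega> in M. integrable lebesgue_T (\<lambda>s. (\<Phi> s \<omega>)\<^sup>2) \<longrightarrow> integrable lebesgue_T (\<lambda>s. \<Phi> s \<omega>)"
    by (intro AE_I2 impI)
  then show "AE \<omega> in M. integrable lebesgue_T (\<lambda>s. \<Phi> s \<omega>)"
    by (rule AE_mp[OF AE2])
  show Jm: "(\<lambda>\<omega>. \<integral>s. \<Phi> s \<omega> \<partial>lebesgue_T) \<in> borel_measurable M"
    by (rule lebesgue_T.borel_measurable_lebesgue_integral)
      (use measurable_compose[OF measurable_pair_swap'[of M lebesgue_T] \<Phi>m] in \<open>simp add: case_prod_beta'\<close>)
  have le: "AE \<omega> in M. (\<integral>s. \<Phi> s \<omega> \<partial>lebesgue_T)\<^sup>2 \<le> T * (\<integral>s. (\<Phi> s \<omega>)\<^sup>2 \<partial>lebesgue_T)"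
    using AE2
  proof (rule AE_mp, intro AE_I2 impI)
    fix \<omega> assume "\<omega> \<in> space M" "integrable lebesgue_T (\<lambda>s. (\<Phi> s \<omega>)\<^sup>2)"
    then show "(\<integral>s. \<Phi> s \<omega> \<partial>lebesgue_T)\<^sup>2 \<le> T * (\<integral>s. (\<Phi> s \<omega>)\<^sup>2 \<partial>lebesgue_T)"
      using integral_Cauchy_Schwarz[of "\<lambda>s. \<Phi> s \<omega>" lebesgue_T "\<lambda>_. 1"] m2 by (simp add: measure_lebesgue_T mult.commute)
  qed
  have iT: "integrable M (\<lambda>\<omega>. T * (\<integral>s. (\<Phi> s \<omega>)\<^sup>2 \<partial>lebesgue_T))"
    using time_sample.integrable_snd[OF ip] by (intro integrable_mult_right) simp
  show J2: "integrable M (\<lambda>\<omega>. (\<integral>s. \<Phi> s \<omega> \<partial>lebesgue_T)\<^sup>2)"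
  proof (rule Bochner_Integration.integrable_bound[OF iT])
    show "AE \<omega> in M. norm ((\<integral>s. \<Phi> s \<omega> \<partial>lebesgue_T)\<^sup>2) \<le> norm (T * (\<integral>s. (\<Phi> s \<omega>)\<^sup>2 \<partial>lebesgue_T))"
      using le by (rule AE_mp) (auto intro!: AE_I2)
  qed (use Jm in measurable)
  have "expectation (\<lambda>\<omega>. (\<integral>s. \<Phi> s \<omega> \<partial>lebesgue_T)\<^sup>2) \<le> expectation (\<lambda>\<omega>. T * (\<integral>s. (\<Phi> s \<omega>)\<^sup>2 \<partial>lebesgue_T))"
    by (rule integral_mono_AE[OF J2 iT le])
  also have "\<dots> = T * (\<integral>s. expectation (\<lambda>\<omega>. (\<Phi> s \<omega>)\<^sup>2) \<partial>lebesgue_T)"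
    using time_sample.Fubini_integral[OF ip] by simp
  finally show "expectation (\<lambda>\<omega>. (\<integral>s. \<Phi> s \<omega> \<partial>lebesgue_T)\<^sup>2) \<le> T * (\<integral>s. expectation (\<lambda>\<omega>. (\<Phi> s \<omega>)\<^sup>2) \<partial>lebesgue_T)" .
  fix Q :: "'a \<Rightarrow> real" assume Qm [measurable]: "Q \<in> borel_measurable M" and Q: "integrable M (\<lambda>\<omega>. (Q \<omega>)\<^sup>2)"
  have Q2m: "(\<lambda>p. Q (snd p)) \<in> borel_measurable (lebesgue_T \<Otimes>\<^sub>M M)"
    by (rule measurable_compose[OF measurable_snd Qm])
  have iq: "integrable (lebesgue_T \<Otimes>\<^sub>M M) (\<lambda>p. (Q (snd p))\<^sup>2)"
  proof (rule time_sample.Fubini_integrable)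
    show "(\<lambda>p. (Q (snd p))\<^sup>2) \<in> borel_measurable (lebesgue_T \<Otimes>\<^sub>M M)"
      by (rule borel_measurable_power[OF Q2m])
    show "integrable lebesgue_T (\<lambda>s. \<integral>\<omega>. norm ((Q (snd (s, \<omega>)))\<^sup>2) \<partial>M)"
      by (simp only: snd_conv) (rule lebesgue_T.integrable_const)
    show "AE s in lebesgue_T. integrable M (\<lambda>\<omega>. (Q (snd (s, \<omega>)))\<^sup>2)"
      by (intro AE_I2) (simp only: snd_conv Q)
  qed
  have "integrable (lebesgue_T \<Otimes>\<^sub>M M) (\<lambda>p. Q (snd p) * \<Phi> (fst p) (snd p))"
    by (rule integrable_mult_of_square[OF Q2m \<Phi>m iq ip[unfolded case_prod_beta']])
  then have "integrable (lebesgue_T \<Otimes>\<^sub>M M) (\<lambda>(s, \<omega>). Q \<omega> * \<Phi> s \<omega>)" by (simp add: case_prod_beta')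
  from time_sample.Fubini_integral[OF this]
  show "expectation (\<lambda>\<omega>. Q \<omega> * (\<integral>s. \<Phi> s \<omega> \<partial>lebesgue_T)) = (\<integral>s. expectation (\<lambda>\<omega>. Q \<omega> * \<Phi> s \<omega>) \<partial>lebesgue_T)"
    by simp
qed

lemma X_sq: "expectation (\<lambda>\<omega>. (X s \<omega>)\<^sup>2) = K s s"
  by (simp add: cov_fun_def power2_eq_square)

definition path_integral :: "(real \<Rightarrow> real) \<Rightarrow> 'a \<Rightarrow> real" where
  "path_integral g \<omega> = (\<integral>s. X s \<omega> * g s \<partial>lebesgue_T)"

lemma X_times_sq:
  assumes "s \<in> {0..T}"
  shows "integrable M (\<lambda>\<omega>. (X s \<omega> * g s)\<^sup>2)"
  using X_moments[OF assms] by (simp add: power_mult_distrib)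

context
  fixes g :: "real \<Rightarrow> real"
  assumes g: "continuous_on {0..T} g"
begin

lemma X_times_meas: "(\<lambda>p. X (fst p) (snd p) * g (fst p)) \<in> borel_measurable (lebesgue_T \<Otimes>\<^sub>M M)"
  using X_bimeasurable measurable_compose[OF measurable_fst measurable_lebesgue_T_continuous[OF g]]
  by (intro borel_measurable_times)

lemma continuous_bounded:
  obtains C where "0 \<le> C" "\<And>s. s \<in> {0..T} \<Longrightarrow> \<bar>g s\<bar> \<le> C"
proof -
  have "compact (g ` {0..T})" by (intro compact_continuous_image g compact_Icc)
  then obtain B where "\<forall>x\<in>g ` {0..T}. norm x \<le> B"
    using compact_imp_bounded bounded_iff by metis
  then have B: "\<bar>g s\<bar> \<le> B" if "s \<in> {0..T}" for s using that by force
  from B[of 0] T_nonneg have "0 \<le> B" by simp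
  from this B show ?thesis by (rule that)
qed

lemma X_times_bounded:
  obtains B where "\<And>s. s \<in> {0..T} \<Longrightarrow> expectation (\<lambda>\<omega>. (X s \<omega> * g s)\<^sup>2) \<le> B"
proof -
  obtain C where C: "0 \<le> C" "\<And>s. s \<in> {0..T} \<Longrightarrow> \<bar>g s\<bar> \<le> C" by (rule continuous_bounded) blast
  obtain B where B: "0 \<le> B" "\<And>r s. r \<in> {0..T} \<Longrightarrow> s \<in> {0..T} \<Longrightarrow> \<bar>K r s\<bar> \<le> B" by (rule K_bounded) blast
  have "expectation (\<lambda>\<omega>. (X s \<omega> * g s)\<^sup>2) \<le> B * C\<^sup>2" if s: "s \<in> {0..T}" for s
  proof -
    have "(g s)\<^sup>2 \<le> C\<^sup>2" using C(2)[OF s] by (metis abs_ge_zero power2_abs power_mono)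
    then have "K s s * (g s)\<^sup>2 \<le> B * C\<^sup>2"
      using B(1) B(2)[OF s s] by (intro mult_mono) auto
    then show ?thesis by (simp add: power_mult_distrib X_sq)
  qed
  then show ?thesis by (rule that)
qed

text \<open>The last claim interchanges expectation and time integration, which expresses all covariances
  with path integrals through the covariance function.\<close>
lemma path_integral_properties:
  shows path_integral_integrable_paths: "AE \<omega> in M. integrable lebesgue_T (\<lambda>s. X s \<omega> * g s)"
    and path_integral_measurable: "path_integral g \<in> borel_measurable M"
    and path_integral_square_integrable: "integrable M (\<lambda>\<omega>. (path_integral g \<omega>)\<^sup>2)"
    and path_integral_inner: "\<And>Q. Q \<in> borel_measurable M \<Longrightarrow> integrable M (\<lambda>\<omega>. (Q \<omega>)\<^sup>2) \<Longrightarrow>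
      expectation (\<lambda>\<omega>. Q \<omega> * path_integral g \<omega>) = (\<integral>s. expectation (\<lambda>\<omega>. Q \<omega> * X s \<omega>) * g s \<partial>lebesgue_T)"
proof -
  obtain B where B: "\<And>s. s \<in> {0..T} \<Longrightarrow> expectation (\<lambda>\<omega>. (X s \<omega> * g s)\<^sup>2) \<le> B"
    by (rule X_times_bounded) blast
  note * = X_times_meas X_times_sq[where g = g] B
  show "AE \<omega> in M. integrable lebesgue_T (\<lambda>s. X s \<omega> * g s)" by (rule L2_integral_AE[OF *])
  have eq: "path_integral g = (\<lambda>\<omega>. \<integral>s. X s \<omega> * g s \<partial>lebesgue_T)" by (simp add: path_integral_def fun_eq_iff)
  show "path_integral g \<in> borel_measurable M" unfolding eq by (rule L2_integral_measurable[OF *])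
  show "integrable M (\<lambda>\<omega>. (path_integral g \<omega>)\<^sup>2)" unfolding eq by (rule L2_integral_square[OF *])
  show "expectation (\<lambda>\<omega>. Q \<omega> * path_integral g \<omega>) = (\<integral>s. expectation (\<lambda>\<omega>. Q \<omega> * X s \<omega>) * g s \<partial>lebesgue_T)"
    if "Q \<in> borel_measurable M" "integrable M (\<lambda>\<omega>. (Q \<omega>)\<^sup>2)" for Q
    using L2_integral_inner[OF * that] unfolding eq by (simp add: mult.assoc[symmetric])
qed

end

text \<open>Rounding down to a multiple of \<open>1 / (m + 1)\<close>. The last grid point may lie below \<open>T\<close>, which is
  harmless, and rounding down keeps the values inside the interval.\<close>
definition grid :: "nat \<Rightarrow> real \<Rightarrow> real" where
  "grid m s = of_int \<lfloor>s * real (Suc m)\<rfloor> / real (Suc m)"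

lemma grid_bounds:
  assumes "s \<in> {0..T}"
  shows "grid m s \<in> {0..T}" "grid m s \<le> s" "s - 1 / real (Suc m) \<le> grid m s"
proof -
  have m: "0 < real (Suc m)" by simp
  show "grid m s \<le> s"
    unfolding grid_def using m by (subst pos_divide_le_eq) auto
  moreover have "0 \<le> grid m s"
    unfolding grid_def using assms m by (intro divide_nonneg_pos) auto
  ultimately show "grid m s \<in> {0..T}" using assms by auto
  have "s * real (Suc m) - 1 \<le> of_int \<lfloor>s * real (Suc m)\<rfloor>" by linarith
  then have "(s * real (Suc m) - 1) / real (Suc m) \<le> grid m s"
    unfolding grid_def using m by (intro divide_right_mono) auto
  then show "s - 1 / real (Suc m) \<le> grid m s" using m by (simp add: diff_divide_distrib)
qed

lemma grid_tendsto:
  assumes "s \<in> {0..T}"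
  shows "(\<lambda>m. grid m s) \<longlonglongrightarrow> s"
proof (rule tendsto_sandwich)
  show "(\<lambda>m. s - 1 / real (Suc m)) \<longlonglongrightarrow> s"
    using tendsto_diff[OF tendsto_const[of s] LIMSEQ_inverse_real_of_nat] by (simp add: inverse_eq_divide)
  show "(\<lambda>_. s) \<longlonglongrightarrow> s" by simp
qed (use grid_bounds[OF assms] in auto)

lemma grid_measurable: "grid m \<in> lebesgue_T \<rightarrow>\<^sub>M lebesgue_T"
proof -
  have "grid m \<in> borel_measurable borel" unfolding grid_def by measurable
  then have "grid m \<in> restrict_space borel {0..T} \<rightarrow>\<^sub>M restrict_space borel {0..T}"
    using grid_bounds(1) by (intro measurable_restrict_space3) auto
  then show ?thesis by (simp add: measurable_cong_sets[OF sets_lebesgue_T sets_lebesgue_T])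
qed

lemma finite_grid: "finite (grid m ` {0..T})"
proof (rule finite_subset)
  show "grid m ` {0..T} \<subseteq> (\<lambda>k. of_int k / real (Suc m)) ` {0..\<lfloor>T * real (Suc m)\<rfloor>}"
  proof safe
    fix s assume "s \<in> {0..T}"
    then have "0 \<le> s * real (Suc m)" "s * real (Suc m) \<le> T * real (Suc m)" by (auto intro: mult_right_mono)
    then have "\<lfloor>s * real (Suc m)\<rfloor> \<in> {0..\<lfloor>T * real (Suc m)\<rfloor>}" by (auto intro: floor_mono)
    then show "grid m s \<in> (\<lambda>k. of_int k / real (Suc m)) ` {0..\<lfloor>T * real (Suc m)\<rfloor>}"
      unfolding grid_def by (rule imageI)
  qed
qed simp

text \<open>A function of the rounded time is a step function, so its integral is a finite linear combination
  of its values on the grid. Applied to paths, this is a linear combination of values of the process.\<close>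
lemma integral_grid:
  fixes h :: "real \<Rightarrow> real"
  shows "(\<integral>s. h (grid m s) \<partial>lebesgue_T) = (\<Sum>p\<in>grid m ` {0..T}. h p * measure lebesgue_T {s \<in> space lebesgue_T. grid m s = p})"
    "integrable lebesgue_T (\<lambda>s. h (grid m s))"
proof -
  let ?A = "\<lambda>p. {s \<in> space lebesgue_T. grid m s = p}"
  have A: "?A p \<in> sets lebesgue_T" for p
  proof -
    have "grid m \<in> borel_measurable borel" unfolding grid_def by measurable
    then have "grid m \<in> borel_measurable lebesgue_T"
      by (simp add: measurable_cong_sets[OF sets_lebesgue_T refl] measurable_restrict_space1)
    from measurable_sets[OF this, of "{p}"] show ?thesis
      by (simp add: vimage_def Int_def conj_commute)
  qed
  have eq: "h (grid m s) = (\<Sum>p\<in>grid m ` {0..T}. h p * indicator (?A p) s)" if "s \<in> space lebesgue_T" for s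
  proof -
    have "(\<Sum>p\<in>grid m ` {0..T}. h p * indicator (?A p) s) = (\<Sum>p\<in>grid m ` {0..T}. if p = grid m s then h p else 0)"
      using that by (intro sum.cong) (auto simp: indicator_def)
    also have "\<dots> = h (grid m s)" using finite_grid that by (simp add: sum.delta space_lebesgue_T)
    finally show ?thesis by simp
  qed
  have i: "integrable lebesgue_T (\<lambda>s. h p * indicator (?A p) s)" for p
    by (intro integrable_mult_right integrable_real_indicator A) (simp only: less_top[symmetric] lebesgue_T.emeasure_finite infinity_ennreal_def not_False_eq_True)
  have "(\<integral>s. h (grid m s) \<partial>lebesgue_T) = (\<integral>s. (\<Sum>p\<in>grid m ` {0..T}. h p * indicator (?A p) s) \<partial>lebesgue_T)"
    by (rule Bochner_Integration.integral_cong[OF refl eq])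
  also have "\<dots> = (\<Sum>p\<in>grid m ` {0..T}. \<integral>s. h p * indicator (?A p) s \<partial>lebesgue_T)"
    by (rule Bochner_Integration.integral_sum[OF i])
  also have "\<dots> = (\<Sum>p\<in>grid m ` {0..T}. h p * measure lebesgue_T (?A p))"
  proof (rule sum.cong[OF refl])
    fix p
    have "?A p \<inter> space lebesgue_T = ?A p" by auto
    then show "(\<integral>s. h p * indicator (?A p) s \<partial>lebesgue_T) = h p * measure lebesgue_T (?A p)"
      using A[of p] by (simp only: integral_mult_right_zero Bochner_Integration.integral_indicator)
  qed
  finally show "(\<integral>s. h (grid m s) \<partial>lebesgue_T) = (\<Sum>p\<in>grid m ` {0..T}. h p * measure lebesgue_T (?A p))" .
  have "integrable lebesgue_T (\<lambda>s. \<Sum>p\<in>grid m ` {0..T}. h p * indicator (?A p) s)"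
    by (rule Bochner_Integration.integrable_sum[OF i])
  then show "integrable lebesgue_T (\<lambda>s. h (grid m s))"
    by (subst Bochner_Integration.integrable_cong[OF refl eq])
qed

context
  fixes g :: "real \<Rightarrow> real"
  assumes g: "continuous_on {0..T} g"
begin

definition grid_error :: "nat \<Rightarrow> real \<Rightarrow> 'a \<Rightarrow> real" where
  "grid_error m s \<omega> = X s \<omega> * g s - X (grid m s) \<omega> * g (grid m s)"

lemma grid_error_measurable:
  "(\<lambda>p. grid_error m (fst p) (snd p)) \<in> borel_measurable (lebesgue_T \<Otimes>\<^sub>M M)"
proof -
  have "(\<lambda>p. (grid m (fst p), snd p)) \<in> lebesgue_T \<Otimes>\<^sub>M M \<rightarrow>\<^sub>M lebesgue_T \<Otimes>\<^sub>M M"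
    by (intro measurable_Pair measurable_compose[OF measurable_fst grid_measurable] measurable_snd)
  from measurable_compose[OF this X_times_meas[OF g]]
  have "(\<lambda>p. X (grid m (fst p)) (snd p) * g (grid m (fst p))) \<in> borel_measurable (lebesgue_T \<Otimes>\<^sub>M M)"
    by simp
  then show ?thesis
    unfolding grid_error_def by (intro borel_measurable_diff X_times_meas[OF g])
qed

lemma grid_error_square:
  assumes s: "s \<in> {0..T}"
  shows "integrable M (\<lambda>\<omega>. (grid_error m s \<omega>)\<^sup>2)"
    "expectation (\<lambda>\<omega>. (grid_error m s \<omega>)\<^sup>2) =
      K s s * (g s)\<^sup>2 + K (grid m s) (grid m s) * (g (grid m s))\<^sup>2 - 2 * (K s (grid m s) * (g s * g (grid m s)))"
proof -
  let ?r = "grid m s"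
  have r: "?r \<in> {0..T}" by (rule grid_bounds[OF s])
  let ?a = "\<lambda>\<omega>. X s \<omega> * g s" and ?b = "\<lambda>\<omega>. - (X ?r \<omega> * g ?r)"
  have m: "?a \<in> borel_measurable M" "?b \<in> borel_measurable M"
    by (intro borel_measurable_uminus borel_measurable_times X_measurable s r borel_measurable_const)+
  have i: "integrable M (\<lambda>\<omega>. (?a \<omega>)\<^sup>2)" "integrable M (\<lambda>\<omega>. (?b \<omega>)\<^sup>2)"
    using X_times_sq[OF s, of g] X_times_sq[OF r, of g] by simp_all
  have eq: "grid_error m s = (\<lambda>\<omega>. ?a \<omega> + ?b \<omega>)" by (simp add: grid_error_def fun_eq_iff)
  show "integrable M (\<lambda>\<omega>. (grid_error m s \<omega>)\<^sup>2)"
    unfolding eq by (rule integrable_square_add[OF m i])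
  have "expectation (\<lambda>\<omega>. ?a \<omega> * ?b \<omega>) = expectation (\<lambda>\<omega>. X s \<omega> * X ?r \<omega> * - (g s * g ?r))"
    by (simp add: mult_ac)
  also have "\<dots> = K s ?r * - (g s * g ?r)"
    unfolding cov_fun_def by (rule integral_mult_left_zero)
  finally show "expectation (\<lambda>\<omega>. (grid_error m s \<omega>)\<^sup>2) =
      K s s * (g s)\<^sup>2 + K ?r ?r * (g ?r)\<^sup>2 - 2 * (K s ?r * (g s * g ?r))"
    unfolding eq integral_square_add[OF m i]
    by (simp add: power_mult_distrib X_sq)
qed

lemma grid_error_bounded:
  obtains B where "\<And>m s. s \<in> {0..T} \<Longrightarrow> expectation (\<lambda>\<omega>. (grid_error m s \<omega>)\<^sup>2) \<le> B"
proof -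
  obtain C where C: "0 \<le> C" "\<And>s. s \<in> {0..T} \<Longrightarrow> \<bar>g s\<bar> \<le> C" by (rule continuous_bounded[OF g]) blast
  obtain B where B: "0 \<le> B" "\<And>r s. r \<in> {0..T} \<Longrightarrow> s \<in> {0..T} \<Longrightarrow> \<bar>K r s\<bar> \<le> B" by (rule K_bounded) blast
  have Kgg: "\<bar>K r s * (g r' * g s')\<bar> \<le> B * (C * C)"
    if "r \<in> {0..T}" "s \<in> {0..T}" "r' \<in> {0..T}" "s' \<in> {0..T}" for r s r' s'
    unfolding abs_mult using that B C by (intro mult_mono) auto
  have "expectation (\<lambda>\<omega>. (grid_error m s \<omega>)\<^sup>2) \<le> 4 * (B * (C * C))" if s: "s \<in> {0..T}" for m s
  proof -
    note r = grid_bounds(1)[OF s, of m]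
    show ?thesis
      unfolding grid_error_square(2)[OF s]
      using Kgg[OF s s s s] Kgg[OF r r r r] Kgg[OF s r s r] unfolding power2_eq_square by linarith
  qed
  then show ?thesis by (rule that)
qed

text \<open>The mean square error at time \<open>s\<close> is a continuous function of the two times \<open>s\<close> and \<open>grid m s\<close>
  up to the factors \<open>g\<close>, and vanishes on the diagonal; bounded convergence does the rest.\<close>
lemma grid_error_tendsto:
  "(\<lambda>m. \<integral>s. expectation (\<lambda>\<omega>. (grid_error m s \<omega>)\<^sup>2) \<partial>lebesgue_T) \<longlonglongrightarrow> 0"
proof -
  let ?h = "\<lambda>m s. expectation (\<lambda>\<omega>. (grid_error m s \<omega>)\<^sup>2)"
  obtain B where B: "\<And>m s. s \<in> {0..T} \<Longrightarrow> ?h m s \<le> B"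
    by (rule grid_error_bounded) blast
  have "(\<lambda>m. \<integral>s. ?h m s \<partial>lebesgue_T) \<longlonglongrightarrow> (\<integral>s. 0 \<partial>lebesgue_T)"
  proof (rule integral_dominated_convergence[where w="\<lambda>_. B"])
    show "?h m \<in> borel_measurable lebesgue_T" for m
      by (rule borel_measurable_lebesgue_integral)
        (simp add: case_prod_beta' borel_measurable_power[OF grid_error_measurable])
    show "integrable lebesgue_T (\<lambda>_. B)" by (rule lebesgue_T.integrable_const)
    show "AE s in lebesgue_T. (\<lambda>m. ?h m s) \<longlonglongrightarrow> 0"
    proof (rule AE_I2)
      fix s assume "s \<in> space lebesgue_T"
      then have s: "s \<in> {0..T}" by (simp add: space_lebesgue_T)
      note r = grid_bounds(1)[OF s]
      have lim: "(\<lambda>m. g (grid m s)) \<longlonglongrightarrow> g s"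
        by (rule continuous_on_tendsto_compose[OF g grid_tendsto[OF s] s]) (use r in auto)
      have k1: "(\<lambda>m. K (grid m s) (grid m s)) \<longlonglongrightarrow> K s s"
        using continuous_on_tendsto_compose[OF cont tendsto_Pair[OF grid_tendsto[OF s] grid_tendsto[OF s]]] s r
        by (auto simp del: atLeastAtMost_iff)
      have k2: "(\<lambda>m. K s (grid m s)) \<longlonglongrightarrow> K s s"
        using continuous_on_tendsto_compose[OF cont tendsto_Pair[OF tendsto_const[of s] grid_tendsto[OF s]]] s r
        by (auto simp del: atLeastAtMost_iff)
      have "(\<lambda>m. ?h m s) \<longlonglongrightarrow> K s s * (g s)\<^sup>2 + K s s * (g s)\<^sup>2 - 2 * (K s s * (g s * g s))"
        unfolding grid_error_square(2)[OF s] by (intro tendsto_intros lim k1 k2)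
      then show "(\<lambda>m. ?h m s) \<longlonglongrightarrow> 0" by (simp add: power2_eq_square)
    qed
    show "AE s in lebesgue_T. norm (?h m s) \<le> B" for m
      using B by (intro AE_I2) (simp add: space_lebesgue_T)
  qed simp
  then show ?thesis by simp
qed

text \<open>Replacing the time by its rounded value inside the integral yields finite linear combinations of
  values of the process, which are Gaussian; by Cauchy-Schwarz in the time variable, the integrated
  error bound makes them converge in mean square.\<close>
lemma process_integral_centered_gaussian:
  assumes I: "finite I" "\<And>i. i \<in> I \<Longrightarrow> p i \<in> {0..T}"
  shows "centered_gaussian M (\<lambda>\<omega>. (\<Sum>i\<in>I. u i * X (p i) \<omega>) + path_integral g \<omega>)"
proof -
  define L where "L \<omega> = (\<Sum>i\<in>I. u i * X (p i) \<omega>)" for \<omega>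
  define A where "A m \<omega> = (\<integral>s. X (grid m s) \<omega> * g (grid m s) \<partial>lebesgue_T)" for m \<omega>
  have "L = (\<lambda>\<omega>. \<Sum>i\<in>I. u i * X (p i) \<omega>)" by (simp add: L_def fun_eq_iff)
  then have L_gauss: "centered_gaussian M L" using linear_combination_centered_gaussian[OF I] by simp
  note Lm = centered_gaussianD(1)[OF L_gauss]
  have gauss: "centered_gaussian M (\<lambda>\<omega>. L \<omega> + A m \<omega>)" for m
  proof -
    let ?F = "grid m ` {0..T}"
    define c where "c = case_sum u (\<lambda>q. g q * measure lebesgue_T {s \<in> space lebesgue_T. grid m s = q})"
    have "L \<omega> + A m \<omega> = (\<Sum>k\<in>I <+> ?F. c k * X (case_sum p (\<lambda>q. q) k) \<omega>)" for \<omega>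
      unfolding L_def A_def integral_grid(1)[of "\<lambda>q. X q \<omega> * g q"]
      unfolding sum.Plus[OF I(1) finite_grid] c_def sum.case
      by (intro arg_cong2[where f="(+)"] sum.cong refl) (simp_all only: comp_def sum.case mult_ac)
    then have eq: "(\<lambda>\<omega>. L \<omega> + A m \<omega>) = (\<lambda>\<omega>. \<Sum>k\<in>I <+> ?F. c k * X (case_sum p (\<lambda>q. q) k) \<omega>)"
      by (rule ext)
    have "case_sum p (\<lambda>q. q) k \<in> {0..T}" if "k \<in> I <+> ?F" for k
      using that
    proof (rule PlusE)
      fix i assume "i \<in> I" "k = Inl i"
      then show ?thesis using I(2) by (simp only: sum.case)
    next
      fix q assume "q \<in> ?F" "k = Inr q"
      then show ?thesis using grid_bounds(1) by (elim imageE) (simp only: sum.case)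
    qed
    then show ?thesis
      unfolding eq by (intro linear_combination_centered_gaussian finite_Plus I(1) finite_grid)
  qed
  have "centered_gaussian M (\<lambda>\<omega>. L \<omega> + path_integral g \<omega>)"
  proof (rule centered_gaussian_L2_limit[OF gauss])
    show "(\<lambda>\<omega>. L \<omega> + path_integral g \<omega>) \<in> borel_measurable M"
      by (intro borel_measurable_add Lm path_integral_measurable[OF g])
    show "integrable M (\<lambda>\<omega>. (L \<omega> + path_integral g \<omega>)\<^sup>2)"
      by (intro integrable_square_add Lm path_integral_measurable[OF g] path_integral_square_integrable[OF g] centered_gaussianD(3)[OF L_gauss])
    obtain B where B: "\<And>m s. s \<in> {0..T} \<Longrightarrow> expectation (\<lambda>\<omega>. (grid_error m s \<omega>)\<^sup>2) \<le> B"
      by (rule grid_error_bounded) blast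
    have "expectation (\<lambda>\<omega>. (L \<omega> + path_integral g \<omega> - (L \<omega> + A m \<omega>))\<^sup>2) \<le>
        T * (\<integral>s. expectation (\<lambda>\<omega>. (grid_error m s \<omega>)\<^sup>2) \<partial>lebesgue_T)" for m
    proof -
      have Am: "A m \<in> borel_measurable M"
      proof -
        have "(\<lambda>\<omega>. (L \<omega> + A m \<omega>) - L \<omega>) \<in> borel_measurable M"
          by (intro borel_measurable_diff Lm centered_gaussianD(1)[OF gauss])
        then show ?thesis by simp
      qed
      have "path_integral g \<omega> - A m \<omega> = (\<integral>s. grid_error m s \<omega> \<partial>lebesgue_T)" if "integrable lebesgue_T (\<lambda>s. X s \<omega> * g s)" for \<omega>
        unfolding path_integral_def A_def grid_error_def
        by (rule Bochner_Integration.integral_diff[symmetric, OF that integral_grid(2)[of "\<lambda>q. X q \<omega> * g q"]])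
      then have "AE \<omega> in M. integrable lebesgue_T (\<lambda>s. X s \<omega> * g s) \<longrightarrow>
          (L \<omega> + path_integral g \<omega> - (L \<omega> + A m \<omega>))\<^sup>2 = (\<integral>s. grid_error m s \<omega> \<partial>lebesgue_T)\<^sup>2"
        by (intro AE_I2 impI) simp
      then have "AE \<omega> in M. (L \<omega> + path_integral g \<omega> - (L \<omega> + A m \<omega>))\<^sup>2 = (\<integral>s. grid_error m s \<omega> \<partial>lebesgue_T)\<^sup>2"
        by (rule AE_mp[OF path_integral_integrable_paths[OF g]])
      then have "expectation (\<lambda>\<omega>. (L \<omega> + path_integral g \<omega> - (L \<omega> + A m \<omega>))\<^sup>2) =
          expectation (\<lambda>\<omega>. (\<integral>s. grid_error m s \<omega> \<partial>lebesgue_T)\<^sup>2)"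
        by (intro integral_cong_AE borel_measurable_power borel_measurable_diff borel_measurable_add
            Lm path_integral_measurable[OF g] Am L2_integral_measurable[OF grid_error_measurable grid_error_square(1) B])
      also have "\<dots> \<le> T * (\<integral>s. expectation (\<lambda>\<omega>. (grid_error m s \<omega>)\<^sup>2) \<partial>lebesgue_T)"
        by (rule L2_integral_square_le[OF grid_error_measurable grid_error_square(1) B])
      finally show ?thesis .
    qed
    note le = this
    show "(\<lambda>m. expectation (\<lambda>\<omega>. (L \<omega> + path_integral g \<omega> - (L \<omega> + A m \<omega>))\<^sup>2)) \<longlonglongrightarrow> 0"
    proof (rule tendsto_sandwich[OF always_eventually always_eventually tendsto_const])
      show "(\<lambda>m. T * (\<integral>s. expectation (\<lambda>\<omega>. (grid_error m s \<omega>)\<^sup>2) \<partial>lebesgue_T)) \<longlonglongrightarrow> 0"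
        by (rule tendsto_mult_right_zero[OF grid_error_tendsto])
      show "\<forall>m. 0 \<le> expectation (\<lambda>\<omega>. (L \<omega> + path_integral g \<omega> - (L \<omega> + A m \<omega>))\<^sup>2)"
        by (intro allI integral_nonneg_AE AE_I2 zero_le_power2)
    qed (use le in blast)
  qed
  then show ?thesis by (simp only: L_def)
qed

end

end

section \<open>Conditional expectations and regular conditional distributions\<close>

context prob_space begin

lemma sigma_finite_subalgebra_vimage:
  assumes U: "U \<in> M \<rightarrow>\<^sub>M L"
  shows "sigma_finite_subalgebra M (vimage_algebra (space M) U L)"
proof (rule finite_measure_subalgebra_is_sigma_finite)
  have "subalgebra M (vimage_algebra (space M) U L)"
    unfolding subalgebra_def using sets_image_in_sets[OF refl U] by simp
  then show "finite_measure_subalgebra M (vimage_algebra (space M) U L)"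
    by (simp add: finite_measure_subalgebra_def finite_measure_subalgebra_axioms_def finite_measure_axioms)
qed

lemma measurable_vimage_compose:
  assumes "U \<in> M \<rightarrow>\<^sub>M L" "f \<in> L \<rightarrow>\<^sub>M K"
  shows "(\<lambda>\<omega>. f (U \<omega>)) \<in> vimage_algebra (space M) U L \<rightarrow>\<^sub>M K"
  using assms measurable_space[OF assms(1)]
  by (intro measurable_compose[OF measurable_vimage_algebra1]) auto

lemma cond_exp_given_inner:
  assumes U: "U \<in> M \<rightarrow>\<^sub>M L" and f: "f \<in> borel_measurable L" and g: "g \<in> borel_measurable M"
    and i: "integrable M (\<lambda>\<omega>. f (U \<omega>) * g \<omega>)"
    and c: "AE \<omega> in M. cond_exp_given M U L g \<omega> = h (U \<omega>)" and h: "h \<in> borel_measurable L"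
  shows "expectation (\<lambda>\<omega>. f (U \<omega>) * h (U \<omega>)) = expectation (\<lambda>\<omega>. f (U \<omega>) * g \<omega>)"
proof -
  let ?F = "vimage_algebra (space M) U L"
  interpret F: sigma_finite_subalgebra M ?F by (rule sigma_finite_subalgebra_vimage[OF U])
  note fm = measurable_vimage_compose[OF U f]
  have "expectation (\<lambda>\<omega>. f (U \<omega>) * h (U \<omega>)) = expectation (\<lambda>\<omega>. f (U \<omega>) * real_cond_exp M ?F g \<omega>)"
  proof (rule integral_cong_AE)
    show "AE \<omega> in M. f (U \<omega>) * h (U \<omega>) = f (U \<omega>) * real_cond_exp M ?F g \<omega>"
      using c unfolding cond_exp_given_def by eventually_elim simp
    show "(\<lambda>\<omega>. f (U \<omega>) * h (U \<omega>)) \<in> borel_measurable M"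
      by (intro borel_measurable_times measurable_compose[OF U] f h)
    show "(\<lambda>\<omega>. f (U \<omega>) * real_cond_exp M ?F g \<omega>) \<in> borel_measurable M"
      by (intro borel_measurable_times measurable_compose[OF U] f borel_measurable_cond_exp2)
  qed
  also have "\<dots> = expectation (\<lambda>\<omega>. f (U \<omega>) * g \<omega>)"
    by (rule F.real_cond_exp_intg(2)[OF i fm g])
  finally show ?thesis .
qed

text \<open>The sets of the \<open>\<sigma>\<close>-algebra generated by \<open>U\<close> are the events \<open>U \<in> A\<close>, so the defining property of
  conditional expectation can be tested on indicators composed with \<open>U\<close>.\<close>
lemma cond_exp_given_charact:
  assumes U: "U \<in> M \<rightarrow>\<^sub>M L" and g: "integrable M g"
    and h: "h \<in> borel_measurable L" "integrable M (\<lambda>\<omega>. h (U \<omega>))"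
    and eq: "\<And>A. A \<in> sets L \<Longrightarrow>
      expectation (\<lambda>\<omega>. indicator A (U \<omega>) * g \<omega>) = expectation (\<lambda>\<omega>. indicator A (U \<omega>) * h (U \<omega>))"
  shows "AE \<omega> in M. cond_exp_given M U L g \<omega> = h (U \<omega>)"
  unfolding cond_exp_given_def
proof (rule sigma_finite_subalgebra.real_cond_exp_charact[OF sigma_finite_subalgebra_vimage[OF U]])
  fix A' assume "A' \<in> sets (vimage_algebra (space M) U L)"
  then obtain A where A: "A \<in> sets L" "A' = U -` A \<inter> space M"
    using sets_vimage_algebra2[of U "space M" L] measurable_space[OF U] by auto
  have "set_lebesgue_integral M A' f = expectation (\<lambda>\<omega>. indicator A (U \<omega>) * f \<omega>)" for f :: "'a \<Rightarrow> real"
    unfolding set_lebesgue_integral_def A(2)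
    by (rule Bochner_Integration.integral_cong) (auto simp: indicator_def)
  then show "set_lebesgue_integral M A' g = set_lebesgue_integral M A' (\<lambda>\<omega>. h (U \<omega>))"
    using eq[OF A(1)] by simp
qed (use g h measurable_vimage_compose[OF U h(1)] in auto)

text \<open>The law of \<open>(U, W)\<close> is the semidirect product of the law of \<open>U\<close> with \<open>\<kappa>\<close>: the defining property of
  a regular conditional distribution gives equality on measurable rectangles, which are an
  intersection-stable generator.\<close>
lemma regular_cond_distr_integral:
  fixes f :: "'c \<times> 'd \<Rightarrow> real"
  assumes W: "W \<in> M \<rightarrow>\<^sub>M N" and U: "U \<in> M \<rightarrow>\<^sub>M L"
    and reg: "regular_cond_distr M W N U L \<kappa>"
    and f: "f \<in> borel_measurable (L \<Otimes>\<^sub>M N)" and bounded: "\<And>p. \<bar>f p\<bar> \<le> B"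
  shows "expectation (\<lambda>\<omega>. f (U \<omega>, W \<omega>)) = expectation (\<lambda>\<omega>. \<integral>w. f (U \<omega>, w) \<partial>\<kappa> (U \<omega>))"
proof -
  let ?P = "L \<Otimes>\<^sub>M N" and ?\<mu> = "distr M L U"
  have \<kappa>: "\<kappa> \<in> L \<rightarrow>\<^sub>M prob_algebra N" using reg by (simp add: regular_cond_distr_def)
  have \<kappa>_sets: "sets (\<kappa> u) = sets N" and \<kappa>_prob: "prob_space (\<kappa> u)" if "u \<in> space L" for u
    using measurable_space[OF \<kappa> that] by (auto simp: space_prob_algebra)
  define k where "k u = distr (\<kappa> u) ?P (Pair u)" for u
  have k: "k \<in> L \<rightarrow>\<^sub>M subprob_algebra ?P"
    unfolding k_def by (rule measurable_distr2[OF _ measurable_prob_algebraD[OF \<kappa>]]) (simp add: case_prod_beta')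
  have Pair_m: "Pair u \<in> \<kappa> u \<rightarrow>\<^sub>M ?P" if "u \<in> space L" for u
    using measurable_Pair1'[OF that, of N] by (simp only: measurable_cong_sets[OF \<kappa>_sets[OF that] refl])
  have k': "k \<in> ?\<mu> \<rightarrow>\<^sub>M subprob_algebra ?P" using k by (simp only: measurable_distr_eq1)
  interpret \<mu>: prob_space ?\<mu> by (rule prob_space_distr[OF U])
  let ?Q = "?\<mu> \<bind> k"
  have UW: "(\<lambda>\<omega>. (U \<omega>, W \<omega>)) \<in> M \<rightarrow>\<^sub>M ?P" using U W by (rule measurable_Pair)
  have "distr M ?P (\<lambda>\<omega>. (U \<omega>, W \<omega>)) = ?Q"
  proof (rule measure_eqI_generator_eq[OF Int_stable_pair_measure_generator[of L N]])
    show "{a \<times> b |a b. a \<in> sets L \<and> b \<in> sets N} \<subseteq> Pow (space ?P)"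
      using sets.space_closed[of L] sets.space_closed[of N] by (auto simp: space_pair_measure)
    have sQ: "sets ?Q = sets ?P"
      by (rule sets_bind[OF sets_kernel[OF k']]) (simp_all add: \<mu>.not_empty del: space_distr)
    show "sets (distr M ?P (\<lambda>\<omega>. (U \<omega>, W \<omega>))) = sigma_sets (space ?P) {a \<times> b |a b. a \<in> sets L \<and> b \<in> sets N}"
      by (simp add: sets_pair_measure space_pair_measure)
    then show "sets ?Q = sigma_sets (space ?P) {a \<times> b |a b. a \<in> sets L \<and> b \<in> sets N}"
      by (simp add: sQ)
    show "range (\<lambda>_::nat. space L \<times> space N) \<subseteq> {a \<times> b |a b. a \<in> sets L \<and> b \<in> sets N}" by auto
    show "(\<Union>i::nat. space L \<times> space N) = space ?P" by (simp add: space_pair_measure)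
    interpret D: prob_space "distr M ?P (\<lambda>\<omega>. (U \<omega>, W \<omega>))" by (rule prob_space_distr[OF UW])
    show "emeasure (distr M ?P (\<lambda>\<omega>. (U \<omega>, W \<omega>))) (space L \<times> space N) \<noteq> \<infinity>" by simp
    fix X assume "X \<in> {a \<times> b |a b. a \<in> sets L \<and> b \<in> sets N}"
    then obtain A B where X: "X = A \<times> B" and A: "A \<in> sets L" and B: "B \<in> sets N" by auto
    have XP: "X \<in> sets ?P" unfolding X using A B by (rule pair_measureI)
    have mB: "(\<lambda>u. measure (\<kappa> u) B) \<in> borel_measurable L"
      by (rule measurable_compose[OF measurable_prob_algebraD[OF \<kappa>] measurable_measure_subprob_algebra[OF B]])
    have ind: "(\<lambda>u. indicator A u :: real) \<in> borel_measurable L" using A by simp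
    have mm: "(\<lambda>u. indicator A u * measure (\<kappa> u) B) \<in> borel_measurable L"
      by (rule borel_measurable_times[OF ind mB])
    have gm: "(\<lambda>\<omega>. indicator B (W \<omega>) :: real) \<in> borel_measurable M"
      by (rule measurable_compose[OF W borel_measurable_indicator[OF B]])
    have i1: "integrable M (\<lambda>\<omega>. indicator A (U \<omega>) * (indicator B (W \<omega>) :: real))"
    proof (rule integrable_const_bound[of _ 1])
      show "(\<lambda>\<omega>. indicator A (U \<omega>) * (indicator B (W \<omega>) :: real)) \<in> borel_measurable M"
        by (rule borel_measurable_times[OF measurable_compose[OF U ind] gm])
    qed (auto simp: indicator_def)
    have eq: "expectation (\<lambda>\<omega>. indicator A (U \<omega>) * measure (\<kappa> (U \<omega>)) B) =
        expectation (\<lambda>\<omega>. indicator A (U \<omega>) * indicator B (W \<omega>))"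
      using reg B unfolding regular_cond_distr_def by (intro cond_exp_given_inner[OF U ind gm i1 _ mB]) blast
    have le1: "measure (\<kappa> u) B \<le> 1" if "u \<in> space L" for u
      using prob_space.prob_le_1[OF \<kappa>_prob[OF that]] .
    have emk: "emeasure (k u) X = ennreal (indicator A u * measure (\<kappa> u) B)" if u: "u \<in> space L" for u
    proof -
      interpret \<kappa>u: prob_space "\<kappa> u" by (rule \<kappa>_prob[OF u])
      have "Pair u -` X \<inter> space (\<kappa> u) = (if u \<in> A then B else {})"
        using sets.sets_into_space[OF B] sets_eq_imp_space_eq[OF \<kappa>_sets[OF u]] by (auto simp: X)
      then have "emeasure (k u) X = emeasure (\<kappa> u) (if u \<in> A then B else {})"
        unfolding k_def using emeasure_distr[OF Pair_m[OF u] XP] by simp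
      then show ?thesis by (simp add: indicator_def \<kappa>u.emeasure_eq_measure)
    qed
    have i2: "integrable ?\<mu> (\<lambda>u. indicator A u * measure (\<kappa> u) B)"
      by (rule \<mu>.integrable_const_bound[of _ 1])
        (use mm le1 in \<open>auto simp: indicator_def intro!: AE_I2 simp: measurable_distr_eq1\<close>)
    have "emeasure ?Q X = (\<integral>\<^sup>+u. emeasure (k u) X \<partial>?\<mu>)"
      by (rule emeasure_bind[OF \<mu>.not_empty k' XP])
    also have "\<dots> = (\<integral>\<^sup>+u. ennreal (indicator A u * measure (\<kappa> u) B) \<partial>?\<mu>)"
      by (rule nn_integral_cong) (simp add: emk)
    also have "\<dots> = ennreal (\<integral>u. indicator A u * measure (\<kappa> u) B \<partial>?\<mu>)"
      by (rule nn_integral_eq_integral[OF i2]) (auto intro!: AE_I2)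
    also have "(\<integral>u. indicator A u * measure (\<kappa> u) B \<partial>?\<mu>) =
        expectation (\<lambda>\<omega>. indicator A (U \<omega>) * indicator B (W \<omega>))"
      unfolding eq[symmetric] by (rule integral_distr[OF U mm])
    also have "\<dots> = expectation (indicator ((\<lambda>\<omega>. (U \<omega>, W \<omega>)) -` X \<inter> space M))"
      by (rule Bochner_Integration.integral_cong) (auto simp: X indicator_def)
    also have "\<dots> = measure M ((\<lambda>\<omega>. (U \<omega>, W \<omega>)) -` X \<inter> space M)" by simp
    also have "ennreal \<dots> = emeasure (distr M ?P (\<lambda>\<omega>. (U \<omega>, W \<omega>))) X"
      by (simp add: emeasure_distr[OF UW XP] emeasure_eq_measure)
    finally show "emeasure (distr M ?P (\<lambda>\<omega>. (U \<omega>, W \<omega>))) X = emeasure ?Q X" by (rule sym)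
  qed
  then have "expectation (\<lambda>\<omega>. f (U \<omega>, W \<omega>)) = (\<integral>p. f p \<partial>?Q)"
    using integral_distr[OF UW f] by simp
  also have "\<dots> = (\<integral>u. (\<integral>p. f p \<partial>k u) \<partial>?\<mu>)"
  proof (rule integral_bind[OF f bounded k'])
    show "AE u in ?\<mu>. emeasure (k u) (space (k u)) \<le> ennreal 1"
      using subprob_space.emeasure_space_le_1[OF subprob_space_kernel[OF k']] by (intro AE_I2) simp
  qed (rule \<mu>.finite_measure_axioms)
  also have "\<dots> = (\<integral>u. (\<integral>w. f (u, w) \<partial>\<kappa> u) \<partial>?\<mu>)"
    by (rule Bochner_Integration.integral_cong) (simp_all add: k_def integral_distr[OF Pair_m f])
  also have "\<dots> = expectation (\<lambda>\<omega>. \<integral>w. f (U \<omega>, w) \<partial>\<kappa> (U \<omega>))"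
  proof (rule integral_distr[OF U])
    have "(\<lambda>u. \<integral>p. f p \<partial>k u) \<in> borel_measurable L"
      by (rule measurable_compose[OF k integral_measurable_subprob_algebra[OF f]])
    then show "(\<lambda>u. \<integral>w. f (u, w) \<partial>\<kappa> u) \<in> borel_measurable L"
      by (rule measurable_cong[THEN iffD1, rotated]) (simp add: k_def integral_distr[OF Pair_m f])
  qed
  finally show ?thesis .
qed

end

text \<open>The inner integral is supplied in closed form, as a function \<open>c\<close> whose measurability is known; for
  Gaussian kernels it is an explicit exponential.\<close>
lemma (in prob_space) regular_cond_distr_integral_complex:
  fixes f :: "'c \<times> 'd \<Rightarrow> complex" and c :: "'c \<Rightarrow> complex"
  assumes W: "W \<in> M \<rightarrow>\<^sub>M N" and U: "U \<in> M \<rightarrow>\<^sub>M L"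
    and reg: "regular_cond_distr M W N U L \<kappa>"
    and f: "f \<in> borel_measurable (L \<Otimes>\<^sub>M N)" and bounded: "\<And>p. cmod (f p) \<le> B"
    and c: "c \<in> borel_measurable L" "\<And>u. cmod (c u) \<le> B"
    and inner: "\<And>u. u \<in> space L \<Longrightarrow> (CLINT w|\<kappa> u. f (u, w)) = c u"
  shows "(CLINT \<omega>|M. f (U \<omega>, W \<omega>)) = (CLINT \<omega>|M. c (U \<omega>))"
proof -
  have UW: "(\<lambda>\<omega>. (U \<omega>, W \<omega>)) \<in> M \<rightarrow>\<^sub>M L \<Otimes>\<^sub>M N" using U W by (rule measurable_Pair)
  have i: "integrable M (\<lambda>\<omega>. f (U \<omega>, W \<omega>))"
    by (rule integrable_const_bound[of _ B]) (use bounded measurable_compose[OF UW f] in auto)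
  have ic: "integrable M (\<lambda>\<omega>. c (U \<omega>))"
    by (rule integrable_const_bound[of _ B]) (use c(2) measurable_compose[OF U c(1)] in auto)
  have i\<kappa>: "integrable (\<kappa> u) (\<lambda>w. f (u, w))" if u: "u \<in> space L" for u
  proof -
    have \<kappa>: "prob_space (\<kappa> u)" "sets (\<kappa> u) = sets N"
      using measurable_space[of \<kappa> L "prob_algebra N" u] reg u
      by (auto simp: regular_cond_distr_def space_prob_algebra)
    interpret \<kappa>: prob_space "\<kappa> u" by (rule \<kappa>)
    have "(\<lambda>w. f (u, w)) \<in> borel_measurable N" by (rule measurable_compose[OF measurable_Pair1'[OF u] f])
    then have "(\<lambda>w. f (u, w)) \<in> borel_measurable (\<kappa> u)" by (simp only: measurable_cong_sets[OF \<kappa>(2) refl])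
    then show ?thesis by (intro \<kappa>.integrable_const_bound[of _ B]) (use bounded in auto)
  qed
  note US = measurable_space[OF U]
  have b: "\<bar>Re (f p)\<bar> \<le> B" "\<bar>Im (f p)\<bar> \<le> B" for p
    using bounded[of p] abs_Re_le_cmod[of "f p"] abs_Im_le_cmod[of "f p"] by linarith+
  have "Re (CLINT \<omega>|M. f (U \<omega>, W \<omega>)) = expectation (\<lambda>\<omega>. Re (f (U \<omega>, W \<omega>)))"
    by (rule integral_Re[OF i, symmetric])
  also have "\<dots> = expectation (\<lambda>\<omega>. \<integral>w. Re (f (U \<omega>, w)) \<partial>\<kappa> (U \<omega>))"
    by (rule regular_cond_distr_integral[OF W U reg, of "\<lambda>p. Re (f p)" B]) (use f b in auto)
  also have "\<dots> = expectation (\<lambda>\<omega>. Re (c (U \<omega>)))"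
    by (rule Bochner_Integration.integral_cong) (simp_all only: integral_Re[OF i\<kappa>] inner US)
  also have "\<dots> = Re (CLINT \<omega>|M. c (U \<omega>))" by (rule integral_Re[OF ic])
  finally have re: "Re (CLINT \<omega>|M. f (U \<omega>, W \<omega>)) = Re (CLINT \<omega>|M. c (U \<omega>))" .
  have "Im (CLINT \<omega>|M. f (U \<omega>, W \<omega>)) = expectation (\<lambda>\<omega>. Im (f (U \<omega>, W \<omega>)))"
    by (rule integral_Im[OF i, symmetric])
  also have "\<dots> = expectation (\<lambda>\<omega>. \<integral>w. Im (f (U \<omega>, w)) \<partial>\<kappa> (U \<omega>))"
    by (rule regular_cond_distr_integral[OF W U reg, of "\<lambda>p. Im (f p)" B]) (use f b in auto)
  also have "\<dots> = expectation (\<lambda>\<omega>. Im (c (U \<omega>)))"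
    by (rule Bochner_Integration.integral_cong) (simp_all only: integral_Im[OF i\<kappa>] inner US)
  also have "\<dots> = Im (CLINT \<omega>|M. c (U \<omega>))" by (rule integral_Im[OF ic])
  finally have im: "Im (CLINT \<omega>|M. f (U \<omega>, W \<omega>)) = Im (CLINT \<omega>|M. c (U \<omega>))" .
  show ?thesis by (rule complex_eqI[OF re im])
qed

section \<open>Conditioning in a jointly Gaussian pair\<close>

lemma integral_quadratic_form:
  assumes fin: "finite I" and m: "\<And>i. i \<in> I \<Longrightarrow> (\<lambda>\<omega>. W \<omega> i) \<in> borel_measurable M"
    and sq: "\<And>i. i \<in> I \<Longrightarrow> integrable M (\<lambda>\<omega>. (W \<omega> i :: real)\<^sup>2)"
  shows "(\<Sum>i\<in>I. \<Sum>k\<in>I. u i * (\<integral>\<omega>. W \<omega> i * W \<omega> k \<partial>M) * u k) = (\<integral>\<omega>. (\<Sum>i\<in>I. u i * W \<omega> i)\<^sup>2 \<partial>M)"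
proof -
  have i: "integrable M (\<lambda>\<omega>. W \<omega> i * W \<omega> k)" if "i \<in> I" "k \<in> I" for i k
    using that m sq by (intro integrable_mult_of_square)
  have "(\<integral>\<omega>. (\<Sum>i\<in>I. u i * W \<omega> i)\<^sup>2 \<partial>M) = (\<integral>\<omega>. (\<Sum>i\<in>I. \<Sum>k\<in>I. (u i * u k) * (W \<omega> i * W \<omega> k)) \<partial>M)"
    by (simp add: power2_eq_square sum_product mult_ac)
  also have "\<dots> = (\<Sum>i\<in>I. \<Sum>k\<in>I. (u i * u k) * (\<integral>\<omega>. W \<omega> i * W \<omega> k \<partial>M))"
    by (simp add: Bochner_Integration.integral_sum i)
  finally show ?thesis by (simp add: mult_ac)
qed

locale gaussian_pair = prob_space M
  for M :: "'a measure" and I :: "'i set" and J :: "'j set"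
    and V :: "'a \<Rightarrow> 'i \<Rightarrow> real" and Y :: "'a \<Rightarrow> 'j \<Rightarrow> real" +
  assumes finite_I: "finite I" and finite_J: "finite J"
    and V_meas: "V \<in> M \<rightarrow>\<^sub>M borel_vec I" and Y_meas: "Y \<in> M \<rightarrow>\<^sub>M borel_vec J"
    and gauss: "\<And>u w. centered_gaussian M (\<lambda>\<omega>. (\<Sum>i\<in>I. u i * V \<omega> i) + (\<Sum>j\<in>J. w j * Y \<omega> j))"
begin

lemma V_component: "i \<in> I \<Longrightarrow> centered_gaussian M (\<lambda>\<omega>. V \<omega> i)"
  using gauss[of "\<lambda>k. if k = i then 1 else 0" "\<lambda>_. 0"] finite_I by (simp add: if_distrib[of "\<lambda>x. x * _"] cong: if_cong)

lemma Y_component: "j \<in> J \<Longrightarrow> centered_gaussian M (\<lambda>\<omega>. Y \<omega> j)"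
  using gauss[of "\<lambda>_. 0" "\<lambda>k. if k = j then 1 else 0"] finite_J by (simp add: if_distrib[of "\<lambda>x. x * _"] cong: if_cong)

lemma V_lin: "centered_gaussian M (\<lambda>\<omega>. \<Sum>i\<in>I. u i * V \<omega> i)"
  using gauss[of u "\<lambda>_. 0"] by simp

lemma Y_lin: "centered_gaussian M (\<lambda>\<omega>. \<Sum>j\<in>J. w j * Y \<omega> j)"
  using gauss[of "\<lambda>_. 0" w] by simp

end

text \<open>The situation in which the regression matrix can be read off: \<open>cov(Y)\<close> is diagonal and invertible,
  and \<open>R\<close> is \<open>cov(V, Y) cov(Y)\<^sup>-\<^sup>1\<close>.\<close>
locale gaussian_regression = gaussian_pair M I J V Y
  for M :: "'a measure" and I :: "'i set" and J :: "'j set"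
    and V :: "'a \<Rightarrow> 'i \<Rightarrow> real" and Y :: "'a \<Rightarrow> 'j \<Rightarrow> real" +
  fixes R :: "'i \<Rightarrow> 'j \<Rightarrow> real" and var :: "'j \<Rightarrow> real"
  assumes var_pos: "\<And>j. j \<in> J \<Longrightarrow> 0 < var j"
    and cov_Y: "\<And>j k. j \<in> J \<Longrightarrow> k \<in> J \<Longrightarrow> expectation (\<lambda>\<omega>. Y \<omega> j * Y \<omega> k) = (if j = k then var j else 0)"
    and cov_VY: "\<And>i j. i \<in> I \<Longrightarrow> j \<in> J \<Longrightarrow> expectation (\<lambda>\<omega>. V \<omega> i * Y \<omega> j) = var j * R i j"
begin

definition residual :: "'a \<Rightarrow> 'i \<Rightarrow> real" where
  "residual \<omega> = (\<lambda>i\<in>I. V \<omega> i - mat_vec J R (Y \<omega>) i)"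

lemma mat_vec_measurable: "(\<lambda>y. mat_vec J R y i) \<in> borel_measurable (borel_vec J)"
  unfolding mat_vec_def by measurable

lemma residual_measurable: "residual \<in> M \<rightarrow>\<^sub>M borel_vec I"
  unfolding residual_def
proof (rule measurable_restrict)
  fix i assume "i \<in> I"
  then show "(\<lambda>\<omega>. V \<omega> i - mat_vec J R (Y \<omega>) i) \<in> borel_measurable M"
    by (intro borel_measurable_diff measurable_compose[OF V_meas measurable_component_singleton]
        measurable_compose[OF Y_meas mat_vec_measurable])
qed

lemma linear_residual:
  "(\<Sum>i\<in>I. a i * residual \<omega> i) + (\<Sum>j\<in>J. w j * Y \<omega> j) =
   (\<Sum>i\<in>I. a i * V \<omega> i) + (\<Sum>j\<in>J. (w j - (\<Sum>i\<in>I. a i * R i j)) * Y \<omega> j)"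
proof -
  have "(\<Sum>i\<in>I. a i * mat_vec J R (Y \<omega>) i) = (\<Sum>j\<in>J. (\<Sum>i\<in>I. a i * R i j) * Y \<omega> j)"
    unfolding mat_vec_def sum_distrib_left sum_distrib_right mult.assoc[symmetric] by (rule sum.swap)
  then show ?thesis
    by (simp add: residual_def right_diff_distrib left_diff_distrib sum_subtractf)
qed

sublocale residual: gaussian_pair M I J residual Y
  by unfold_locales (use residual_measurable Y_meas finite_I finite_J gauss in \<open>simp_all only: linear_residual\<close>)

lemma residual_uncorrelated:
  assumes i: "i \<in> I" and j: "j \<in> J"
  shows "expectation (\<lambda>\<omega>. residual \<omega> i * Y \<omega> j) = 0"
proof -
  note vs = centered_gaussianD[OF V_component[OF i]] and ys = centered_gaussianD[OF Y_component]
  have iv: "integrable M (\<lambda>\<omega>. V \<omega> i * Y \<omega> j)"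
    by (rule integrable_mult_of_square[OF vs(1) ys(1) vs(3) ys(3)]) (rule j)+
  have iy: "integrable M (\<lambda>\<omega>. Y \<omega> k * Y \<omega> j)" if "k \<in> J" for k
    by (rule integrable_mult_of_square[OF ys(1) ys(1) ys(3) ys(3)]) (rule j that)+
  have "expectation (\<lambda>\<omega>. residual \<omega> i * Y \<omega> j) =
      expectation (\<lambda>\<omega>. V \<omega> i * Y \<omega> j - (\<Sum>k\<in>J. R i k * (Y \<omega> k * Y \<omega> j)))"
    using i by (simp add: residual_def mat_vec_def left_diff_distrib sum_distrib_right mult.assoc)
  also have "\<dots> = var j * R i j - (\<Sum>k\<in>J. R i k * (if k = j then var k else 0))"
    using iv iy i j by (simp add: Bochner_Integration.integral_sum cov_VY cov_Y)
  also have "\<dots> = 0" using j finite_J by (simp add: if_distrib[of "\<lambda>x. _ * x"] cong: if_cong)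
  finally show ?thesis .
qed

lemma linear_uncorrelated:
  "expectation (\<lambda>\<omega>. (\<Sum>i\<in>I. a i * residual \<omega> i) * (\<Sum>j\<in>J. w j * Y \<omega> j)) = 0"
proof -
  have iu: "integrable M (\<lambda>\<omega>. residual \<omega> i * Y \<omega> j)" if "i \<in> I" "j \<in> J" for i j
    using centered_gaussianD[OF residual.V_component[OF that(1)]] centered_gaussianD[OF Y_component[OF that(2)]]
    by (intro integrable_mult_of_square)
  have "expectation (\<lambda>\<omega>. (\<Sum>i\<in>I. a i * residual \<omega> i) * (\<Sum>j\<in>J. w j * Y \<omega> j)) =
      expectation (\<lambda>\<omega>. \<Sum>i\<in>I. \<Sum>j\<in>J. (a i * w j) * (residual \<omega> i * Y \<omega> j))"
    by (simp only: sum_product mult.assoc mult.left_commute)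
  also have "\<dots> = 0"
    by (simp add: Bochner_Integration.integral_sum iu residual_uncorrelated)
  finally show ?thesis .
qed

text \<open>For jointly Gaussian vectors, vanishing covariance makes the joint characteristic function
  factorise, which is independence. It is stated as equality of laws because the two vectors have
  different types.\<close>
lemma residual_independent:
  "distr M (borel_vec I) residual \<Otimes>\<^sub>M distr M (borel_vec J) Y =
   distr M (borel_vec I \<Otimes>\<^sub>M borel_vec J) (\<lambda>\<omega>. (residual \<omega>, Y \<omega>))"
proof -
  let ?\<mu> = "distr M (borel_vec I) residual" and ?\<nu> = "distr M (borel_vec J) Y"
    and ?PP = "borel_vec I \<Otimes>\<^sub>M borel_vec J"
  interpret \<mu>: prob_space ?\<mu> by (rule prob_space_distr[OF residual_measurable])
  interpret \<nu>: prob_space ?\<nu> by (rule prob_space_distr[OF Y_meas])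
  interpret \<mu>\<nu>: pair_prob_space ?\<mu> ?\<nu> ..
  have pm: "(\<lambda>\<omega>. (residual \<omega>, Y \<omega>)) \<in> M \<rightarrow>\<^sub>M ?PP" using residual_measurable Y_meas by (rule measurable_Pair)
  interpret j: prob_space "distr M ?PP (\<lambda>\<omega>. (residual \<omega>, Y \<omega>))" by (rule prob_space_distr[OF pm])
  show ?thesis
  proof (rule char_unique_pair_PiM[OF finite_I finite_J])
    fix u :: "'i \<Rightarrow> real" and w :: "'j \<Rightarrow> real"
    have mu: "(\<lambda>x. iexp (\<Sum>i\<in>I. u i * x i)) \<in> borel_measurable (borel_vec I)" by measurable
    have mw: "(\<lambda>y. iexp (\<Sum>j\<in>J. w j * y j)) \<in> borel_measurable (borel_vec J)" by measurable
    have split: "(\<lambda>(x, y). iexp ((\<Sum>i\<in>I. u i * x i) + (\<Sum>j\<in>J. w j * y j))) =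
        (\<lambda>p. iexp (\<Sum>i\<in>I. u i * fst p i) * iexp (\<Sum>j\<in>J. w j * snd p j))"
      by (rule ext) (simp only: case_prod_beta' of_real_add distrib_left exp_add)
    have mm: "(\<lambda>p. iexp (\<Sum>i\<in>I. u i * fst p i) * iexp (\<Sum>j\<in>J. w j * snd p j)) \<in> borel_measurable ?PP"
      by (intro borel_measurable_times measurable_compose[OF measurable_fst mu] measurable_compose[OF measurable_snd mw])
    let ?U = "\<lambda>\<omega>. \<Sum>i\<in>I. u i * residual \<omega> i" and ?W = "\<lambda>\<omega>. \<Sum>j\<in>J. w j * Y \<omega> j"
    note gU = centered_gaussianD[OF residual.V_lin[of u]] and gW = centered_gaussianD[OF Y_lin[of w]]
    have "(CLINT p|?\<mu> \<Otimes>\<^sub>M ?\<nu>. iexp (\<Sum>i\<in>I. u i * fst p i) * iexp (\<Sum>j\<in>J. w j * snd p j)) =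
        (CLINT x|?\<mu>. CLINT y|?\<nu>. iexp (\<Sum>i\<in>I. u i * x i) * iexp (\<Sum>j\<in>J. w j * y j))"
    proof (subst \<mu>\<nu>.integral_fst'[symmetric])
      show "integrable (?\<mu> \<Otimes>\<^sub>M ?\<nu>) (\<lambda>p. iexp (\<Sum>i\<in>I. u i * fst p i) * iexp (\<Sum>j\<in>J. w j * snd p j))"
        by (rule \<mu>\<nu>.P.integrable_const_bound[of _ 1]) (use mm in \<open>auto simp: norm_mult\<close>)
    qed simp
    also have "\<dots> = (CLINT \<omega>|M. iexp (?U \<omega>)) * (CLINT \<omega>|M. iexp (?W \<omega>))"
      by (simp only: integral_mult_right_zero integral_mult_left_zero integral_distr[OF Y_meas mw] integral_distr[OF residual_measurable mu])
    also have "\<dots> = of_real (exp (- expectation (\<lambda>\<omega>. (?U \<omega> + ?W \<omega>)\<^sup>2) / 2))"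
      unfolding gU(6) gW(6) integral_square_add[OF gU(1) gW(1) gU(3) gW(3)] linear_uncorrelated
      by (simp add: diff_divide_distrib flip: of_real_mult exp_add)
    also have "\<dots> = (CLINT \<omega>|M. iexp (?U \<omega> + ?W \<omega>))"
      by (rule centered_gaussianD(6)[OF residual.gauss, symmetric])
    also have "\<dots> = (CLINT \<omega>|M. iexp (?U \<omega>) * iexp (?W \<omega>))"
      by (simp only: of_real_add distrib_left exp_add)
    also have "\<dots> = (CLINT p|distr M ?PP (\<lambda>\<omega>. (residual \<omega>, Y \<omega>)). iexp (\<Sum>i\<in>I. u i * fst p i) * iexp (\<Sum>j\<in>J. w j * snd p j))"
      by (simp only: integral_distr[OF pm mm] fst_conv snd_conv)
    finally show "(CLINT (x, y)|?\<mu> \<Otimes>\<^sub>M ?\<nu>. iexp ((\<Sum>i\<in>I. u i * x i) + (\<Sum>j\<in>J. w j * y j))) =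
      (CLINT (x, y)|distr M ?PP (\<lambda>\<omega>. (residual \<omega>, Y \<omega>)). iexp ((\<Sum>i\<in>I. u i * x i) + (\<Sum>j\<in>J. w j * y j)))"
      unfolding split .
  next
    show "finite_measure (?\<mu> \<Otimes>\<^sub>M ?\<nu>)" by (rule \<mu>\<nu>.P.finite_measure_axioms)
    show "finite_measure (distr M ?PP (\<lambda>\<omega>. (residual \<omega>, Y \<omega>)))" by (rule j.finite_measure_axioms)
    show "sets (?\<mu> \<Otimes>\<^sub>M ?\<nu>) = sets ?PP" by (rule sets_pair_measure_cong) simp_all
    show "sets (distr M ?PP (\<lambda>\<omega>. (residual \<omega>, Y \<omega>))) = sets ?PP" by simp
  qed
qed

lemma residual_independent_product:
  assumes f: "f \<in> borel_measurable (borel_vec I)" "integrable M (\<lambda>\<omega>. f (residual \<omega>))"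
    and h: "h \<in> borel_measurable (borel_vec J)" "integrable M (\<lambda>\<omega>. h (Y \<omega>))"
  shows "expectation (\<lambda>\<omega>. f (residual \<omega>) * h (Y \<omega>) :: real) =
    expectation (\<lambda>\<omega>. f (residual \<omega>)) * expectation (\<lambda>\<omega>. h (Y \<omega>))"
proof -
  let ?PI = "borel_vec I" and ?PJ = "borel_vec J"
  have fm: "(\<lambda>\<omega>. f (residual \<omega>)) \<in> borel_measurable M" "(\<lambda>\<omega>. h (Y \<omega>)) \<in> borel_measurable M"
    using measurable_compose[OF residual_measurable f(1)] measurable_compose[OF Y_meas h(1)] .
  have pm: "(\<lambda>\<omega>. (residual \<omega>, Y \<omega>)) \<in> M \<rightarrow>\<^sub>M ?PI \<Otimes>\<^sub>M ?PJ"
    using residual_measurable Y_meas by (rule measurable_Pair)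
  have fh: "(\<lambda>(x, y). (f x, h y)) \<in> ?PI \<Otimes>\<^sub>M ?PJ \<rightarrow>\<^sub>M borel \<Otimes>\<^sub>M borel"
    unfolding case_prod_beta'
    by (intro measurable_Pair measurable_compose[OF measurable_fst f(1)] measurable_compose[OF measurable_snd h(1)])
  interpret h: prob_space "distr M borel (\<lambda>\<omega>. h (Y \<omega>))" by (rule prob_space_distr[OF fm(2)])
  have h': "distr M borel (\<lambda>\<omega>. h (Y \<omega>)) = distr (distr M ?PJ Y) borel h"
    using distr_distr[OF h(1) Y_meas] by (simp add: comp_def)
  have "distr M borel (\<lambda>\<omega>. f (residual \<omega>)) \<Otimes>\<^sub>M distr M borel (\<lambda>\<omega>. h (Y \<omega>)) =
      distr (distr M ?PI residual) borel f \<Otimes>\<^sub>M distr (distr M ?PJ Y) borel h"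
    using distr_distr[OF f(1) residual_measurable] distr_distr[OF h(1) Y_meas] by (simp add: comp_def)
  also have "\<dots> = distr (distr M ?PI residual \<Otimes>\<^sub>M distr M ?PJ Y) (borel \<Otimes>\<^sub>M borel) (\<lambda>(x, y). (f x, h y))"
  proof (rule pair_measure_distr)
    show "sigma_finite_measure (distr (distr M ?PJ Y) borel h)"
      unfolding h'[symmetric] by (rule h.sigma_finite_measure_axioms)
  qed (use f h in \<open>simp_all add: measurable_distr_eq1\<close>)
  also have "\<dots> = distr M (borel \<Otimes>\<^sub>M borel) (\<lambda>\<omega>. (f (residual \<omega>), h (Y \<omega>)))"
    unfolding residual_independent using distr_distr[OF fh pm] by (simp add: comp_def)
  finally have "indep_var borel (\<lambda>\<omega>. f (residual \<omega>)) borel (\<lambda>\<omega>. h (Y \<omega>))"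
    unfolding indep_var_distribution_eq using fm by simp
  from indep_var_lebesgue_integral[OF this f(2) h(2)] show ?thesis .
qed

lemma V_eq: "\<omega> \<in> space M \<Longrightarrow> V \<omega> = (\<lambda>i\<in>I. mat_vec J R (Y \<omega>) i + residual \<omega> i)"
  using measurable_space[OF V_meas, of \<omega>]
  by (auto simp: residual_def space_PiM PiE_iff extensional_def restrict_def fun_eq_iff)

lemma cond_exp_V:
  assumes i: "i \<in> I"
  shows "AE \<omega> in M. cond_exp_given M Y (borel_vec J) (\<lambda>\<omega>'. V \<omega>' i) \<omega> = mat_vec J R (Y \<omega>) i"
proof (rule cond_exp_given_charact[OF Y_meas _ mat_vec_measurable])
  note gV = centered_gaussianD[OF V_component[OF i]] and gU = centered_gaussianD[OF residual.V_component[OF i]]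
  show iV: "integrable M (\<lambda>\<omega>. V \<omega> i)" by (rule gV(2))
  show iR: "integrable M (\<lambda>\<omega>. mat_vec J R (Y \<omega>) i)"
    unfolding mat_vec_def using centered_gaussianD(2)[OF Y_lin[of "R i"]] .
  fix A assume A: "A \<in> sets (borel_vec J)"
  have Am: "(indicator A :: _ \<Rightarrow> real) \<in> borel_measurable (borel_vec J)" using A by (rule borel_measurable_indicator)
  note AYm = measurable_compose[OF Y_meas Am]
  have iA: "integrable M (\<lambda>\<omega>. indicator A (Y \<omega>) :: real)"
    by (rule integrable_const_bound[of _ 1]) (use AYm in \<open>auto simp: indicator_def\<close>)
  have iAf: "integrable M (\<lambda>\<omega>. indicator A (Y \<omega>) * f \<omega>)" if "integrable M f" for f :: "'a \<Rightarrow> real"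
  proof (rule Bochner_Integration.integrable_bound[OF that])
    show "(\<lambda>\<omega>. indicator A (Y \<omega>) * f \<omega>) \<in> borel_measurable M"
      by (rule borel_measurable_times[OF AYm borel_measurable_integrable[OF that]])
  qed (auto simp: indicator_def)
  have "expectation (\<lambda>\<omega>. indicator A (Y \<omega>) * V \<omega> i) - expectation (\<lambda>\<omega>. indicator A (Y \<omega>) * mat_vec J R (Y \<omega>) i) =
      expectation (\<lambda>\<omega>. residual \<omega> i * indicator A (Y \<omega>))"
    using i by (subst Bochner_Integration.integral_diff[symmetric, OF iAf[OF iV] iAf[OF iR]])
      (simp add: residual_def algebra_simps)
  also have "\<dots> = expectation (\<lambda>\<omega>. residual \<omega> i) * expectation (\<lambda>\<omega>. indicator A (Y \<omega>))"
    by (rule residual_independent_product[of "\<lambda>x. x i", OF measurable_component_singleton[OF i] gU(2) Am iA])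
  also have "\<dots> = 0" by (simp add: gU(4))
  finally show "expectation (\<lambda>\<omega>. indicator A (Y \<omega>) * V \<omega> i) =
      expectation (\<lambda>\<omega>. indicator A (Y \<omega>) * mat_vec J R (Y \<omega>) i)" by simp
qed

text \<open>Two affine regression functions agree almost surely along \<open>Y\<close>. Taking the expectation of the
  difference, and of its product with each \<open>Y k\<close>, kills all coefficients, because the variances of
  the uncorrelated coordinates are positive. So the functions agree everywhere on \<open>vecs J\<close>.\<close>
lemma affine_regression_unique:
  assumes a: "affine_regression M I V J Y a" and i: "i \<in> I" and y: "y \<in> vecs J"
  shows "a y i = mat_vec J R y i"
proof -
  from a obtain A b where A: "\<And>y i. y \<in> vecs J \<Longrightarrow> i \<in> I \<Longrightarrow> a y i = mat_vec J A y i + b i"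
    and c: "AE \<omega> in M. cond_exp_given M Y (borel_vec J) (\<lambda>\<omega>'. V \<omega>' i) \<omega> = a (Y \<omega>) i"
    unfolding affine_regression_def using i by blast
  define L where "L \<omega> = (\<Sum>j\<in>J. (A i j - R i j) * Y \<omega> j)" for \<omega>
  have L: "AE \<omega> in M. L \<omega> + b i = 0"
    using cond_exp_V[OF i] c AE_space
  proof eventually_elim
    fix \<omega> assume 1: "cond_exp_given M Y (borel_vec J) (\<lambda>\<omega>'. V \<omega>' i) \<omega> = mat_vec J R (Y \<omega>) i"
      "cond_exp_given M Y (borel_vec J) (\<lambda>\<omega>'. V \<omega>' i) \<omega> = a (Y \<omega>) i" "\<omega> \<in> space M"
    have "Y \<omega> \<in> vecs J" using measurable_space[OF Y_meas 1(3)] by (simp add: space_PiM)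
    with 1 A[OF this i] show "L \<omega> + b i = 0"
      by (simp add: L_def mat_vec_def left_diff_distrib sum_subtractf)
  qed
  have gL: "centered_gaussian M L" unfolding L_def by (rule Y_lin)
  note gL = centered_gaussianD[OF gL]
  have Lb: "(\<lambda>\<omega>. L \<omega> + b i) \<in> borel_measurable M" using gL(1) by simp
  have "expectation (\<lambda>\<omega>. L \<omega> + b i) = expectation (\<lambda>_. 0)"
    by (rule integral_cong_AE[OF Lb _ L]) simp
  then have b: "b i = 0" using gL(2,4) by (simp add: prob_space)
  have AR: "A i k = R i k" if k: "k \<in> J" for k
  proof -
    note gk = centered_gaussianD[OF Y_component[OF k]]
    have iy: "integrable M (\<lambda>\<omega>. Y \<omega> j * Y \<omega> k)" if "j \<in> J" for j
      using centered_gaussianD[OF Y_component[OF that]] gk by (intro integrable_mult_of_square)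
    have "0 = expectation (\<lambda>\<omega>. L \<omega> * Y \<omega> k)"
    proof -
      have "AE \<omega> in M. L \<omega> * Y \<omega> k = 0" using L by eventually_elim (simp add: b)
      then have "expectation (\<lambda>\<omega>. L \<omega> * Y \<omega> k) = expectation (\<lambda>_. 0)"
        using gL(1) gk(1) by (intro integral_cong_AE) auto
      then show ?thesis by simp
    qed
    also have "\<dots> = expectation (\<lambda>\<omega>. \<Sum>j\<in>J. (A i j - R i j) * (Y \<omega> j * Y \<omega> k))"
      by (simp add: L_def sum_distrib_right mult.assoc)
    also have "\<dots> = (\<Sum>j\<in>J. (A i j - R i j) * (if j = k then var j else 0))"
      using k by (simp add: Bochner_Integration.integral_sum iy cov_Y)
    also have "\<dots> = (A i k - R i k) * var k"
      using k finite_J by (simp add: if_distrib[of "\<lambda>x. _ * x"] cong: if_cong)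
    finally show ?thesis using var_pos[OF k] by simp
  qed
  show ?thesis unfolding A[OF y i] b mat_vec_def by (simp add: AR)
qed

definition shift :: "('j \<Rightarrow> real) \<Rightarrow> ('i \<Rightarrow> real) \<Rightarrow> 'i \<Rightarrow> real" where
  "shift y z = (\<lambda>i\<in>I. mat_vec J R y i + z i)"

definition kernel :: "('j \<Rightarrow> real) \<Rightarrow> ('i \<Rightarrow> real) measure" where
  "kernel y = distr (distr M (borel_vec I) residual) (borel_vec I) (shift y)"

lemma shift_measurable2: "(\<lambda>(y, z). shift y z) \<in> borel_vec J \<Otimes>\<^sub>M borel_vec I \<rightarrow>\<^sub>M borel_vec I"
  unfolding shift_def case_prod_beta'
proof (rule measurable_restrict)
  fix i assume "i \<in> I"
  then show "(\<lambda>p. mat_vec J R (fst p) i + snd p i) \<in> borel_measurable (borel_vec J \<Otimes>\<^sub>M borel_vec I)"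
    by (intro borel_measurable_add measurable_compose[OF measurable_fst mat_vec_measurable]
        measurable_compose[OF measurable_snd measurable_component_singleton])
qed

lemma shift_measurable: "shift y \<in> borel_vec I \<rightarrow>\<^sub>M borel_vec I"
  unfolding shift_def
proof (rule measurable_restrict)
  fix i assume "i \<in> I"
  then show "(\<lambda>z. mat_vec J R y i + z i) \<in> borel_measurable (borel_vec I)"
    by (intro borel_measurable_add measurable_component_singleton) simp_all
qed

lemma kernel_measurable: "kernel \<in> borel_vec J \<rightarrow>\<^sub>M prob_algebra (borel_vec I)"
  unfolding kernel_def
proof (rule measurable_distr_prob_space2[OF _ shift_measurable2])
  have "distr M (borel_vec I) residual \<in> space (prob_algebra (borel_vec I))"
    using prob_space_distr[OF residual_measurable] by (simp add: space_prob_algebra)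
  then show "(\<lambda>_. distr M (borel_vec I) residual) \<in> borel_vec J \<rightarrow>\<^sub>M prob_algebra (borel_vec I)"
    by (rule measurable_const)
qed

lemma kernel_eq: "kernel y = distr M (borel_vec I) (\<lambda>\<omega>. shift y (residual \<omega>))"
  unfolding kernel_def using distr_distr[OF shift_measurable residual_measurable] by (simp add: comp_def)

text \<open>Since \<open>V = R Y + residual\<close> with independent summands, Fubini in the product of their laws shows that
  the law of \<open>R y + residual\<close> disintegrates \<open>V\<close> along \<open>Y\<close>.\<close>
lemma regular_cond_distr_kernel: "regular_cond_distr M V (borel_vec I) Y (borel_vec J) kernel"
  unfolding regular_cond_distr_def
proof (intro conjI ballI kernel_measurable)
  let ?PI = "borel_vec I" and ?PJ = "borel_vec J"
  let ?\<mu> = "distr M ?PI residual" and ?\<nu> = "distr M ?PJ Y"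
  interpret \<mu>: prob_space ?\<mu> by (rule prob_space_distr[OF residual_measurable])
  interpret \<nu>: prob_space ?\<nu> by (rule prob_space_distr[OF Y_meas])
  interpret \<mu>\<nu>: pair_prob_space ?\<mu> ?\<nu> ..
  have pm: "(\<lambda>\<omega>. (residual \<omega>, Y \<omega>)) \<in> M \<rightarrow>\<^sub>M ?PI \<Otimes>\<^sub>M ?PJ" using residual_measurable Y_meas by (rule measurable_Pair)
  fix B assume B: "B \<in> sets ?PI"
  have Bm: "(indicator B :: _ \<Rightarrow> real) \<in> borel_measurable ?PI" using B by (rule borel_measurable_indicator)
  have km: "(\<lambda>y. measure (kernel y) B) \<in> borel_measurable ?PJ"
    by (rule measurable_compose[OF measurable_prob_algebraD[OF kernel_measurable] measurable_measure_subprob_algebra[OF B]])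
  show "AE \<omega> in M. cond_exp_given M Y ?PJ (\<lambda>\<omega>'. indicator B (V \<omega>')) \<omega> = measure (kernel (Y \<omega>)) B"
  proof (rule cond_exp_given_charact[OF Y_meas _ km])
    show "integrable M (\<lambda>\<omega>. indicator B (V \<omega>) :: real)"
      by (rule integrable_const_bound[of _ 1])
        (use measurable_compose[OF V_meas Bm] in \<open>auto simp: indicator_def\<close>)
    show "integrable M (\<lambda>\<omega>. measure (kernel (Y \<omega>)) B)"
    proof (rule integrable_const_bound[of _ 1])
      show "AE \<omega> in M. norm (measure (kernel (Y \<omega>)) B) \<le> 1"
      proof (rule AE_I2)
        fix \<omega> assume "\<omega> \<in> space M"
        from measurable_space[OF kernel_measurable measurable_space[OF Y_meas this]]
        have "prob_space (kernel (Y \<omega>))" by (simp add: space_prob_algebra)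
        from prob_space.prob_le_1[OF this] show "norm (measure (kernel (Y \<omega>)) B) \<le> 1" by simp
      qed
    qed (rule measurable_compose[OF Y_meas km])
    fix A assume A: "A \<in> sets ?PJ"
    have Am: "(indicator A :: _ \<Rightarrow> real) \<in> borel_measurable ?PJ" using A by (rule borel_measurable_indicator)
    let ?f = "\<lambda>z y. indicator A y * indicator B (shift y z) :: real"
    have fm: "case_prod ?f \<in> borel_measurable (?PI \<Otimes>\<^sub>M ?PJ)"
      using measurable_compose[OF measurable_pair_swap' shift_measurable2] measurable_compose[OF measurable_snd Am]
      unfolding case_prod_beta' by (intro borel_measurable_times measurable_compose[OF _ Bm]) simp_all
    have fi: "integrable (?\<mu> \<Otimes>\<^sub>M ?\<nu>) (case_prod ?f)"
      by (rule \<mu>\<nu>.P.integrable_const_bound[of _ 1]) (use fm in \<open>auto simp: indicator_def\<close>)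
    have inner: "(\<integral>z. ?f z y \<partial>?\<mu>) = indicator A y * measure (kernel y) B" for y
    proof -
      have "(\<integral>z. indicator B (shift y z) \<partial>?\<mu>) = (\<integral>x. indicator B x \<partial>kernel y :: real)"
        unfolding kernel_def by (rule integral_distr[symmetric]) (simp_all add: measurable_distr_eq1 shift_measurable Bm)
      also have "\<dots> = measure (kernel y) B"
        using sets.sets_into_space[OF B] by (simp add: kernel_def Int_absorb2)
      finally show ?thesis by simp
    qed
    have "expectation (\<lambda>\<omega>. indicator A (Y \<omega>) * indicator B (V \<omega>)) = expectation (\<lambda>\<omega>. case_prod ?f (residual \<omega>, Y \<omega>))"
      by (rule Bochner_Integration.integral_cong) (simp_all add: V_eq shift_def)
    also have "\<dots> = (\<integral>p. case_prod ?f p \<partial>(?\<mu> \<Otimes>\<^sub>M ?\<nu>))"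
      unfolding residual_independent by (rule integral_distr[OF pm fm, symmetric])
    also have "\<dots> = (\<integral>y. (\<integral>z. ?f z y \<partial>?\<mu>) \<partial>?\<nu>)"
      by (rule \<mu>\<nu>.integral_snd[OF fi, symmetric])
    also have "\<dots> = (\<integral>y. indicator A y * measure (kernel y) B \<partial>?\<nu>)"
      unfolding inner ..
    also have "\<dots> = expectation (\<lambda>\<omega>. indicator A (Y \<omega>) * measure (kernel (Y \<omega>)) B)"
      by (rule integral_distr[OF Y_meas borel_measurable_times[OF Am km]])
    finally show "expectation (\<lambda>\<omega>. indicator A (Y \<omega>) * indicator B (V \<omega>)) =
        expectation (\<lambda>\<omega>. indicator A (Y \<omega>) * measure (kernel (Y \<omega>)) B)" .
  qed
qed

abbreviation regression_error :: "'a \<Rightarrow> 'i \<Rightarrow> real" where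
  "regression_error \<equiv> \<lambda>\<omega> i. V \<omega> i - cond_exp_given M Y (borel_vec J) (\<lambda>\<omega>'. V \<omega>' i) \<omega>"

lemma regression_error_eq:
  assumes i: "i \<in> I"
  shows "AE \<omega> in M. regression_error \<omega> i = residual \<omega> i"
  using cond_exp_V[OF i] by eventually_elim (simp add: residual_def i)

lemma regression_error_measurable:
  "i \<in> I \<Longrightarrow> (\<lambda>\<omega>. regression_error \<omega> i) \<in> borel_measurable M"
  unfolding cond_exp_given_def
  by (intro borel_measurable_diff borel_measurable_cond_exp2 centered_gaussianD(1)[OF V_component])

text \<open>The regression error is defined through a version of the conditional expectation, so it agrees with
  the residual only almost surely; that is enough for second moments.\<close>
lemma cov_regression_error:
  assumes i: "i \<in> I" and k: "k \<in> I"
  shows "cov_mat M regression_error i k = expectation (\<lambda>\<omega>. residual \<omega> i * residual \<omega> k)"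
proof -
  have mean: "expectation (\<lambda>\<omega>. regression_error \<omega> i) = 0" if "i \<in> I" for i
  proof -
    note g = centered_gaussianD[OF residual.V_component[OF that]]
    have "expectation (\<lambda>\<omega>. regression_error \<omega> i) = expectation (\<lambda>\<omega>. residual \<omega> i)"
      by (rule integral_cong_AE[OF regression_error_measurable[OF that] g(1) regression_error_eq[OF that]])
    then show ?thesis by (simp add: g(4))
  qed
  have "expectation (\<lambda>\<omega>. regression_error \<omega> i * regression_error \<omega> k) = expectation (\<lambda>\<omega>. residual \<omega> i * residual \<omega> k)"
  proof (rule integral_cong_AE)
    show "AE \<omega> in M. regression_error \<omega> i * regression_error \<omega> k = residual \<omega> i * residual \<omega> k"
      using regression_error_eq[OF i] regression_error_eq[OF k] by eventually_elim simp
  qed (intro borel_measurable_times regression_error_measurable i k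
      centered_gaussianD(1)[OF residual.V_component[OF i]] centered_gaussianD(1)[OF residual.V_component[OF k]])+
  then show ?thesis unfolding cov_mat_def mean[OF i] mean[OF k] by simp
qed

lemma is_normal_kernel:
  "is_normal I (mat_vec J R y) (cov_mat M regression_error) (kernel y)"
proof -
  let ?C = "cov_mat M regression_error"
  have q: "(\<Sum>i\<in>I. \<Sum>k\<in>I. u i * ?C i k * u k) = expectation (\<lambda>\<omega>. (\<Sum>i\<in>I. u i * residual \<omega> i)\<^sup>2)" for u
  proof -
    have "(\<Sum>i\<in>I. \<Sum>k\<in>I. u i * ?C i k * u k) =
        (\<Sum>i\<in>I. \<Sum>k\<in>I. u i * expectation (\<lambda>\<omega>. residual \<omega> i * residual \<omega> k) * u k)"
      by (intro sum.cong refl) (simp only: cov_regression_error)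
    also have "\<dots> = expectation (\<lambda>\<omega>. (\<Sum>i\<in>I. u i * residual \<omega> i)\<^sup>2)"
      by (rule integral_quadratic_form[OF finite_I])
        (use centered_gaussianD[OF residual.V_component] in blast)+
    finally show ?thesis .
  qed
  have sm: "(\<lambda>\<omega>. shift y (residual \<omega>)) \<in> M \<rightarrow>\<^sub>M borel_vec I"
    by (rule measurable_compose[OF residual_measurable shift_measurable])
  have lin: "distr (kernel y) borel (\<lambda>x. \<Sum>i\<in>I. u i * x i) =
      normal_real (\<Sum>i\<in>I. u i * mat_vec J R y i) (expectation (\<lambda>\<omega>. (\<Sum>i\<in>I. u i * residual \<omega> i)\<^sup>2))" for u
  proof -
    let ?m = "\<Sum>i\<in>I. u i * mat_vec J R y i" and ?U = "\<lambda>\<omega>. \<Sum>i\<in>I. u i * residual \<omega> i"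
    note g = centered_gaussianD[OF residual.V_lin[of u]]
    have "(\<lambda>x. \<Sum>i\<in>I. u i * x i) \<in> borel_measurable (borel_vec I)" by measurable
    from distr_distr[OF this sm]
    have "distr (kernel y) borel (\<lambda>x. \<Sum>i\<in>I. u i * x i) = distr M borel (\<lambda>\<omega>. ?m + ?U \<omega>)"
      unfolding kernel_eq by (simp add: comp_def shift_def distrib_left sum.distrib)
    also have "\<dots> = normal_real ?m (expectation (\<lambda>\<omega>. (?U \<omega>)\<^sup>2))"
    proof (rule distr_eq_normal_realI)
      show "(\<lambda>\<omega>. ?m + ?U \<omega>) \<in> borel_measurable M" using g(1) by simp
      fix \<theta>
      have "(CLINT \<omega>|M. iexp (\<theta> * (?m + ?U \<omega>))) = (CLINT \<omega>|M. iexp (\<theta> * ?m) * iexp (\<theta> * ?U \<omega>))"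
        by (simp only: distrib_left of_real_add exp_add)
      also have "\<dots> = iexp (\<theta> * ?m) * (CLINT \<omega>|M. iexp (\<theta> * ?U \<omega>))"
        by (rule integral_mult_right_zero)
      also have "(CLINT \<omega>|M. iexp (\<theta> * ?U \<omega>)) = of_real (exp (- (\<theta>\<^sup>2 * expectation (\<lambda>\<omega>. (?U \<omega>)\<^sup>2)) / 2))"
        using centered_gaussianD(6)[OF centered_gaussian_scale[OF residual.V_lin[of u], of \<theta>]]
        by (simp only: power_mult_distrib integral_mult_right_zero)
      finally show "(CLINT \<omega>|M. iexp (\<theta> * (?m + ?U \<omega>))) =
          iexp (\<theta> * ?m) * of_real (exp (- (\<theta>\<^sup>2 * expectation (\<lambda>\<omega>. (?U \<omega>)\<^sup>2)) / 2))" .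
    qed simp
    finally show ?thesis .
  qed
  have "?C i k = ?C k i" for i k by (simp add: cov_mat_def mult.commute)
  moreover have "prob_space (kernel y)" unfolding kernel_eq by (rule prob_space_distr[OF sm])
  moreover have "sets (kernel y) = sets (borel_vec I)" by (simp add: kernel_def)
  ultimately show ?thesis unfolding is_normal_def by (auto simp: q lin)
qed

text \<open>Existence is the disintegration just proved. For uniqueness, every competitor is Gaussian with the
  same covariance matrix, and with the same mean by uniqueness of the affine regression function.\<close>
theorem cond_law_eq_kernel:
  assumes y: "y \<in> vecs J"
  shows "cond_law M I V J Y y = kernel y"
  unfolding cond_law_def
proof (rule the_equality)
  have "affine_regression M I V J Y (mat_vec J R)"
    unfolding affine_regression_def using cond_exp_V
    by (intro conjI ballI exI[of _ R] exI[of _ "\<lambda>_. 0"]) auto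
  then have "gaussian_cond_kernel M I V J Y kernel"
    unfolding gaussian_cond_kernel_def using regular_cond_distr_kernel is_normal_kernel by blast
  then show "\<exists>\<nu>. gaussian_cond_kernel M I V J Y \<nu> \<and> kernel y = \<nu> y" by blast
next
  fix \<mu> assume "\<exists>\<nu>. gaussian_cond_kernel M I V J Y \<nu> \<and> \<mu> = \<nu> y"
  then obtain a where a: "affine_regression M I V J Y a"
    and n: "is_normal I (a y) (cov_mat M regression_error) \<mu>"
    unfolding gaussian_cond_kernel_def using y by blast
  show "\<mu> = kernel y"
    by (rule is_normal_unique[OF finite_I n is_normal_kernel]) (rule affine_regression_unique[OF a _ y])
qed

end

section \<open>The reversed sampling scheme has the joint law\<close>

lemma bilinear_mat_mul:
  "(\<Sum>j\<in>J. \<Sum>k\<in>K. a j * mat_mul I S Q j k * b k) =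
   (\<Sum>i\<in>I. (\<Sum>j\<in>J. a j * S j i) * (\<Sum>k\<in>K. Q i k * b k))"
proof -
  have "(\<Sum>j\<in>J. \<Sum>k\<in>K. a j * mat_mul I S Q j k * b k) =
      (\<Sum>j\<in>J. \<Sum>k\<in>K. \<Sum>i\<in>I. (a j * S j i) * (Q i k * b k))"
    by (simp add: mat_mul_def sum_distrib_left sum_distrib_right mult.assoc)
  also have "\<dots> = (\<Sum>j\<in>J. \<Sum>i\<in>I. \<Sum>k\<in>K. (a j * S j i) * (Q i k * b k))"
    by (intro sum.cong refl sum.swap)
  also have "\<dots> = (\<Sum>i\<in>I. \<Sum>j\<in>J. \<Sum>k\<in>K. (a j * S j i) * (Q i k * b k))"
    by (rule sum.swap)
  finally show ?thesis by (simp add: sum_product)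
qed

lemma quadratic_form_congruence:
  "(\<Sum>j\<in>J. \<Sum>k\<in>J. w j * mat_mul I S (mat_mul I C (mat_transpose S)) j k * w k) =
   (\<Sum>i\<in>I. \<Sum>l\<in>I. (\<Sum>j\<in>J. w j * S j i) * C i l * (\<Sum>k\<in>J. w k * S k l))"
proof -
  define r where "r l = (\<Sum>k\<in>J. w k * S k l)" for l
  have "(\<Sum>k\<in>J. mat_mul I C (mat_transpose S) i k * w k) = (\<Sum>l\<in>I. C i l * r l)" for i
  proof -
    have "(\<Sum>k\<in>J. mat_mul I C (mat_transpose S) i k * w k) = (\<Sum>k\<in>J. \<Sum>l\<in>I. C i l * (w k * S k l))"
      unfolding mat_mul_def mat_transpose_def sum_distrib_right by (simp add: mult_ac)
    also have "\<dots> = (\<Sum>l\<in>I. \<Sum>k\<in>J. C i l * (w k * S k l))" by (rule sum.swap)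
    finally show ?thesis by (simp add: r_def sum_distrib_left)
  qed
  then show ?thesis
    unfolding bilinear_mat_mul r_def[symmetric] by (simp add: sum_distrib_left mult.assoc)
qed

lemma linear_form_mat_vec:
  "(\<Sum>j\<in>J. w j * mat_vec I S v j) = (\<Sum>i\<in>I. (\<Sum>j\<in>J. w j * S j i) * v i)"
  unfolding mat_vec_def sum_distrib_left sum_distrib_right mult.assoc[symmetric] by (rule sum.swap)

context gaussian_pair begin

lemma cov_mat_V: "i \<in> I \<Longrightarrow> k \<in> I \<Longrightarrow> cov_mat M V i k = expectation (\<lambda>\<omega>. V \<omega> i * V \<omega> k)"
  using centered_gaussianD(4)[OF V_component] by (simp add: cov_mat_def)

lemma cov_mat_Y: "j \<in> J \<Longrightarrow> k \<in> J \<Longrightarrow> cov_mat M Y j k = expectation (\<lambda>\<omega>. Y \<omega> j * Y \<omega> k)"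
  using centered_gaussianD(4)[OF Y_component] by (simp add: cov_mat_def)

text \<open>Let \<open>E\<close> be the part of \<open>w \<cdot> Y\<close> orthogonal to \<open>V\<close>. The conditional covariance matrix in the
  hypothesis evaluates at \<open>w\<close> to the variance \<open>q\<close> of \<open>E\<close>, so integrating out \<open>G\<close> leaves
  \<open>exp (- q / 2)\<close> times the characteristic function of a linear form in \<open>V'\<close>, whose law is that of \<open>V\<close>.
  The variances of that linear form and of \<open>E\<close> add up to the variance of \<open>u \<cdot> V + w \<cdot> Y\<close>.\<close>
lemma reversed_sampling_char:
  fixes P :: "'b measure" and S :: "'j \<Rightarrow> 'i \<Rightarrow> real"
  assumes P: "prob_space P" and V': "V' \<in> P \<rightarrow>\<^sub>M borel_vec I" and G: "G \<in> P \<rightarrow>\<^sub>M borel_vec J"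
    and law: "distr P (borel_vec I) V' = distr M (borel_vec I) V"
    and regr: "\<And>j. j \<in> J \<Longrightarrow> AE \<omega> in M.
      cond_exp_given M V (borel_vec I) (\<lambda>\<omega>'. Y \<omega>' j) \<omega> = mat_vec I S (V \<omega>) j"
    and reg: "regular_cond_distr P G (borel_vec J) V' (borel_vec I) \<kappa>"
    and normal: "\<And>v. v \<in> vecs I \<Longrightarrow> is_normal J (mat_vec I S v)
      (\<lambda>j k. cov_mat M Y j k - mat_mul I S (mat_mul I (cov_mat M V) (mat_transpose S)) j k) (\<kappa> v)"
  shows "(CLINT \<omega>|P. iexp ((\<Sum>i\<in>I. u i * V' \<omega> i) + (\<Sum>j\<in>J. w j * G \<omega> j))) =
    (CLINT \<omega>|M. iexp ((\<Sum>i\<in>I. u i * V \<omega> i) + (\<Sum>j\<in>J. w j * Y \<omega> j)))"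
proof -
  interpret P: prob_space P by (rule P)
  define r where "r i = (\<Sum>j\<in>J. w j * S j i)" for i
  define B where "B \<omega> = (\<Sum>i\<in>I. r i * V \<omega> i)" for \<omega>
  define E where "E \<omega> = (\<Sum>j\<in>J. w j * Y \<omega> j) - B \<omega>" for \<omega>
  define q where "q = expectation (\<lambda>\<omega>. (E \<omega>)\<^sup>2)"
  note gV = centered_gaussianD[OF V_component] and gY = centered_gaussianD[OF Y_component]
  note gu = centered_gaussianD[OF V_lin] and gw = centered_gaussianD[OF Y_lin[of w]]
  have gB: "centered_gaussian M B" unfolding B_def by (rule V_lin)
  note gB = centered_gaussianD[OF gB]
  have B_eq: "B \<omega> = (\<Sum>j\<in>J. w j * mat_vec I S (V \<omega>) j)" for \<omega>
    unfolding B_def r_def by (rule linear_form_mat_vec[symmetric])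
  have Em: "E \<in> borel_measurable M" unfolding E_def by (rule borel_measurable_diff[OF gw(1) gB(1)])
  have E2: "integrable M (\<lambda>\<omega>. (E \<omega>)\<^sup>2)"
    using integrable_square_add[OF gw(1) borel_measurable_uminus[OF gB(1)] gw(3)] gB(3) by (simp add: E_def)
  have iVY: "integrable M (\<lambda>\<omega>. V \<omega> i * Y \<omega> j)" if "i \<in> I" "j \<in> J" for i j
    using gV[OF that(1)] gY[OF that(2)] by (intro integrable_mult_of_square)
  have orth1: "expectation (\<lambda>\<omega>. V \<omega> i * E \<omega>) = 0" if i: "i \<in> I" for i
  proof -
    have mS: "(\<lambda>v. mat_vec I S v j) \<in> borel_measurable (borel_vec I)" for j
      unfolding mat_vec_def by measurable
    have e: "expectation (\<lambda>\<omega>. V \<omega> i * mat_vec I S (V \<omega>) j) = expectation (\<lambda>\<omega>. V \<omega> i * Y \<omega> j)" if j: "j \<in> J" for j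
      by (rule cond_exp_given_inner[OF V_meas, where f = "\<lambda>v. v i" and h = "\<lambda>v. mat_vec I S v j"])
        (use i j gY(1)[OF j] iVY[OF i j] regr[OF j] mS in auto)
    have iVS: "integrable M (\<lambda>\<omega>. V \<omega> i * mat_vec I S (V \<omega>) j)" for j
      unfolding mat_vec_def using gV[OF i] gu by (intro integrable_mult_of_square)
    have "expectation (\<lambda>\<omega>. V \<omega> i * E \<omega>) =
        expectation (\<lambda>\<omega>. (\<Sum>j\<in>J. w j * (V \<omega> i * Y \<omega> j)) - (\<Sum>j\<in>J. w j * (V \<omega> i * mat_vec I S (V \<omega>) j)))"
      by (simp add: E_def B_eq right_diff_distrib sum_distrib_left mult.left_commute)
    also have "\<dots> = (\<Sum>j\<in>J. w j * expectation (\<lambda>\<omega>. V \<omega> i * Y \<omega> j)) -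
        (\<Sum>j\<in>J. w j * expectation (\<lambda>\<omega>. V \<omega> i * mat_vec I S (V \<omega>) j))"
      using iVY[OF i] iVS by (simp add: Bochner_Integration.integral_sum)
    also have "\<dots> = 0" by (simp add: e)
    finally show ?thesis .
  qed
  have orth: "expectation (\<lambda>\<omega>. (\<Sum>i\<in>I. a i * V \<omega> i) * E \<omega>) = 0" for a
  proof -
    have iVE: "integrable M (\<lambda>\<omega>. V \<omega> i * E \<omega>)" if "i \<in> I" for i
      using gV[OF that] Em E2 by (intro integrable_mult_of_square)
    have "expectation (\<lambda>\<omega>. (\<Sum>i\<in>I. a i * V \<omega> i) * E \<omega>) = expectation (\<lambda>\<omega>. \<Sum>i\<in>I. a i * (V \<omega> i * E \<omega>))"
      by (simp add: sum_distrib_right mult.assoc)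
    also have "\<dots> = 0" by (simp add: Bochner_Integration.integral_sum iVE orth1)
    finally show ?thesis .
  qed
  have pyth: "expectation (\<lambda>\<omega>. ((\<Sum>i\<in>I. a i * V \<omega> i) + E \<omega>)\<^sup>2) = expectation (\<lambda>\<omega>. (\<Sum>i\<in>I. a i * V \<omega> i)\<^sup>2) + q" for a
    unfolding q_def integral_square_add[OF gu(1) Em gu(3) E2] orth by simp
  let ?C = "\<lambda>j k. cov_mat M Y j k - mat_mul I S (mat_mul I (cov_mat M V) (mat_transpose S)) j k"
  have quad: "(\<Sum>j\<in>J. \<Sum>k\<in>J. w j * ?C j k * w k) = q"
  proof -
    have "(\<Sum>j\<in>J. \<Sum>k\<in>J. w j * ?C j k * w k) = (\<Sum>j\<in>J. \<Sum>k\<in>J. w j * cov_mat M Y j k * w k) -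
        (\<Sum>i\<in>I. \<Sum>l\<in>I. r i * cov_mat M V i l * r l)"
      unfolding r_def quadratic_form_congruence[symmetric]
      by (simp add: right_diff_distrib left_diff_distrib sum_subtractf)
    also have "(\<Sum>j\<in>J. \<Sum>k\<in>J. w j * cov_mat M Y j k * w k) =
        (\<Sum>j\<in>J. \<Sum>k\<in>J. w j * expectation (\<lambda>\<omega>. Y \<omega> j * Y \<omega> k) * w k)"
      by (intro sum.cong refl) (simp only: cov_mat_Y)
    also have "\<dots> = expectation (\<lambda>\<omega>. (\<Sum>j\<in>J. w j * Y \<omega> j)\<^sup>2)"
      by (rule integral_quadratic_form[OF finite_J gY(1) gY(3)])
    also have "(\<Sum>i\<in>I. \<Sum>l\<in>I. r i * cov_mat M V i l * r l) =
        (\<Sum>i\<in>I. \<Sum>l\<in>I. r i * expectation (\<lambda>\<omega>. V \<omega> i * V \<omega> l) * r l)"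
      by (intro sum.cong refl) (simp only: cov_mat_V)
    also have "\<dots> = expectation (\<lambda>\<omega>. (B \<omega>)\<^sup>2)"
      unfolding B_def by (rule integral_quadratic_form[OF finite_I gV(1) gV(3)])
    also have "expectation (\<lambda>\<omega>. (\<Sum>j\<in>J. w j * Y \<omega> j)\<^sup>2) = expectation (\<lambda>\<omega>. ((\<Sum>i\<in>I. r i * V \<omega> i) + E \<omega>)\<^sup>2)"
      by (simp add: E_def B_def)
    finally show ?thesis unfolding pyth B_def by simp
  qed
  define \<psi> where "\<psi> v = (\<Sum>i\<in>I. (u i + r i) * v i)" for v :: "'i \<Rightarrow> real"
  have \<psi>: "(\<Sum>i\<in>I. u i * v i) + (\<Sum>j\<in>J. w j * mat_vec I S v j) = \<psi> v" for v
    unfolding linear_form_mat_vec \<psi>_def r_def by (simp add: distrib_right sum.distrib)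
  have \<psi>m: "\<psi> \<in> borel_measurable (borel_vec I)" unfolding \<psi>_def by measurable
  let ?e = "of_real (exp (- q / 2)) :: complex"
  have q0: "0 \<le> q" unfolding q_def by simp
  have mu: "(\<lambda>v. iexp (\<Sum>i\<in>I. u i * v i)) \<in> borel_measurable (borel_vec I)" by measurable
  have mw: "(\<lambda>g. iexp (\<Sum>j\<in>J. w j * g j)) \<in> borel_measurable (borel_vec J)" by measurable
  have m\<psi>: "(\<lambda>v. iexp (\<psi> v)) \<in> borel_measurable (borel_vec I)" unfolding \<psi>_def by measurable
  have "(CLINT \<omega>|P. iexp ((\<Sum>i\<in>I. u i * V' \<omega> i) + (\<Sum>j\<in>J. w j * G \<omega> j))) =
      (CLINT \<omega>|P. (\<lambda>p. iexp (\<Sum>i\<in>I. u i * fst p i) * iexp (\<Sum>j\<in>J. w j * snd p j)) (V' \<omega>, G \<omega>))"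
    by (simp only: of_real_add distrib_left exp_add fst_conv snd_conv)
  also have "\<dots> = (CLINT \<omega>|P. ?e * iexp (\<psi> (V' \<omega>)))"
  proof (rule P.regular_cond_distr_integral_complex[OF G V' reg, where B = 1 and c = "\<lambda>v. ?e * iexp (\<psi> v)"])
    show "(\<lambda>p. iexp (\<Sum>i\<in>I. u i * fst p i) * iexp (\<Sum>j\<in>J. w j * snd p j)) \<in> borel_measurable (borel_vec I \<Otimes>\<^sub>M borel_vec J)"
      by (intro borel_measurable_times measurable_compose[OF measurable_fst mu] measurable_compose[OF measurable_snd mw])
    show "(\<lambda>v. ?e * iexp (\<psi> v)) \<in> borel_measurable (borel_vec I)"
      by (intro borel_measurable_times borel_measurable_const m\<psi>)
    show "cmod (?e * iexp (\<psi> v)) \<le> 1" for v using q0 by (simp add: norm_mult)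
    fix v :: "'i \<Rightarrow> real" assume "v \<in> space (borel_vec I)"
    then have "v \<in> vecs I" by (simp add: space_PiM)
    from is_normal_char[OF normal[OF this], of w]
    have "(CLINT g|\<kappa> v. iexp (\<Sum>j\<in>J. w j * g j)) = iexp (\<Sum>j\<in>J. w j * mat_vec I S v j) * ?e"
      by (simp only: quad)
    then have "(CLINT g|\<kappa> v. iexp (\<Sum>i\<in>I. u i * v i) * iexp (\<Sum>j\<in>J. w j * g j)) =
        iexp (\<Sum>i\<in>I. u i * v i) * (iexp (\<Sum>j\<in>J. w j * mat_vec I S v j) * ?e)"
      by (simp only: integral_mult_right_zero)
    also have "\<dots> = ?e * iexp (\<psi> v)" unfolding \<psi>[symmetric] of_real_add distrib_left exp_add by (simp only: mult_ac)
    finally show "(CLINT g|\<kappa> v. iexp (\<Sum>i\<in>I. u i * fst (v, g) i) * iexp (\<Sum>j\<in>J. w j * snd (v, g) j)) = ?e * iexp (\<psi> v)"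
      by (simp only: fst_conv snd_conv)
  qed (simp add: norm_mult)
  also have "\<dots> = ?e * (CLINT v|distr P (borel_vec I) V'. iexp (\<psi> v))"
    by (simp only: integral_mult_right_zero integral_distr[OF V' m\<psi>])
  also have "\<dots> = ?e * (CLINT \<omega>|M. iexp (\<Sum>i\<in>I. (u i + r i) * V \<omega> i))"
    unfolding law integral_distr[OF V_meas m\<psi>] unfolding \<psi>_def ..
  also have "\<dots> = of_real (exp (- expectation (\<lambda>\<omega>. ((\<Sum>i\<in>I. (u i + r i) * V \<omega> i) + E \<omega>)\<^sup>2) / 2))"
    unfolding gu(6) pyth by (simp add: add_divide_distrib flip: of_real_mult exp_add)
  also have "\<dots> = of_real (exp (- expectation (\<lambda>\<omega>. ((\<Sum>i\<in>I. u i * V \<omega> i) + (\<Sum>j\<in>J. w j * Y \<omega> j))\<^sup>2) / 2))"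
    by (simp add: E_def B_def distrib_right sum.distrib)
  also have "\<dots> = (CLINT \<omega>|M. iexp ((\<Sum>i\<in>I. u i * V \<omega> i) + (\<Sum>j\<in>J. w j * Y \<omega> j)))"
    by (rule centered_gaussianD(6)[OF gauss, symmetric])
  finally show ?thesis .
qed

end

section \<open>Karhunen-Loeve coefficients\<close>

text \<open>The set of equality is closed and of full measure, so it contains the open interval and hence its
  closure. Nondegeneracy of the interval is essential: a single point is a null set.\<close>
lemma continuous_AE_eq_imp_eq:
  fixes f g :: "real \<Rightarrow> real"
  assumes "a < b" and f: "continuous_on {a..b} f" and g: "continuous_on {a..b} g"
    and ae: "AE t in lborel. t \<in> {a..b} \<longrightarrow> f t = g t" and t: "t \<in> {a..b}"
  shows "f t = g t"
proof -
  let ?C = "{t \<in> {a..b}. f t - g t = 0}"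
  have C: "closed ?C"
    by (rule continuous_closed_preimage_constant) (intro continuous_intros f g closed_atLeastAtMost)+
  have "AE t in lebesgue. t \<in> {a<..<b} \<longrightarrow> t \<in> ?C"
    using AE_completion[OF ae] by eventually_elim auto
  then have "{a<..<b} \<subseteq> ?C"
    using mem_closed_if_AE_lebesgue_open[OF open_greaterThanLessThan C] by blast
  from closure_minimal[OF this C] t \<open>a < b\<close> show ?thesis by auto
qed

context gaussian_process_with_continuous_covariance begin

lemma path_integral_linear:
  fixes e :: "'j \<Rightarrow> real \<Rightarrow> real"
  assumes fin: "finite A" and e: "\<And>j. j \<in> A \<Longrightarrow> continuous_on {0..T} (e j)"
  shows "AE \<omega> in M. path_integral (\<lambda>s. \<Sum>j\<in>A. w j * e j s) \<omega> = (\<Sum>j\<in>A. w j * path_integral (e j) \<omega>)"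
proof -
  have "AE \<omega> in M. \<forall>j\<in>A. integrable lebesgue_T (\<lambda>s. X s \<omega> * e j s)"
    using fin by (rule AE_finite_allI) (rule path_integral_integrable_paths[OF e])
  then show ?thesis
  proof eventually_elim
    fix \<omega> assume i: "\<forall>j\<in>A. integrable lebesgue_T (\<lambda>s. X s \<omega> * e j s)"
    have "path_integral (\<lambda>s. \<Sum>j\<in>A. w j * e j s) \<omega> = (\<integral>s. (\<Sum>j\<in>A. w j * (X s \<omega> * e j s)) \<partial>lebesgue_T)"
      by (simp add: path_integral_def sum_distrib_left mult.left_commute)
    also have "\<dots> = (\<Sum>j\<in>A. w j * path_integral (e j) \<omega>)"
      using i by (simp add: path_integral_def Bochner_Integration.integral_sum)
    finally show "path_integral (\<lambda>s. \<Sum>j\<in>A. w j * e j s) \<omega> = (\<Sum>j\<in>A. w j * path_integral (e j) \<omega>)" .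
  qed
qed

lemma cov_op_eq: "cov_op T M X g r = (\<integral>s. K s r * g s \<partial>lebesgue_T)"
  by (simp add: cov_op_def set_integral_eq_lebesgue_T)

lemma continuous_cov_op:
  assumes g: "continuous_on {0..T} g"
  shows "continuous_on {0..T} (cov_op T M X g)"
proof (rule continuous_on_sequentiallyI)
  obtain C where C: "0 \<le> C" "\<And>s. s \<in> {0..T} \<Longrightarrow> \<bar>g s\<bar> \<le> C" by (rule continuous_bounded[OF g]) blast
  obtain B where B: "0 \<le> B" "\<And>r s. r \<in> {0..T} \<Longrightarrow> s \<in> {0..T} \<Longrightarrow> \<bar>K r s\<bar> \<le> B" by (rule K_bounded) blast
  fix x :: "nat \<Rightarrow> real" and r
  assume x: "\<forall>n. x n \<in> {0..T}" and r: "r \<in> {0..T}" and lim: "x \<longlonglongrightarrow> r"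
  have Kc: "continuous_on {0..T} (\<lambda>s. K s r * g s)" if "r \<in> {0..T}" for r
  proof -
    have "continuous_on {0..T} (\<lambda>s. case (s, r) of (r, s) \<Rightarrow> K r s)"
      by (rule continuous_on_compose2[OF cont]) (use that in \<open>auto intro!: continuous_intros\<close>)
    then show ?thesis using g by (auto intro: continuous_on_mult)
  qed
  show "(\<lambda>n. cov_op T M X g (x n)) \<longlonglongrightarrow> cov_op T M X g r"
    unfolding cov_op_eq
  proof (rule integral_dominated_convergence[where w = "\<lambda>_. B * C"])
    show "(\<lambda>s. K s r * g s) \<in> borel_measurable lebesgue_T" by (rule measurable_lebesgue_T_continuous[OF Kc[OF r]])
    show "(\<lambda>s. K s (x n) * g s) \<in> borel_measurable lebesgue_T" for n
      using x by (intro measurable_lebesgue_T_continuous Kc) blast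
    show "integrable lebesgue_T (\<lambda>_. B * C)" by (rule lebesgue_T.integrable_const)
    show "AE s in lebesgue_T. (\<lambda>n. K s (x n) * g s) \<longlonglongrightarrow> K s r * g s"
    proof (rule AE_I2)
      fix s assume "s \<in> space lebesgue_T"
      then have s: "s \<in> {0..T}" by (simp add: space_lebesgue_T)
      have "(\<lambda>n. case (s, x n) of (r, s) \<Rightarrow> K r s) \<longlonglongrightarrow> (case (s, r) of (r, s) \<Rightarrow> K r s)"
        by (rule continuous_on_tendsto_compose[OF cont tendsto_Pair[OF tendsto_const lim]])
          (use s r x in \<open>auto simp del: atLeastAtMost_iff\<close>)
      then show "(\<lambda>n. K s (x n) * g s) \<longlonglongrightarrow> K s r * g s" by (auto intro: tendsto_mult)
    qed
    show "AE s in lebesgue_T. norm (K s (x n) * g s) \<le> B * C" for n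
    proof (rule AE_I2)
      fix s assume "s \<in> space lebesgue_T"
      then have s: "s \<in> {0..T}" by (simp add: space_lebesgue_T)
      show "norm (K s (x n) * g s) \<le> B * C"
        unfolding real_norm_def abs_mult using B C s x by (intro mult_mono) auto
    qed
  qed
qed

lemma K_commute: "K r s = K s r"
  by (simp add: cov_fun_def mult.commute)

lemma cov_X_path_integral:
  assumes g: "continuous_on {0..T} g" and r: "r \<in> {0..T}"
  shows "expectation (\<lambda>\<omega>. X r \<omega> * path_integral g \<omega>) = cov_op T M X g r"
  unfolding path_integral_inner[OF g X_measurable[OF r] X_moments(2)[OF r]] cov_op_eq
  by (simp add: K_commute[of _ r]) (simp add: cov_fun_def)

end

locale karhunen_loeve = gaussian_process_with_continuous_covariance M T X
  for M :: "'a measure" and T :: real and X :: "real \<Rightarrow> 'a \<Rightarrow> real" +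
  fixes N :: enat and e :: "nat \<Rightarrow> real \<Rightarrow> real" and lam :: "nat \<Rightarrow> real"
  assumes KL: "KL_eigensystem T M X N e lam"
    and e_cont: "\<And>k. k \<in> kl_index N \<Longrightarrow> continuous_on {0..T} (e k)"
    and T_pos: "0 < T"
begin

lemma lam_pos: "k \<in> kl_index N \<Longrightarrow> 0 < lam k"
  using KL by (simp add: KL_eigensystem_def)

lemma orthonormal:
  "k \<in> kl_index N \<Longrightarrow> l \<in> kl_index N \<Longrightarrow> (\<integral>s. e k s * e l s \<partial>lebesgue_T) = (if k = l then 1 else 0)"
  using KL by (simp add: KL_eigensystem_def inner_L2_def set_integral_eq_lebesgue_T)

text \<open>The eigenvalue equation of an eigensystem holds in \<open>L\<^sup>2\<close>, but the marginals sit at fixed times. As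
  the covariance operator has continuous image and the eigenfunctions are continuous, the equation
  holds at every time.\<close>
lemma eigenfunction:
  assumes k: "k \<in> kl_index N" and r: "r \<in> {0..T}"
  shows "cov_op T M X (e k) r = lam k * e k r"
proof (rule continuous_AE_eq_imp_eq[OF T_pos _ _ _ r])
  show "continuous_on {0..T} (cov_op T M X (e k))" by (rule continuous_cov_op[OF e_cont[OF k]])
  show "continuous_on {0..T} (\<lambda>r. lam k * e k r)" by (intro continuous_intros e_cont k)
  show "AE t in lborel. t \<in> {0..T} \<longrightarrow> cov_op T M X (e k) t = lam k * e k t"
    using KL k by (simp add: KL_eigensystem_def eq_L2_def)
qed

lemma cov_X_coefficient:
  "k \<in> kl_index N \<Longrightarrow> r \<in> {0..T} \<Longrightarrow> expectation (\<lambda>\<omega>. X r \<omega> * path_integral (e k) \<omega>) = lam k * e k r"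
  by (simp add: cov_X_path_integral[OF e_cont] eigenfunction del: atLeastAtMost_iff)

lemma cov_coefficients:
  assumes k: "k \<in> kl_index N" and l: "l \<in> kl_index N"
  shows "expectation (\<lambda>\<omega>. path_integral (e k) \<omega> * path_integral (e l) \<omega>) = (if k = l then lam k else 0)"
proof -
  have "expectation (\<lambda>\<omega>. path_integral (e k) \<omega> * path_integral (e l) \<omega>) = (\<integral>s. expectation (\<lambda>\<omega>. path_integral (e k) \<omega> * X s \<omega>) * e l s \<partial>lebesgue_T)"
    by (rule path_integral_inner[OF e_cont[OF l] path_integral_measurable[OF e_cont[OF k]] path_integral_square_integrable[OF e_cont[OF k]]])
  also have "\<dots> = (\<integral>s. lam k * (e k s * e l s) \<partial>lebesgue_T)"
  proof (rule Bochner_Integration.integral_cong[OF refl])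
    fix s assume "s \<in> space lebesgue_T"
    then show "expectation (\<lambda>\<omega>. path_integral (e k) \<omega> * X s \<omega>) * e l s = lam k * (e k s * e l s)"
      using cov_X_coefficient[OF k, of s] by (simp add: space_lebesgue_T mult.commute)
  qed
  also have "\<dots> = (if k = l then lam k else 0)"
    using orthonormal[OF k l] by simp
  finally show ?thesis .
qed

lemma gaussian_regression_on_coefficients:
  assumes t: "\<And>i. i \<in> I \<Longrightarrow> t i \<in> {0..T}" and fin: "finite I" "finite A" and A: "A \<subseteq> kl_index N"
  shows "gaussian_regression M I A (\<lambda>\<omega>. \<lambda>i\<in>I. X (t i) \<omega>)
    (\<lambda>\<omega>. \<lambda>j\<in>A. LINT s:{0..T}|lborel. X s \<omega> * e j s) (\<lambda>i j. e j (t i)) lam"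
proof -
  let ?V = "\<lambda>\<omega>. \<lambda>i\<in>I. X (t i) \<omega>"
  have Y: "(\<lambda>\<omega>. \<lambda>j\<in>A. LINT s:{0..T}|lborel. X s \<omega> * e j s) = (\<lambda>\<omega>. \<lambda>j\<in>A. path_integral (e j) \<omega>)" (is "_ = ?Y")
    by (simp add: path_integral_def set_integral_eq_lebesgue_T)
  have ec: "continuous_on {0..T} (e j)" if "j \<in> A" for j using that A e_cont by blast
  have Vm: "?V \<in> M \<rightarrow>\<^sub>M borel_vec I"
    by (rule measurable_restrict) (rule X_measurable[OF t])
  have Ym: "?Y \<in> M \<rightarrow>\<^sub>M borel_vec A"
    by (rule measurable_restrict) (rule path_integral_measurable[OF ec])
  show ?thesis unfolding Y
  proof unfold_locales
    show "finite I" "finite A" by fact+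
    show "?V \<in> M \<rightarrow>\<^sub>M borel_vec I" "?Y \<in> M \<rightarrow>\<^sub>M borel_vec A" by fact+
    show "centered_gaussian M (\<lambda>\<omega>. (\<Sum>i\<in>I. u i * ?V \<omega> i) + (\<Sum>j\<in>A. w j * ?Y \<omega> j))" for u w
    proof (rule centered_gaussian_cong_AE)
      let ?g = "\<lambda>s. \<Sum>j\<in>A. w j * e j s"
      have g: "continuous_on {0..T} ?g" by (intro continuous_intros ec)
      show "centered_gaussian M (\<lambda>\<omega>. (\<Sum>i\<in>I. u i * X (t i) \<omega>) + path_integral ?g \<omega>)"
        by (rule process_integral_centered_gaussian[OF g fin(1) t])
      show "(\<lambda>\<omega>. (\<Sum>i\<in>I. u i * ?V \<omega> i) + (\<Sum>j\<in>A. w j * ?Y \<omega> j)) \<in> borel_measurable M"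
        by (intro borel_measurable_add borel_measurable_sum borel_measurable_times borel_measurable_const
            measurable_compose[OF Vm measurable_component_singleton] measurable_compose[OF Ym measurable_component_singleton])
      show "AE \<omega> in M. (\<Sum>i\<in>I. u i * X (t i) \<omega>) + path_integral ?g \<omega> = (\<Sum>i\<in>I. u i * ?V \<omega> i) + (\<Sum>j\<in>A. w j * ?Y \<omega> j)"
      proof -
        have "AE \<omega> in M. path_integral ?g \<omega> = (\<Sum>j\<in>A. w j * path_integral (e j) \<omega>)" by (rule path_integral_linear[OF fin(2) ec])
        then show ?thesis by eventually_elim simp
      qed
    qed
    show "0 < lam j" if "j \<in> A" for j using that A lam_pos by blast
    show "expectation (\<lambda>\<omega>. ?Y \<omega> j * ?Y \<omega> k) = (if j = k then lam j else 0)" if "j \<in> A" "k \<in> A" for j k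
      using that cov_coefficients[of j k] subsetD[OF A] by simp
    show "expectation (\<lambda>\<omega>. ?V \<omega> i * ?Y \<omega> j) = lam j * e j (t i)" if "i \<in> I" "j \<in> A" for i j
      using that cov_X_coefficient[of j "t i"] A t[of i] by auto
  qed
qed

end

text \<open>On a degenerate interval every function has norm 0, so there are no normalised eigenfunctions.\<close>
lemma KL_eigensystem_imp_pos:
  assumes "KL_eigensystem T M X N e lam" "k \<in> kl_index N" "0 \<le> T"
  shows "0 < T"
proof (rule ccontr)
  assume "\<not> 0 < T"
  with \<open>0 \<le> T\<close> have "T = 0" by simp
  have "AE s in lborel. s \<noteq> (0::real)" by (rule AE_lborel_singleton)
  then have "AE s in lborel. indicator {0..T} s *\<^sub>R (e k s * e k s) = 0"
    by eventually_elim (simp add: \<open>T = 0\<close>)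
  then have "inner_L2 T (e k) (e k) = 0"
    unfolding inner_L2_def set_lebesgue_integral_def by (rule integral_eq_zero_AE)
  with assms show False by (simp add: KL_eigensystem_def)
qed

section \<open>The conditional law of the marginals\<close>

theorem mainTheorem5:
  fixes M :: "'a measure" and P :: "'b measure"
    and X :: "real \<Rightarrow> 'a \<Rightarrow> real"
    and T :: real and t :: "nat \<Rightarrow> real" and n d :: nat
    and N :: enat and e :: "nat \<Rightarrow> real \<Rightarrow> real" and lam :: "nat \<Rightarrow> real"
    and R_YV :: "nat \<Rightarrow> nat \<Rightarrow> real"
    and V' :: "'b \<Rightarrow> nat \<Rightarrow> real" and G :: "'b \<Rightarrow> nat \<Rightarrow> real"
    and \<kappa> :: "(nat \<Rightarrow> real) \<Rightarrow> (nat \<Rightarrow> real) measure"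
  defines "V \<equiv> \<lambda>\<omega>. \<lambda>i\<in>{0..n}. X (t i) \<omega>"
    and "Y \<equiv> \<lambda>\<omega>. \<lambda>j\<in>{1..d}. LINT s:{0..T}|lborel. X s \<omega> * e j s"
    and "R_VY \<equiv> \<lambda>i j. e j (t i)"
  defines "Z \<equiv> \<lambda>\<omega>. \<lambda>i\<in>{0..n}. V' \<omega> i - mat_vec {1..d} R_VY (G \<omega>) i"
  assumes "prob_space M"
    and "gaussian_process T M X" and "bimeasurable T M X"
    and "\<And>s. s \<in> {0..T} \<Longrightarrow> (\<integral>\<omega>. X s \<omega> \<partial>M) = 0"
    and "continuous_on ({0..T} \<times> {0..T}) (\<lambda>(r, s). cov_fun M X r s)"
    and "KL_eigensystem T M X N e lam"
    and "\<And>k. k \<in> kl_index N \<Longrightarrow> continuous_on {0..T} (e k)"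
    and "t 0 = 0" and "t n = T" and "mono_on {0..n} t"
    and "d \<ge> 1" and "enat d \<le> N"
    and "\<And>j. j \<in> {1..d} \<Longrightarrow> AE \<omega> in M.
           cond_exp_given M V (borel_vec {0..n}) (\<lambda>\<omega>'. Y \<omega>' j) \<omega> = mat_vec {0..n} R_YV (V \<omega>) j"
    and "prob_space P"
    and "V' \<in> P \<rightarrow>\<^sub>M borel_vec {0..n}" and "G \<in> P \<rightarrow>\<^sub>M borel_vec {1..d}"
    and "distr P (borel_vec {0..n}) V' = distr M (borel_vec {0..n}) V"
    and "regular_cond_distr P G (borel_vec {1..d}) V' (borel_vec {0..n}) \<kappa>"
    and "\<And>v. v \<in> vecs {0..n} \<Longrightarrow>
           is_normal {1..d} (mat_vec {0..n} R_YV v)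
             (\<lambda>j k. cov_mat M Y j k -
                mat_mul {0..n} R_YV (mat_mul {0..n} (cov_mat M V) (mat_transpose R_YV)) j k)
             (\<kappa> v)"
  shows "\<forall>y\<in>vecs {1..d}.
           distr P (borel_vec {0..n}) (\<lambda>\<omega>. \<lambda>i\<in>{0..n}. mat_vec {1..d} R_VY y i + Z \<omega> i)
             = cond_law M {0..n} V {1..d} Y y"
proof -
  let ?I = "{0..n}" and ?J = "{1..d}"
  have t: "t i \<in> {0..T}" if "i \<in> ?I" for i
    using mono_onD[OF \<open>mono_on {0..n} t\<close>, of 0 i] mono_onD[OF \<open>mono_on {0..n} t\<close>, of i n] that
    by (simp add: \<open>t 0 = 0\<close> \<open>t n = T\<close>)
  have T: "0 \<le> T" using t[of 0] by simp
  have index: "?J \<subseteq> kl_index N"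
  proof
    fix k assume k: "k \<in> ?J"
    then have "enat k \<le> enat d" by simp
    from order_trans[OF this \<open>enat d \<le> N\<close>] show "k \<in> kl_index N" using k by (simp add: kl_index_def)
  qed
  have "0 < T"
    using index \<open>d \<ge> 1\<close> T by (intro KL_eigensystem_imp_pos[OF \<open>KL_eigensystem T M X N e lam\<close>, of 1]) auto
  interpret M: prob_space M by fact
  interpret karhunen_loeve M T X N e lam
    by unfold_locales fact+
  interpret gaussian_regression M ?I ?J V Y R_VY lam
    unfolding V_def Y_def R_VY_def
    by (rule gaussian_regression_on_coefficients[OF t _ _ index]) simp_all
  have Zm: "Z \<in> P \<rightarrow>\<^sub>M borel_vec ?I"
    unfolding Z_def
    by (intro measurable_restrict borel_measurable_diff measurable_compose[OF \<open>V' \<in> _\<close> measurable_component_singleton]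
        measurable_compose[OF \<open>G \<in> _\<close> mat_vec_measurable])
  interpret P: prob_space P by fact
  have law_Z: "distr P (borel_vec ?I) Z = distr M (borel_vec ?I) residual"
  proof (rule char_unique_PiM)
    show "finite_measure (distr P (borel_vec ?I) Z)" "finite_measure (distr M (borel_vec ?I) residual)"
      using P.finite_measure_distr[OF Zm] M.finite_measure_distr[OF residual_measurable] .
    fix u :: "nat \<Rightarrow> real"
    let ?w = "\<lambda>j. - (\<Sum>i\<in>?I. u i * R_VY i j)"
    have lin: "(\<Sum>i\<in>?I. u i * (v i - mat_vec ?J R_VY g i)) = (\<Sum>i\<in>?I. u i * v i) + (\<Sum>j\<in>?J. ?w j * g j)" for v g
      by (simp add: right_diff_distrib sum_subtractf linear_form_mat_vec sum_negf)
    have um: "(\<lambda>x. iexp (\<Sum>i\<in>?I. u i * x i)) \<in> borel_measurable (borel_vec ?I)" by measurable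
    have "(CLINT x|distr P (borel_vec ?I) Z. iexp (\<Sum>i\<in>?I. u i * x i)) =
        (CLINT \<omega>|P. iexp ((\<Sum>i\<in>?I. u i * V' \<omega> i) + (\<Sum>j\<in>?J. ?w j * G \<omega> j)))"
      unfolding integral_distr[OF Zm um] lin[symmetric] by (simp add: Z_def)
    also have "\<dots> = (CLINT \<omega>|M. iexp ((\<Sum>i\<in>?I. u i * V \<omega> i) + (\<Sum>j\<in>?J. ?w j * Y \<omega> j)))"
      by (rule reversed_sampling_char[OF \<open>prob_space P\<close>]) fact+
    also have "\<dots> = (CLINT x|distr M (borel_vec ?I) residual. iexp (\<Sum>i\<in>?I. u i * x i))"
      unfolding integral_distr[OF residual_measurable um] lin[symmetric] residual_def by simp
    finally show "(CLINT x|distr P (borel_vec ?I) Z. iexp (\<Sum>i\<in>?I. u i * x i)) =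
        (CLINT x|distr M (borel_vec ?I) residual. iexp (\<Sum>i\<in>?I. u i * x i))" .
  qed simp_all
  show ?thesis
  proof
    fix y assume y: "y \<in> vecs ?J"
    have "distr P (borel_vec ?I) (\<lambda>\<omega>. shift y (Z \<omega>)) = distr (distr P (borel_vec ?I) Z) (borel_vec ?I) (shift y)"
      using distr_distr[OF shift_measurable Zm] by (simp add: comp_def)
    also have "\<dots> = cond_law M ?I V ?J Y y"
      unfolding law_Z cond_law_eq_kernel[OF y] kernel_def ..
    finally show "distr P (borel_vec ?I) (\<lambda>\<omega>. \<lambda>i\<in>?I. mat_vec ?J R_VY y i + Z \<omega> i) = cond_law M ?I V ?J Y y"
      by (simp only: shift_def)
  qed
qed

end
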